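(* Let $\mathcal H$ be a Hilbert space, and let $X$ be a bounded operator from $\mathbf L_2(\mathbb R)\otimes\mathcal H$ into itself which commutes with the translation operators $T_h$, $h\in\mathbb R$. Assume that $$UXU^{-1}\left(\mathbf H_2(\mathbb C_+)\otimes\mathcal H\right)\subset\mathbf H_2(\mathbb C_+)\otimes\mathcal H .$$ Then there exists an $\mathbf L(\mathcal H)$-valued function $S$ on $\mathbb C_+$ such that $$(UXU^{-1}f)(t)=S(t)f(t),\qquad f\in\mathbf H_2(\mathbb C_+)\otimes\mathcal H,\ t\in\mathbb C_+ .$$
   Context: $\mathbf L(\mathcal H)$ is the set of bounded operators from $\mathcal H$ into itself. $(T_hf)(t)=f(t+h)$ for $f\in\mathbf L_2(\mathbb R)\otimes\mathcal H$ (the space of square-integrable $\mathcal H$-valued functions on $\mathbb R$). $U$ is the Fourier transform $Uf(t)=\frac1{\sqrt{2\pi}}\int_{\mathbb R}f(x)e^{ixt}\,dx$ on $\mathbf L_2(\mathbb R)\otimes\mathcal H$. $\mathbf H_2(\mathbb C_+)$ is the Hardy space of the open upper half-plane $\mathbb C_+$; $\mathbf H_2(\mathbb C_+)\otimes\mathcal H$ is the $\mathcal H$-valued Hardy space, identified via boundary values with a closed subspace of $\mathbf L_2(\mathbb R)\otimes\mathcal H$, its elements being also regarded as analytic functions on $\mathbb C_+$. *)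

theory Defs
  imports "HOL-Analysis.Analysis"
begin

section \<open>Complex normed spaces and complex Hilbert spaces\<close>

class scaleC =
  fixes scaleC :: "complex \<Rightarrow> 'a \<Rightarrow> 'a"  (infixr "*\<^sub>C" 75)

class complex_normed_vector = scaleC + real_normed_vector +
  assumes scaleC_add_right: "a *\<^sub>C (x + y) = a *\<^sub>C x + a *\<^sub>C y"
    and scaleC_add_left: "(a + b) *\<^sub>C x = a *\<^sub>C x + b *\<^sub>C x"
    and scaleC_scaleC: "a *\<^sub>C b *\<^sub>C x = (a * b) *\<^sub>C x"
    and scaleC_one: "1 *\<^sub>C x = x"
    and scaleR_scaleC: "r *\<^sub>R x = complex_of_real r *\<^sub>C x"
    and norm_scaleC: "norm (a *\<^sub>C x) = cmod a * norm x"

class complex_hilbert = complex_normed_vector + complete_space +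
  fixes cinner :: "'a \<Rightarrow> 'a \<Rightarrow> complex"
  assumes cinner_add_left: "cinner (x + y) z = cinner x z + cinner y z"
    and cinner_scaleC_left: "cinner (a *\<^sub>C x) y = a * cinner x y"
    and cinner_commute: "cinner x y = cnj (cinner y x)"
    and cinner_self: "cinner x x = complex_of_real ((norm x)\<^sup>2)"

instantiation complex :: complex_hilbert
begin

definition scaleC_complex :: "complex \<Rightarrow> complex \<Rightarrow> complex"
  where "scaleC_complex a x = a * x"

definition cinner_complex :: "complex \<Rightarrow> complex \<Rightarrow> complex"
  where "cinner_complex x y = x * cnj y"

instance
proof
  fix x :: complex
  show "cinner x x = complex_of_real ((norm x)\<^sup>2)"
    unfolding cinner_complex_def complex_norm_square[symmetric] by simp
qed (auto simp: scaleC_complex_def cinner_complex_def algebra_simps norm_mult scaleR_conv_of_real)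

end

definition bounded_clinear :: "('a::complex_normed_vector \<Rightarrow> 'b::complex_normed_vector) \<Rightarrow> bool"
  where "bounded_clinear A \<longleftrightarrow> bounded_linear A \<and> (\<forall>c x. A (c *\<^sub>C x) = c *\<^sub>C A x)"


section \<open>Square-integrable vector-valued functions on the real line\<close>

text \<open>
  Strong (Bochner) measurability; for non-separable target spaces it is stronger than
  Borel measurability. Every Bochner--Lebesgue measurable function agrees almost everywhere
  with one that is strongly measurable in the present, Borel, sense, so that the space of
  classes below is the usual one.
\<close>

definition strongly_measurable :: "(real \<Rightarrow> 'a::real_normed_vector) \<Rightarrow> bool"
  where "strongly_measurable f \<longleftrightarrow>
    (\<exists>s. (\<forall>n. simple_function lborel (s n)) \<and> (\<forall>x. (\<lambda>n. s n x) \<longlonglongrightarrow> f x))"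

definition square_integrable :: "(real \<Rightarrow> 'a::real_normed_vector) \<Rightarrow> bool"
  where "square_integrable f \<longleftrightarrow>
    strongly_measurable f \<and> integrable lborel (\<lambda>x. (norm (f x))\<^sup>2)"

lemma strongly_measurable_const: "strongly_measurable (\<lambda>x. c)"
  unfolding strongly_measurable_def by (intro exI[of _ "\<lambda>n x. c"]) auto

lemma strongly_measurable_add:
  assumes "strongly_measurable f" "strongly_measurable g"
  shows "strongly_measurable (\<lambda>x. f x + g x)"
proof -
  obtain s t where
    "\<And>n. simple_function lborel (s n)" "\<And>x. (\<lambda>n. s n x) \<longlonglongrightarrow> f x"
    "\<And>n. simple_function lborel (t n)" "\<And>x. (\<lambda>n. t n x) \<longlonglongrightarrow> g x"
    using assms unfolding strongly_measurable_def by blast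
  then show ?thesis
    unfolding strongly_measurable_def
    by (intro exI[of _ "\<lambda>n x. s n x + t n x"] conjI allI tendsto_add
        simple_function_compose2[where h="(+)"]) auto
qed

lemma bounded_linear_scaleC: "bounded_linear (\<lambda>x::'a::complex_normed_vector. a *\<^sub>C x)"
  by (rule bounded_linear_intro[where K="cmod a"])
    (simp_all add: scaleC_add_right scaleR_scaleC scaleC_scaleC mult.commute norm_scaleC)

lemma strongly_measurable_scaleC:
  fixes f :: "real \<Rightarrow> 'a::complex_normed_vector"
  assumes "strongly_measurable f"
  shows "strongly_measurable (\<lambda>x. a *\<^sub>C f x)"
proof -
  obtain s where
    "\<And>n. simple_function lborel (s n)" "\<And>x. (\<lambda>n. s n x) \<longlonglongrightarrow> f x"
    using assms unfolding strongly_measurable_def by blast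
  then show ?thesis
    unfolding strongly_measurable_def
    by (intro exI[of _ "\<lambda>n x. a *\<^sub>C s n x"] conjI allI simple_function_compose1[where g="scaleC a"]
        bounded_linear.tendsto[OF bounded_linear_scaleC]) auto
qed

lemma measurable_norm_strongly_measurable:
  assumes "strongly_measurable f"
  shows "(\<lambda>x. norm (f x)) \<in> borel_measurable lborel"
proof -
  obtain s where s:
    "\<And>n. simple_function lborel (s n)" "\<And>x. (\<lambda>n. s n x) \<longlonglongrightarrow> f x"
    using assms unfolding strongly_measurable_def by blast
  show ?thesis
  proof (rule borel_measurable_LIMSEQ_real[where u="\<lambda>n x. norm (s n x)"])
    show "(\<lambda>n. norm (s n x)) \<longlonglongrightarrow> norm (f x)" for x
      by (intro tendsto_norm s)
    show "(\<lambda>x. norm (s n x)) \<in> borel_measurable lborel" for n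
      by (intro borel_measurable_simple_function simple_function_compose1[where g=norm] s)
  qed
qed

lemma square_integrable_zero: "square_integrable (\<lambda>x. 0)"
  by (simp add: square_integrable_def strongly_measurable_const)

lemma square_integrable_add:
  assumes "square_integrable f" "square_integrable g"
  shows "square_integrable (\<lambda>x. f x + g x)"
proof -
  have m: "strongly_measurable (\<lambda>x. f x + g x)"
    using assms by (auto simp: square_integrable_def intro: strongly_measurable_add)
  note [measurable] = measurable_norm_strongly_measurable[OF m]
  have "integrable lborel (\<lambda>x. 2 * (norm (f x))\<^sup>2 + 2 * (norm (g x))\<^sup>2)"
    using assms by (auto simp: square_integrable_def)
  then have "integrable lborel (\<lambda>x. (norm (f x + g x))\<^sup>2)"
  proof (rule Bochner_Integration.integrable_bound)
    show "AE x in lborel. norm ((norm (f x + g x))\<^sup>2) \<le> norm (2 * (norm (f x))\<^sup>2 + 2 * (norm (g x))\<^sup>2)"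
    proof (rule AE_I2)
      fix x
      have "(norm (f x + g x))\<^sup>2 \<le> (norm (f x) + norm (g x))\<^sup>2"
        by (intro power_mono norm_triangle_ineq) auto
      also have "\<dots> \<le> 2 * (norm (f x))\<^sup>2 + 2 * (norm (g x))\<^sup>2"
        using zero_le_power2[of "norm (f x) - norm (g x)"]
        by (simp add: power2_eq_square algebra_simps)
      finally show "norm ((norm (f x + g x))\<^sup>2) \<le> norm (2 * (norm (f x))\<^sup>2 + 2 * (norm (g x))\<^sup>2)"
        by simp
    qed
  qed simp
  with m show ?thesis by (simp add: square_integrable_def)
qed

lemma square_integrable_scaleC:
  fixes f :: "real \<Rightarrow> 'a::complex_normed_vector"
  assumes "square_integrable f"
  shows "square_integrable (\<lambda>x. a *\<^sub>C f x)"
  using assms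
  by (auto simp: square_integrable_def norm_scaleC power_mult_distrib
      intro: strongly_measurable_scaleC)

lemma scaleC_minus_one: "(-1) *\<^sub>C x = - (x::'a::complex_normed_vector)"
  using scaleR_scaleC[of "-1" x] by simp

lemma square_integrable_uminus:
  fixes f :: "real \<Rightarrow> 'a::complex_normed_vector"
  shows "square_integrable f \<Longrightarrow> square_integrable (\<lambda>x. - f x)"
  using square_integrable_scaleC[of f "-1"] by (simp add: scaleC_minus_one)

lemma square_integrable_diff:
  fixes f g :: "real \<Rightarrow> 'a::complex_normed_vector"
  shows "square_integrable f \<Longrightarrow> square_integrable g \<Longrightarrow> square_integrable (\<lambda>x. f x - g x)"
  using square_integrable_add[OF _ square_integrable_uminus, of f g] by simp

lemma square_integrable_scaleR:
  fixes f :: "real \<Rightarrow> 'a::complex_normed_vector"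
  shows "square_integrable f \<Longrightarrow> square_integrable (\<lambda>x. r *\<^sub>R f x)"
  by (simp add: scaleR_scaleC square_integrable_scaleC)

lemma square_integrable_translate:
  assumes "square_integrable f"
  shows "square_integrable (\<lambda>t. f (t + h))"
proof -
  obtain s where s:
    "\<And>n. simple_function lborel (s n)" "\<And>x. (\<lambda>n. s n x) \<longlonglongrightarrow> f x"
    using assms unfolding square_integrable_def strongly_measurable_def by blast
  have "simple_function lborel (\<lambda>t. s n (t + h))" for n
  proof -
    have "finite (range (s n))"
      using s(1)[of n] by (simp add: simple_function_def)
    have "s n -` {y} \<in> sets borel" for y
      using s(1)[of n] by (cases "s n -` {y} = {}") (auto simp: simple_function_def)
    then have "(\<lambda>t. t + h) -` (s n -` {y}) \<in> sets borel" for y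
      using measurable_sets[of "\<lambda>t. t + h" borel borel "s n -` {y}"] by simp
    moreover have "(\<lambda>t. s n (t + h)) -` {y} = (\<lambda>t. t + h) -` (s n -` {y})" for y
      by auto
    ultimately show ?thesis
      using finite_subset[OF _ \<open>finite (range (s n))\<close>, of "range (\<lambda>t. s n (t + h))"]
      by (auto simp: simple_function_def)
  qed
  then have "strongly_measurable (\<lambda>t. f (t + h))"
    unfolding strongly_measurable_def using s(2)
    by (intro exI[of _ "\<lambda>n t. s n (t + h)"]) auto
  moreover have "integrable lborel (\<lambda>x. (norm (f (x + h)))\<^sup>2)"
    using lborel_integrable_real_affine[of "\<lambda>x. (norm (f x))\<^sup>2" 1 h] assms
    by (simp add: square_integrable_def add.commute)
  ultimately show ?thesis by (simp add: square_integrable_def)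
qed

lemma AE_translate:
  fixes f g :: "real \<Rightarrow> 'a::complex_normed_vector"
  assumes "square_integrable f" "square_integrable g" "AE x in lborel. f x = g x"
  shows "AE x in lborel. f (x + h) = g (x + h)"
proof -
  have "strongly_measurable (\<lambda>x. f x - g x)"
    using square_integrable_diff[OF assms(1,2)] by (simp add: square_integrable_def)
  note [measurable] = measurable_norm_strongly_measurable[OF this]
  have "AE x in lborel. norm (f (h + 1 * x) - g (h + 1 * x)) = 0"
  proof (rule AE_borel_affine)
    show "Measurable.pred borel (\<lambda>x. norm (f x - g x) = 0)"
      by measurable
    show "AE x in lborel. norm (f x - g x) = 0"
      using assms(3) by (rule eventually_mono) simp
  qed simp
  then show ?thesis by (simp add: add.commute)
qed

definition L2R_rel :: "(real \<Rightarrow> 'a::complex_normed_vector) \<Rightarrow> (real \<Rightarrow> 'a) \<Rightarrow> bool"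
  where "L2R_rel f g \<longleftrightarrow>
    square_integrable f \<and> square_integrable g \<and> (AE x in lborel. f x = g x)"

text \<open>
  The Hilbert space tensor product of the scalar space with \<open>'a\<close>, realized as the space of
  classes of square-integrable \<open>'a\<close>-valued functions; \<open>rep_L2R f\<close> is some representative
  of the class \<open>f\<close>.
\<close>

quotient_type (overloaded) 'a L2R =
  "real \<Rightarrow> 'a::complex_normed_vector" / partial: L2R_rel
proof (rule part_equivpI)
  show "\<exists>f::real \<Rightarrow> 'a. L2R_rel f f"
    using square_integrable_zero by (auto simp: L2R_rel_def)
  show "symp (L2R_rel :: (real \<Rightarrow> 'a) \<Rightarrow> _)"
    by (auto simp: symp_def L2R_rel_def eq_commute)
  show "transp (L2R_rel :: (real \<Rightarrow> 'a) \<Rightarrow> _)"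
    unfolding transp_def L2R_rel_def by (blast intro: eventually_elim2 dest: trans)
qed

definition L2_norm :: "(real \<Rightarrow> 'a::real_normed_vector) \<Rightarrow> real"
  where "L2_norm f = sqrt (\<integral>x. (norm (f x))\<^sup>2 \<partial>lborel)"

lemma L2_norm_nonneg: "0 \<le> L2_norm f"
  by (simp add: L2_norm_def)

lemma L2_norm_power2: "(L2_norm f)\<^sup>2 = (\<integral>x. (norm (f x))\<^sup>2 \<partial>lborel)"
  by (simp add: L2_norm_def)

lemma L2_norm_cong:
  assumes "square_integrable f" "square_integrable g" "AE x in lborel. f x = g x"
  shows "L2_norm f = L2_norm g"
proof -
  have "(\<integral>x. (norm (f x))\<^sup>2 \<partial>lborel) = (\<integral>x. (norm (g x))\<^sup>2 \<partial>lborel)"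
    by (rule integral_cong_AE) (use assms in \<open>auto simp: square_integrable_def elim: eventually_mono\<close>)
  then show ?thesis by (simp add: L2_norm_def)
qed

lemma L2_norm_eq_0_iff:
  assumes "square_integrable f"
  shows "L2_norm f = 0 \<longleftrightarrow> (AE x in lborel. f x = 0)"
  using integral_nonneg_eq_0_iff_AE[of lborel "\<lambda>x. (norm (f x))\<^sup>2"] assms
  by (simp add: L2_norm_def square_integrable_def)

lemma L2_norm_scaleC:
  fixes f :: "real \<Rightarrow> 'a::complex_normed_vector"
  shows "L2_norm (\<lambda>x. a *\<^sub>C f x) = cmod a * L2_norm f"
  by (simp add: L2_norm_def norm_scaleC power_mult_distrib real_sqrt_mult)

lemma L2_norm_triangle:
  assumes f: "square_integrable f" and g: "square_integrable g"
  shows "L2_norm (\<lambda>x. f x + g x) \<le> L2_norm f + L2_norm g"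
proof -
  have *: "L2_norm (\<lambda>x. f x + g x) \<le> a + b" if "L2_norm f < a" "L2_norm g < b" for a b
  proof -
    have ab: "a > 0" "b > 0"
      using that L2_norm_nonneg[of f] L2_norm_nonneg[of g] by linarith+
    have fg: "square_integrable (\<lambda>x. f x + g x)"
      by (rule square_integrable_add[OF f g])
    have ptw: "(norm (f x + g x))\<^sup>2 \<le> (1 + b / a) * (norm (f x))\<^sup>2 + (1 + a / b) * (norm (g x))\<^sup>2" for x
    proof -
      have "(norm (f x + g x))\<^sup>2 \<le> (norm (f x) + norm (g x))\<^sup>2"
        by (intro power_mono norm_triangle_ineq) auto
      moreover have "0 \<le> (b * norm (f x) - a * norm (g x))\<^sup>2 / (a * b)"
        using ab by simp
      moreover have "(1 + b / a) * (norm (f x))\<^sup>2 + (1 + a / b) * (norm (g x))\<^sup>2 - (norm (f x) + norm (g x))\<^sup>2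
          = (b * norm (f x) - a * norm (g x))\<^sup>2 / (a * b)"
        using ab by (simp add: field_simps power2_eq_square)
      ultimately show ?thesis by linarith
    qed
    have "(L2_norm (\<lambda>x. f x + g x))\<^sup>2
        \<le> (\<integral>x. (1 + b / a) * (norm (f x))\<^sup>2 + (1 + a / b) * (norm (g x))\<^sup>2 \<partial>lborel)"
      unfolding L2_norm_power2
      by (rule integral_mono) (use f g fg ptw in \<open>auto simp: square_integrable_def\<close>)
    also have "\<dots> = (1 + b / a) * (L2_norm f)\<^sup>2 + (1 + a / b) * (L2_norm g)\<^sup>2"
      unfolding L2_norm_power2 using f g by (simp add: square_integrable_def)
    also have "\<dots> \<le> (1 + b / a) * a\<^sup>2 + (1 + a / b) * b\<^sup>2"
      using that ab L2_norm_nonneg[of f] L2_norm_nonneg[of g]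
      by (intro add_mono mult_left_mono power_mono) auto
    also have "\<dots> = (a + b)\<^sup>2"
      using ab by (simp add: field_simps power2_eq_square)
    finally show ?thesis
      by (rule power2_le_imp_le) (use ab in linarith)
  qed
  show ?thesis
  proof (rule field_le_epsilon)
    fix e :: real assume "e > 0"
    then show "L2_norm (\<lambda>x. f x + g x) \<le> L2_norm f + L2_norm g + e"
      using *[of "L2_norm f + e / 2" "L2_norm g + e / 2"] by simp
  qed
qed

instantiation L2R :: (complex_normed_vector) complex_normed_vector
begin

lift_definition zero_L2R :: "'a L2R" is "\<lambda>x. 0"
  by (simp add: L2R_rel_def square_integrable_zero)

lift_definition plus_L2R :: "'a L2R \<Rightarrow> 'a L2R \<Rightarrow> 'a L2R" is "\<lambda>f g x. f x + g x"
  unfolding L2R_rel_def by (auto intro: square_integrable_add)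

lift_definition uminus_L2R :: "'a L2R \<Rightarrow> 'a L2R" is "\<lambda>f x. - f x"
  by (auto simp: L2R_rel_def square_integrable_uminus)

lift_definition minus_L2R :: "'a L2R \<Rightarrow> 'a L2R \<Rightarrow> 'a L2R" is "\<lambda>f g x. f x - g x"
  unfolding L2R_rel_def by (auto intro: square_integrable_diff)

lift_definition scaleR_L2R :: "real \<Rightarrow> 'a L2R \<Rightarrow> 'a L2R" is "\<lambda>r f x. r *\<^sub>R f x"
  by (auto simp: L2R_rel_def square_integrable_scaleR elim: eventually_mono)

lift_definition scaleC_L2R :: "complex \<Rightarrow> 'a L2R \<Rightarrow> 'a L2R" is "\<lambda>c f x. c *\<^sub>C f x"
  by (auto simp: L2R_rel_def square_integrable_scaleC elim: eventually_mono)

lift_definition norm_L2R :: "'a L2R \<Rightarrow> real" is L2_norm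
  by (auto simp: L2R_rel_def intro: L2_norm_cong)

definition sgn_L2R :: "'a L2R \<Rightarrow> 'a L2R"
  where "sgn_L2R f = inverse (norm f) *\<^sub>R f"

definition dist_L2R :: "'a L2R \<Rightarrow> 'a L2R \<Rightarrow> real"
  where "dist_L2R f g = norm (f - g)"

definition uniformity_L2R :: "('a L2R \<times> 'a L2R) filter"
  where "uniformity_L2R = (INF e\<in>{0<..}. principal {(x, y). dist x y < e})"

definition open_L2R :: "'a L2R set \<Rightarrow> bool"
  where "open_L2R S = (\<forall>x\<in>S. \<forall>\<^sub>F (x', y) in uniformity. x' = x \<longrightarrow> y \<in> S)"

instance
proof
  fix f g k :: "'a L2R" and a b :: real and c d :: complex
  show "f + g + k = f + (g + k)"
    by transfer (auto simp: L2R_rel_def add.assoc intro!: square_integrable_add)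
  show "f + g = g + f"
    by transfer (auto simp: L2R_rel_def add.commute intro!: square_integrable_add)
  show "0 + f = f"
    by transfer (auto simp: L2R_rel_def)
  show "- f + f = 0"
    by transfer (auto simp: L2R_rel_def square_integrable_zero)
  show "f - g = f + - g"
    by transfer (auto simp: L2R_rel_def square_integrable_diff)
  show "a *\<^sub>R (f + g) = a *\<^sub>R f + a *\<^sub>R g"
    by transfer (auto simp: L2R_rel_def scaleR_add_right
        intro!: square_integrable_add square_integrable_scaleR)
  show "(a + b) *\<^sub>R f = a *\<^sub>R f + b *\<^sub>R f"
    by transfer (auto simp: L2R_rel_def scaleR_add_left
        intro!: square_integrable_add square_integrable_scaleR)
  show "a *\<^sub>R b *\<^sub>R f = (a * b) *\<^sub>R f"
    by transfer (auto simp: L2R_rel_def intro!: square_integrable_scaleR)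
  show "1 *\<^sub>R f = f"
    by transfer (auto simp: L2R_rel_def)
  show "c *\<^sub>C (f + g) = c *\<^sub>C f + c *\<^sub>C g"
    by transfer (auto simp: L2R_rel_def scaleC_add_right
        intro!: square_integrable_add square_integrable_scaleC)
  show "(c + d) *\<^sub>C f = c *\<^sub>C f + d *\<^sub>C f"
    by transfer (auto simp: L2R_rel_def scaleC_add_left
        intro!: square_integrable_add square_integrable_scaleC)
  show "c *\<^sub>C d *\<^sub>C f = (c * d) *\<^sub>C f"
    by transfer (auto simp: L2R_rel_def scaleC_scaleC intro!: square_integrable_scaleC)
  show "1 *\<^sub>C f = f"
    by transfer (auto simp: L2R_rel_def scaleC_one)
  show "a *\<^sub>R f = complex_of_real a *\<^sub>C f"
    by transfer (auto simp: L2R_rel_def scaleR_scaleC intro!: square_integrable_scaleC)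
  show n: "norm (c *\<^sub>C f) = cmod c * norm f" for c
    by transfer (simp add: L2_norm_scaleC)
  show "norm (a *\<^sub>R f) = \<bar>a\<bar> * norm f"
    by (subst \<open>a *\<^sub>R f = complex_of_real a *\<^sub>C f\<close>) (simp add: n)
  show "norm f = 0 \<longleftrightarrow> f = 0"
    by transfer (auto simp: L2R_rel_def L2_norm_eq_0_iff square_integrable_zero)
  show "norm (f + g) \<le> norm f + norm g"
    by transfer (auto simp: L2R_rel_def intro: L2_norm_triangle)
qed (simp_all only: sgn_L2R_def dist_L2R_def uniformity_L2R_def open_L2R_def)

end

lift_definition translation :: "real \<Rightarrow> 'a::complex_normed_vector L2R \<Rightarrow> 'a L2R"
  is "\<lambda>h f t. f (t + h)"
  unfolding L2R_rel_def by (blast intro: square_integrable_translate AE_translate)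


section \<open>The Fourier transform\<close>

text \<open>
  The bounded operator given by the Fourier integral on classes that are moreover integrable
  (Plancherel's theorem and density of these classes give existence and uniqueness).
  The library's Bochner integral is confined to separable target spaces; the gauge integral
  has no such restriction and agrees with the Bochner integral on Bochner-integrable functions.
\<close>

definition fourier :: "'h::complex_hilbert L2R \<Rightarrow> 'h L2R"
  where "fourier = (THE U. bounded_clinear U \<and>
    (\<forall>f. integrable lborel (\<lambda>x. norm (rep_L2R f x)) \<longrightarrow>
      (AE t in lborel. rep_L2R (U f) t =
        (1 / sqrt (2 * pi)) *\<^sub>R integral UNIV (\<lambda>x. exp (\<i> * x * t) *\<^sub>C rep_L2R f x))))"


section \<open>The vector-valued Hardy space of the upper half-plane\<close>

definition analytic_upper :: "(complex \<Rightarrow> 'h::complex_normed_vector) \<Rightarrow> bool"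
  where "analytic_upper F \<longleftrightarrow>
    (\<forall>z. Im z > 0 \<longrightarrow> (\<exists>D. (F has_derivative (\<lambda>h. h *\<^sub>C D)) (at z)))"

definition hardy_function :: "(complex \<Rightarrow> 'h::complex_normed_vector) \<Rightarrow> bool"
  where "hardy_function F \<longleftrightarrow> analytic_upper F \<and>
    (\<exists>C. \<forall>y>0. integrable lborel (\<lambda>x. (norm (F (Complex x y)))\<^sup>2) \<and>
      (\<integral>x. (norm (F (Complex x y)))\<^sup>2 \<partial>lborel) \<le> C)"

definition has_boundary_values :: "(complex \<Rightarrow> 'h::complex_normed_vector) \<Rightarrow> 'h L2R \<Rightarrow> bool"
  where "has_boundary_values F f \<longleftrightarrow>
    (AE x in lborel. ((\<lambda>y. F (Complex x y)) \<longlongrightarrow> rep_L2R f x) (at_right 0))"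

definition hardy2 :: "'h::complex_hilbert L2R set"
  where "hardy2 = {f. \<exists>F. hardy_function F \<and> has_boundary_values F f}"

text \<open>
  The analytic function with boundary values \<open>f \<in> hardy2\<close>; it is determined by \<open>f\<close>
  on the upper half-plane only.
\<close>

definition hardy_ext :: "'h::complex_hilbert L2R \<Rightarrow> complex \<Rightarrow> 'h"
  where "hardy_ext f = (SOME F. hardy_function F \<and> has_boundary_values F f)"

end

theory Submission
  imports Defs "HOL-Probability.Levy" "HOL-Complex_Analysis.Cauchy_Integral_Formula"
    "HOL-Real_Asymp.Real_Asymp"
begin

text \<open>
  Let \<open>M = U X U\<^sup>-\<^sup>1\<close>. The Fourier transform turns the translation by \<open>h\<close> into multiplication by
  \<open>exp (- \<i> h x)\<close>, so \<open>M\<close> commutes with all multiplications by characters. The multiplier is forced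
  to be \<open>S(t) v = (M k)(t)\<close>, where \<open>k\<close> is the kernel \<open>(t - cnj t) / (x - cnj t) * v\<close>, an element
  of the Hardy space with value \<open>v\<close> at \<open>t\<close>. The assertion \<open>(M f)(t) = S(t) f(t)\<close> then says that
  \<open>(M f)(t)\<close> vanishes whenever \<open>f(t)\<close> does.

  To see this, divide: if \<open>f(t) = 0\<close>, then \<open>g = f / (z - t)\<close> is in the Hardy space
  (\<open>hardy_function_divide\<close>), and \<open>f\<close> is the limit for \<open>h \<rightarrow> 0\<close> of
  \<open>(1 - exp (\<i> h (z - t))) g / (- \<i> h)\<close> (\<open>hardy2_zero_approx\<close>). As \<open>M\<close> commutes with multiplication
  by \<open>exp (\<i> h z)\<close>, it maps this to \<open>(1 - exp (\<i> h (z - t))) (M g) / (- \<i> h)\<close>, which has a zero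
  at \<open>t\<close> because \<open>M g\<close> is again in the Hardy space. Evaluation at \<open>t\<close> is continuous
  (\<open>hardy_evaluation_bound\<close>), so \<open>(M f)(t) = 0\<close>. This is
  \<open>modulation_invariant_operator_is_multiplication\<close>. Continuity of evaluation also gives the
  boundedness of \<open>S(t)\<close> and the uniqueness of the analytic function with given boundary values.

  Two analytic facts support the argument. The first is Plancherel's theorem for functions with
  values in an arbitrary Hilbert space (\<open>fourier_unitary\<close>), including that the Fourier transform is
  well defined by its values on integrable functions. It is built on indicator functions of
  intervals times vectors, which span a dense subspace (\<open>total_interval_tensor\<close>); their transforms
  have the right inner products by the inversion formula for characteristic functions
  (\<open>ft_set_Ioc_inner\<close>), and completeness of the space of classes (\<open>L2R_Cauchy_convergent\<close>) allows
  the extension. The conjugate transform is an isometry for the same reason and is the adjoint,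
  which makes the transform unitary. The integral formula for a general integrable function follows
  by testing against intervals (\<open>rep_fourier_eq_integral\<close>).

  The second is the Poisson formula for the boundary values of a Hardy function
  (\<open>hardy_poisson_formula\<close>). Paired with a vector it becomes a scalar statement: a function with
  bounded means on horizontal lines is bounded on each smaller half-plane (\<open>hardy_interior_bound\<close>),
  there the formula follows from Cauchy's theorem (\<open>poisson_formula\<close>), and the limit at the
  boundary rests on the bound in mean square and convergence almost everywhere
  (\<open>tendsto_weighted_mean\<close>).
\<close>

section \<open>Complex Hilbert spaces\<close>

instance complex_hilbert \<subseteq> banach ..

lemma scaleC_zero_left [simp]: "0 *\<^sub>C x = (0::'a::complex_normed_vector)"
  using norm_scaleC[of 0 x] by simp

lemma scaleC_zero_right [simp]: "a *\<^sub>C (0::'a::complex_normed_vector) = 0"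
  using norm_scaleC[of a "0::'a"] by simp

lemma scaleC_diff_right: "a *\<^sub>C (x - y) = a *\<^sub>C x - a *\<^sub>C (y::'a::complex_normed_vector)"
  using scaleC_add_right[of a "x - y" y] by (simp add: algebra_simps)

lemma scaleC_minus_left: "(- a) *\<^sub>C x = - (a *\<^sub>C (x::'a::complex_normed_vector))"
  using scaleC_add_left[of a "- a" x] by (simp add: eq_neg_iff_add_eq_0 add.commute)

lemma scaleC_diff_left: "(a - b) *\<^sub>C x = a *\<^sub>C x - b *\<^sub>C (x::'a::complex_normed_vector)"
  using scaleC_add_left[of a "- b" x] by (simp add: scaleC_minus_left)

lemma bounded_bilinear_scaleC:
  "bounded_bilinear (scaleC :: complex \<Rightarrow> 'a::complex_normed_vector \<Rightarrow> 'a)"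
proof
  show "(r *\<^sub>R a) *\<^sub>C b = r *\<^sub>R a *\<^sub>C b" for r a and b :: 'a
    by (simp only: scaleR_scaleC[of r "a *\<^sub>C b"] scaleC_scaleC scaleR_conv_of_real)
  show "a *\<^sub>C r *\<^sub>R b = r *\<^sub>R a *\<^sub>C b" for r a and b :: 'a
    by (simp add: scaleR_scaleC scaleC_scaleC mult.commute)
  show "\<exists>K. \<forall>a b. norm (a *\<^sub>C (b::'a)) \<le> norm a * norm b * K"
    by (rule exI[of _ 1]) (simp add: norm_scaleC)
qed (simp_all add: scaleC_add_left scaleC_add_right)

lemmas tendsto_scaleC = bounded_bilinear.tendsto[OF bounded_bilinear_scaleC]

lemma bounded_clinear_add: "bounded_clinear A \<Longrightarrow> A (x + y) = A x + A y"
  by (simp add: bounded_clinear_def linear_add bounded_linear.linear)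

lemma bounded_clinear_scaleC: "bounded_clinear A \<Longrightarrow> A (c *\<^sub>C x) = c *\<^sub>C A x"
  by (simp add: bounded_clinear_def)

lemma bounded_clinear_zero: "bounded_clinear A \<Longrightarrow> A 0 = 0"
  using bounded_clinear_scaleC[of A 0 0] by simp

lemma bounded_clinear_continuous_on: "bounded_clinear A \<Longrightarrow> continuous_on S A"
  by (simp add: bounded_clinear_def linear_continuous_on)

lemma bounded_clinear_tendsto:
  "bounded_clinear A \<Longrightarrow> (f \<longlongrightarrow> l) F \<Longrightarrow> ((\<lambda>x. A (f x)) \<longlongrightarrow> A l) F"
  by (simp add: bounded_clinear_def bounded_linear.tendsto)

lemma bounded_clinearI:
  assumes "\<And>x y. A (x + y) = A x + A y" "\<And>c x. A (c *\<^sub>C x) = c *\<^sub>C A x"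
    and "\<And>x. norm (A x) \<le> K * norm x"
  shows "bounded_clinear A"
  unfolding bounded_clinear_def
  using assms by (auto intro!: bounded_linear_intro[where K=K] simp: scaleR_scaleC mult.commute)

lemma bounded_clinear_compose:
  assumes "bounded_clinear A" "bounded_clinear B"
  shows "bounded_clinear (\<lambda>x. A (B x))"
  using assms bounded_linear_compose[of A B] by (auto simp: bounded_clinear_def)

lemma cinner_add_right: "cinner x (y + z) = cinner x y + cinner x (z::'a::complex_hilbert)"
  by (metis cinner_commute cinner_add_left complex_cnj_add)

lemma cinner_scaleC_right: "cinner x (a *\<^sub>C y) = cnj a * cinner x (y::'a::complex_hilbert)"
  by (metis cinner_commute cinner_scaleC_left complex_cnj_mult)

lemma cinner_scaleR_left: "cinner (r *\<^sub>R x) y = of_real r * cinner x (y::'a::complex_hilbert)"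
  by (simp add: scaleR_scaleC cinner_scaleC_left)

lemma cinner_zero_left [simp]: "cinner 0 (y::'a::complex_hilbert) = 0"
  using cinner_scaleC_left[of 0 0 y] by simp

lemma cinner_zero_right [simp]: "cinner y (0::'a::complex_hilbert) = 0"
  using cinner_scaleC_right[of y 0 0] by simp

lemma cinner_diff_left: "cinner (x - y) z = cinner x z - cinner y (z::'a::complex_hilbert)"
  using cinner_add_left[of "x - y" y z] by simp

lemma cinner_diff_right: "cinner z (x - y) = cinner z x - cinner z (y::'a::complex_hilbert)"
  using cinner_add_right[of z "x - y" y] by simp

lemma norm_eq_cinner: "(norm x)\<^sup>2 = Re (cinner x (x::'a::complex_hilbert))"
  by (simp add: cinner_self)

lemma norm_diff_square:
  "(norm (x - y))\<^sup>2 = (norm x)\<^sup>2 - 2 * Re (cinner x y) + (norm (y::'a::complex_hilbert))\<^sup>2"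
proof -
  have "Re (cinner y x) = Re (cinner x y)" by (subst cinner_commute) simp
  then show ?thesis by (simp add: norm_eq_cinner cinner_diff_left cinner_diff_right)
qed

lemma cinner_Cauchy_Schwarz: "cmod (cinner x y) \<le> norm x * norm (y::'a::complex_hilbert)"
proof (cases "y = 0")
  case False
  define c where "c = cinner x y / of_real ((norm y)\<^sup>2)"
  have [simp]: "norm y \<noteq> 0" using False by simp
  have "0 \<le> (norm (x - c *\<^sub>C y))\<^sup>2" by simp
  also have "\<dots> = (norm x)\<^sup>2 - 2 * Re (cnj c * cinner x y) + (cmod c * norm y)\<^sup>2"
    by (simp add: norm_diff_square cinner_scaleC_right norm_scaleC)
  also have "cnj c * cinner x y = of_real ((cmod (cinner x y))\<^sup>2 / (norm y)\<^sup>2)"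
    unfolding of_real_divide complex_norm_square by (simp add: c_def)
  also have "(cmod c * norm y)\<^sup>2 = (cmod (cinner x y))\<^sup>2 / (norm y)\<^sup>2"
    by (simp add: c_def norm_divide norm_power norm_mult power_divide power_mult_distrib field_simps power2_eq_square)
  finally have "(cmod (cinner x y))\<^sup>2 / (norm y)\<^sup>2 \<le> (norm x)\<^sup>2" by simp
  then have "(cmod (cinner x y))\<^sup>2 \<le> (norm x * norm y)\<^sup>2"
    using \<open>norm y \<noteq> 0\<close> by (simp add: divide_le_eq power_mult_distrib)
  then show ?thesis by (rule power2_le_imp_le) simp
qed simp

lemma bounded_bilinear_cinner:
  "bounded_bilinear (cinner :: 'a \<Rightarrow> 'a::complex_hilbert \<Rightarrow> complex)"
proof
  show "cinner (r *\<^sub>R a) b = r *\<^sub>R cinner a b" for r and a b :: 'a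
    by (simp only: cinner_scaleR_left scaleR_conv_of_real)
  show "cinner a (r *\<^sub>R b) = r *\<^sub>R cinner a b" for r and a b :: 'a
    by (simp only: scaleR_scaleC[of r b] cinner_scaleC_right scaleR_conv_of_real complex_cnj_complex_of_real)
  show "\<exists>K. \<forall>a b. norm (cinner a (b::'a)) \<le> norm a * norm b * K"
    by (rule exI[of _ 1]) (simp add: cinner_Cauchy_Schwarz)
qed (simp_all add: cinner_add_left cinner_add_right)

lemmas tendsto_cinner = bounded_bilinear.tendsto[OF bounded_bilinear_cinner]
lemmas bounded_linear_cinner_left = bounded_bilinear.bounded_linear_left[OF bounded_bilinear_cinner]

lemma norm_le_of_cinner_le:
  fixes x :: "'a::complex_hilbert"
  assumes "0 \<le> K" "\<And>w. cmod (cinner x w) \<le> K * norm w"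
  shows "norm x \<le> K"
proof (cases "x = 0")
  case False
  have "norm x * norm x \<le> K * norm x"
    using assms(2)[of x] by (simp add: cinner_self norm_power norm_mult power2_eq_square)
  then show ?thesis using False by simp
qed (simp add: assms(1))

definition closed_csubspace :: "'a::complex_normed_vector set \<Rightarrow> bool"
  where "closed_csubspace S \<longleftrightarrow> closed S \<and> 0 \<in> S \<and> (\<forall>x\<in>S. \<forall>y\<in>S. x + y \<in> S) \<and>
    (\<forall>c. \<forall>x\<in>S. c *\<^sub>C x \<in> S)"

text \<open>
  Having dense linear span, in the form of an induction principle: a closed subspace that contains
  the family is everything.
\<close>

definition total_family :: "('i \<Rightarrow> 'a::complex_normed_vector) \<Rightarrow> bool"
  where "total_family e \<longleftrightarrow> (\<forall>S. closed_csubspace S \<longrightarrow> range e \<subseteq> S \<longrightarrow> S = UNIV)"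

lemma bounded_clinear_eq_total:
  assumes "total_family e" "bounded_clinear A" "bounded_clinear B" "\<And>i. A (e i) = B (e i)"
  shows "A = B"
proof -
  have "closed_csubspace {x. A x = B x}"
    unfolding closed_csubspace_def
    using assms(2,3)
    by (auto simp: bounded_clinear_zero bounded_clinear_add bounded_clinear_scaleC
        intro!: closed_Collect_eq bounded_clinear_continuous_on)
  then show ?thesis using assms(1,4) unfolding total_family_def by blast
qed

lemma closed_csubspace_orthogonal: "closed_csubspace {x. cinner x w = (0::complex)}"
  unfolding closed_csubspace_def
  by (auto simp: cinner_add_left cinner_scaleC_left intro!: closed_Collect_eq
      linear_continuous_on bounded_linear_cinner_left continuous_intros)

lemma zero_of_orthogonal_total:
  assumes "total_family e" "\<And>i. cinner (e i) w = 0"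
  shows "w = 0"
proof -
  have "w \<in> {x. cinner x w = 0}"
    using assms closed_csubspace_orthogonal[of w] unfolding total_family_def by blast
  then show ?thesis using norm_eq_cinner[of w] by simp
qed

text \<open>
  The span is indexed by lists because appending lists adds the combinations they denote, so that a
  map given on the family can be transported without choosing a basis.
\<close>

definition lincomb :: "('i \<Rightarrow> 'a::complex_normed_vector) \<Rightarrow> (complex \<times> 'i) list \<Rightarrow> 'a"
  where "lincomb e xs = (\<Sum>(c, i)\<leftarrow>xs. c *\<^sub>C e i)"

lemma lincomb_simps [simp]:
  "lincomb e [] = 0"
  "lincomb e ((c, i) # xs) = c *\<^sub>C e i + lincomb e xs"
  "lincomb e (xs @ ys) = lincomb e xs + lincomb e ys"
  by (simp_all add: lincomb_def)

lemma lincomb_scaleC: "lincomb e (map (\<lambda>(c, i). (a * c, i)) xs) = a *\<^sub>C lincomb e xs"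
  by (induction xs) (auto simp: scaleC_add_right scaleC_scaleC)

lemma cinner_lincomb_eq:
  assumes "\<And>i j. cinner (e' i) (e' j) = cinner (e i) (e j)"
  shows "cinner (lincomb e' xs) (lincomb e' ys) = cinner (lincomb e xs) (lincomb e ys)"
proof (induction xs)
  case (Cons p xs)
  obtain c i where p: "p = (c, i)" by force
  have "cinner (e' i) (lincomb e' ys) = cinner (e i) (lincomb e ys)"
    by (induction ys) (auto simp: cinner_add_right cinner_scaleC_right assms)
  then show ?case using Cons by (simp add: p cinner_add_left cinner_scaleC_left)
qed simp

lemma total_family_imp_dense:
  assumes "total_family e"
  shows "closure (range (lincomb e)) = UNIV"
proof -
  have "closed_csubspace (closure (range (lincomb e)))"
    unfolding closed_csubspace_def
  proof (intro conjI ballI allI)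
    show "0 \<in> closure (range (lincomb e))"
      by (rule subsetD[OF closure_subset]) (metis lincomb_simps(1) rangeI)
    fix x assume "x \<in> closure (range (lincomb e))"
    then obtain u where u: "\<And>n. u n \<in> range (lincomb e)" "u \<longlonglongrightarrow> x"
      unfolding closure_sequential by blast
    {
      fix y assume "y \<in> closure (range (lincomb e))"
      then obtain v where v: "\<And>n. v n \<in> range (lincomb e)" "v \<longlonglongrightarrow> y"
        unfolding closure_sequential by blast
      have "u n + v n \<in> range (lincomb e)" for n
      proof -
        obtain xs ys where "u n = lincomb e xs" "v n = lincomb e ys"
          using u(1)[of n] v(1)[of n] by blast
        then have "u n + v n = lincomb e (xs @ ys)" by simp
        then show ?thesis by blast
      qed
      then show "x + y \<in> closure (range (lincomb e))"
        unfolding closure_sequential using tendsto_add[OF u(2) v(2)]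
        by (intro exI[of _ "\<lambda>n. u n + v n"]) auto
    }
    fix c
    have "c *\<^sub>C u n \<in> range (lincomb e)" for n
    proof -
      obtain xs where "u n = lincomb e xs" using u(1)[of n] by blast
      then have "c *\<^sub>C u n = lincomb e (map (\<lambda>(d, i). (c * d, i)) xs)" by (simp add: lincomb_scaleC)
      then show ?thesis by blast
    qed
    then show "c *\<^sub>C x \<in> closure (range (lincomb e))"
      unfolding closure_sequential using tendsto_scaleC[OF tendsto_const u(2)]
      by (intro exI[of _ "\<lambda>n. c *\<^sub>C u n"]) auto
  qed auto
  moreover have "e i \<in> closure (range (lincomb e))" for i
  proof (rule subsetD[OF closure_subset])
    have "lincomb e [(1, i)] = e i" by (simp add: scaleC_one)
    then show "e i \<in> range (lincomb e)" by (metis rangeI)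
  qed
  ultimately show ?thesis using assms unfolding total_family_def by blast
qed

text \<open>
  Equality of the Gram matrices makes \<open>e i \<mapsto> e' i\<close> well defined and isometric on the linear
  span. An isometry is uniformly continuous, so it extends to the closure of the span, and
  linearity and the inner product pass to the limit.
\<close>

lemma isometric_extension:
  fixes e :: "'i \<Rightarrow> 'a::complex_hilbert" and e' :: "'i \<Rightarrow> 'b::complex_hilbert"
  assumes tot: "total_family e"
    and iso: "\<And>i j. cinner (e' i) (e' j) = cinner (e i) (e j)"
  shows "\<exists>U. bounded_clinear U \<and> (\<forall>i. U (e i) = e' i) \<and> (\<forall>x y. cinner (U x) (U y) = cinner x y)"
proof -
  define U0 where "U0 x = lincomb e' (SOME xs. lincomb e xs = x)" for x
  have dist_eq: "norm (lincomb e' xs - lincomb e' ys) = norm (lincomb e xs - lincomb e ys)" for xs ys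
  proof -
    have "(norm (lincomb e' xs - lincomb e' ys))\<^sup>2 = (norm (lincomb e xs - lincomb e ys))\<^sup>2"
    proof -
      have 1: "(norm (lincomb e' zs))\<^sup>2 = (norm (lincomb e zs))\<^sup>2" for zs
        by (simp only: norm_eq_cinner cinner_lincomb_eq[of e' e, OF iso])
      show ?thesis by (simp only: norm_diff_square 1 cinner_lincomb_eq[of e' e, OF iso])
    qed
    then show ?thesis by simp
  qed
  have U0: "U0 (lincomb e xs) = lincomb e' xs" for xs
  proof -
    have "lincomb e (SOME ys. lincomb e ys = lincomb e xs) = lincomb e xs"
      by (rule someI[of "\<lambda>ys. lincomb e ys = lincomb e xs"]) simp
    then show ?thesis using dist_eq[of "SOME ys. lincomb e ys = lincomb e xs" xs]
      by (simp add: U0_def)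
  qed
  have "uniformly_continuous_on (range (lincomb e)) U0"
    unfolding uniformly_continuous_on_def
  proof (intro allI impI)
    fix d :: real assume "d > 0"
    have "dist (U0 x') (U0 x) = dist x' x"
      if x: "x \<in> range (lincomb e)" "x' \<in> range (lincomb e)" for x x'
    proof -
      obtain xs ys where "x = lincomb e xs" "x' = lincomb e ys" using x by blast
      then show ?thesis by (simp only: U0 dist_norm dist_eq)
    qed
    then show "\<exists>\<delta>>0. \<forall>x\<in>range (lincomb e). \<forall>x'\<in>range (lincomb e).
        dist x' x < \<delta> \<longrightarrow> dist (U0 x') (U0 x) < d"
      using \<open>d > 0\<close> by (intro exI[of _ d]) simp
  qed
  then obtain U where U: "uniformly_continuous_on (closure (range (lincomb e))) U"
    and ext: "\<And>x. x \<in> range (lincomb e) \<Longrightarrow> U0 x = U x"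
    by (rule uniformly_continuous_on_extension_on_closure) (rule that)
  have UL: "U (lincomb e xs) = lincomb e' xs" for xs
    using ext[OF rangeI, of xs] unfolding U0 by (rule sym)
  have cont: "continuous_on UNIV U"
    using uniformly_continuous_imp_continuous[OF U] by (simp add: total_family_imp_dense[OF tot])
  have Ulim: "(\<lambda>n. U (w n)) \<longlonglongrightarrow> U x" if "w \<longlonglongrightarrow> x" for w :: "nat \<Rightarrow> 'a" and x
    by (rule continuous_on_tendsto_compose[OF cont that]) auto
  have lim: "\<exists>u. (\<lambda>n. lincomb e (u n)) \<longlonglongrightarrow> x \<and> (\<lambda>n. lincomb e' (u n)) \<longlonglongrightarrow> U x" for x
  proof -
    have "x \<in> closure (range (lincomb e))" using total_family_imp_dense[OF tot] by simp
    then obtain w where w: "\<And>n. w n \<in> range (lincomb e)" "w \<longlonglongrightarrow> x"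
      unfolding closure_sequential by blast
    then have "\<forall>n. \<exists>xs. w n = lincomb e xs" by blast
    then obtain u where u: "w = (\<lambda>n. lincomb e (u n))" unfolding choice_iff by blast
    have "(\<lambda>n. U (w n)) \<longlonglongrightarrow> U x" by (rule Ulim[OF w(2)])
    then have "(\<lambda>n. lincomb e' (u n)) \<longlonglongrightarrow> U x" unfolding u UL .
    then show ?thesis using w(2) unfolding u by blast
  qed
  have add: "U (x + y) = U x + U y" for x y
  proof -
    obtain u v where "(\<lambda>n. lincomb e (u n)) \<longlonglongrightarrow> x" "(\<lambda>n. lincomb e' (u n)) \<longlonglongrightarrow> U x"
      "(\<lambda>n. lincomb e (v n)) \<longlonglongrightarrow> y" "(\<lambda>n. lincomb e' (v n)) \<longlonglongrightarrow> U y"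
      using lim[of x] lim[of y] by (elim exE conjE)
    then have 1: "(\<lambda>n. lincomb e (u n @ v n)) \<longlonglongrightarrow> x + y"
      and 2: "(\<lambda>n. lincomb e' (u n @ v n)) \<longlonglongrightarrow> U x + U y"
      by (auto intro!: tendsto_add)
    have "(\<lambda>n. U (lincomb e (u n @ v n))) \<longlonglongrightarrow> U (x + y)"
      by (rule Ulim[OF 1])
    then show ?thesis using 2 unfolding UL by (rule LIMSEQ_unique)
  qed
  have scale: "U (c *\<^sub>C x) = c *\<^sub>C U x" for c x
  proof -
    obtain u where u: "(\<lambda>n. lincomb e (u n)) \<longlonglongrightarrow> x" "(\<lambda>n. lincomb e' (u n)) \<longlonglongrightarrow> U x"
      using lim[of x] by (elim exE conjE)
    define u' where "u' n = map (\<lambda>(a, i). (c * a, i)) (u n)" for n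
    have 1: "(\<lambda>n. lincomb e (u' n)) \<longlonglongrightarrow> c *\<^sub>C x" "(\<lambda>n. lincomb e' (u' n)) \<longlonglongrightarrow> c *\<^sub>C U x"
      using tendsto_scaleC[OF tendsto_const u(1), of c] tendsto_scaleC[OF tendsto_const u(2), of c]
      by (simp_all add: u'_def lincomb_scaleC)
    have "(\<lambda>n. U (lincomb e (u' n))) \<longlonglongrightarrow> U (c *\<^sub>C x)"
      by (rule Ulim[OF 1(1)])
    then show ?thesis using 1(2) unfolding UL by (rule LIMSEQ_unique)
  qed
  have inn: "cinner (U x) (U y) = cinner x y" for x y
  proof -
    obtain u v where l: "(\<lambda>n. lincomb e (u n)) \<longlonglongrightarrow> x" "(\<lambda>n. lincomb e' (u n)) \<longlonglongrightarrow> U x"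
      "(\<lambda>n. lincomb e (v n)) \<longlonglongrightarrow> y" "(\<lambda>n. lincomb e' (v n)) \<longlonglongrightarrow> U y"
      using lim[of x] lim[of y] by (elim exE conjE)
    have "(\<lambda>n. cinner (lincomb e (u n)) (lincomb e (v n))) \<longlonglongrightarrow> cinner (U x) (U y)"
      using tendsto_cinner[OF l(2,4)] by (simp add: cinner_lincomb_eq[OF iso])
    then show ?thesis using tendsto_cinner[OF l(1,3)] by (rule LIMSEQ_unique)
  qed
  have "norm (U x) = norm x" for x
    using inn[of x x] by (simp add: cinner_self flip: of_real_power)
  then have "bounded_clinear U"
    by (intro bounded_clinearI[where K=1] add scale) simp
  moreover have "U (e i) = e' i" for i
    using UL[of "[(1, i)]"] by (simp add: scaleC_one)
  ultimately show ?thesis using inn by blast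
qed

section \<open>Strongly measurable functions\<close>

lemma strongly_measurable_compose2:
  assumes f: "strongly_measurable f" and g: "strongly_measurable g"
    and h: "\<And>u v a b. u \<longlonglongrightarrow> a \<Longrightarrow> v \<longlonglongrightarrow> b \<Longrightarrow> (\<lambda>n. h (u n) (v n)) \<longlonglongrightarrow> h a b"
  shows "strongly_measurable (\<lambda>x. h (f x) (g x))"
proof -
  obtain s t where s:
    "\<And>n. simple_function lborel (s n)" "\<And>x. (\<lambda>n. s n x) \<longlonglongrightarrow> f x"
    and t: "\<And>n. simple_function lborel (t n)" "\<And>x. (\<lambda>n. t n x) \<longlonglongrightarrow> g x"
    using assms(1,2) unfolding strongly_measurable_def by blast
  have "simple_function lborel (\<lambda>x. h (s n x) (t n x))" for n
    by (rule simple_function_compose2[OF s(1) t(1)])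
  moreover have "(\<lambda>n. h (s n x) (t n x)) \<longlonglongrightarrow> h (f x) (g x)" for x
    by (rule h[OF s(2) t(2)])
  ultimately show ?thesis
    unfolding strongly_measurable_def by (intro exI[of _ "\<lambda>n x. h (s n x) (t n x)"]) simp
qed

lemma strongly_measurable_iff_borel:
  fixes f :: "real \<Rightarrow> 'a::{real_normed_vector, second_countable_topology}"
  shows "strongly_measurable f \<longleftrightarrow> f \<in> borel_measurable lborel"
proof
  assume "strongly_measurable f"
  then obtain s where s: "\<And>n. simple_function lborel (s n)" "\<And>x. (\<lambda>n. s n x) \<longlonglongrightarrow> f x"
    unfolding strongly_measurable_def by blast
  show "f \<in> borel_measurable lborel"
    by (rule borel_measurable_LIMSEQ_metric[OF borel_measurable_simple_function[OF s(1)] s(2)])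
next
  assume "f \<in> borel_measurable lborel"
  from borel_measurable_implies_sequence_metric[OF this, of 0] show "strongly_measurable f"
    unfolding strongly_measurable_def by auto
qed

lemma borel_measurable_cinner:
  fixes f g :: "real \<Rightarrow> 'a::complex_hilbert"
  assumes "strongly_measurable f" "strongly_measurable g"
  shows "(\<lambda>x. cinner (f x) (g x)) \<in> borel_measurable lborel"
  using strongly_measurable_compose2[OF assms tendsto_cinner]
  by (simp add: strongly_measurable_iff_borel)

lemma strongly_measurable_scaleC_fun:
  fixes f :: "real \<Rightarrow> 'a::complex_normed_vector"
  assumes "\<phi> \<in> borel_measurable lborel" "strongly_measurable f"
  shows "strongly_measurable (\<lambda>x. \<phi> x *\<^sub>C f x)"
  using assms by (intro strongly_measurable_compose2[OF _ _ tendsto_scaleC])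
    (simp_all add: strongly_measurable_iff_borel)

lemma strongly_measurable_scaleR_fun:
  fixes f :: "real \<Rightarrow> 'a::real_normed_vector"
  assumes "\<phi> \<in> borel_measurable lborel" "strongly_measurable f"
  shows "strongly_measurable (\<lambda>x. \<phi> x *\<^sub>R f x)"
  using assms by (intro strongly_measurable_compose2[OF _ _ tendsto_scaleR])
    (simp_all add: strongly_measurable_iff_borel)

lemma strongly_measurable_simple:
  "simple_function lborel s \<Longrightarrow> strongly_measurable s"
  unfolding strongly_measurable_def by (intro exI[of _ "\<lambda>n. s"]) auto

lemma simple_function_scaleR_indicator:
  fixes s :: "real \<Rightarrow> 'a::real_normed_vector"
  assumes "simple_function lborel s" "A \<in> sets borel"
  shows "simple_function lborel (\<lambda>x. indicator A x *\<^sub>R s x)"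
  using assms by (intro simple_function_compose2[where h="\<lambda>a b. a *\<^sub>R b"]) auto

text \<open>
  Cutting an approximating sequence off wherever it exceeds twice the limit gives a dominated
  sequence with the same limit.
\<close>

lemma strongly_measurable_dominated_simple:
  fixes f :: "real \<Rightarrow> 'a::real_normed_vector"
  assumes "strongly_measurable f"
  shows "\<exists>s. (\<forall>n. simple_function lborel (s n)) \<and> (\<forall>x. (\<lambda>n. s n x) \<longlonglongrightarrow> f x) \<and>
    (\<forall>n x. norm (s n x) \<le> 2 * norm (f x))"
proof -
  obtain s where s: "\<And>n. simple_function lborel (s n)" "\<And>x. (\<lambda>n. s n x) \<longlonglongrightarrow> f x"
    using assms unfolding strongly_measurable_def by blast
  note [measurable] = measurable_norm_strongly_measurable[OF assms]
    measurable_norm_strongly_measurable[OF strongly_measurable_simple[OF s(1)]]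
  define A where "A n = {x. norm (s n x) \<le> 2 * norm (f x)}" for n
  have A: "A n \<in> sets borel" for n
  proof -
    have "{x \<in> space lborel. norm (s n x) \<le> 2 * norm (f x)} \<in> sets lborel" by measurable
    then show ?thesis by (simp add: A_def)
  qed
  have "(\<lambda>n. indicator (A n) x *\<^sub>R s n x) \<longlonglongrightarrow> f x" for x
  proof (cases "f x = 0")
    case True
    then have "(\<lambda>n. indicator (A n) x *\<^sub>R s n x) = (\<lambda>n. 0)"
      by (auto simp: A_def indicator_def)
    then show ?thesis using True by simp
  next
    case False
    have "(\<lambda>n. norm (s n x)) \<longlonglongrightarrow> norm (f x)" by (intro tendsto_norm s(2))
    moreover have "norm (f x) < 2 * norm (f x)" using False by simp
    ultimately have "\<forall>\<^sub>F n in sequentially. norm (s n x) < 2 * norm (f x)"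
      by (rule order_tendstoD)
    then have "\<forall>\<^sub>F n in sequentially. s n x = indicator (A n) x *\<^sub>R s n x"
      by eventually_elim (simp add: A_def)
    then show ?thesis using s(2) by (rule Lim_transform_eventually[rotated])
  qed
  moreover have "norm (indicator (A n) x *\<^sub>R s n x) \<le> 2 * norm (f x)" for n x
    by (auto simp: A_def indicator_def)
  ultimately show ?thesis
    using simple_function_scaleR_indicator[OF s(1) A]
    by (intro exI[of _ "\<lambda>n x. indicator (A n) x *\<^sub>R s n x"]) blast
qed

lemma square_integrable_bound:
  assumes "strongly_measurable f" "square_integrable g" "\<And>x. norm (f x) \<le> K * norm (g x)"
  shows "square_integrable f"
proof -
  note [measurable] = measurable_norm_strongly_measurable[OF assms(1)]
  have "integrable lborel (\<lambda>x. K\<^sup>2 * (norm (g x))\<^sup>2)"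
    using assms(2) by (simp add: square_integrable_def)
  then have "integrable lborel (\<lambda>x. (norm (f x))\<^sup>2)"
  proof (rule Bochner_Integration.integrable_bound)
    have "(norm (f x))\<^sup>2 \<le> (K * norm (g x))\<^sup>2" for x
      by (intro power_mono assms(3)) simp
    then show "AE x in lborel. norm ((norm (f x))\<^sup>2) \<le> norm (K\<^sup>2 * (norm (g x))\<^sup>2)"
      by (simp add: power_mult_distrib)
  qed simp
  then show ?thesis using assms(1) by (simp add: square_integrable_def)
qed

lemma strongly_measurable_square_integrable:
  "square_integrable f \<Longrightarrow> strongly_measurable f"
  by (simp add: square_integrable_def)

lemma square_integrable_scaleC_fun:
  fixes f :: "real \<Rightarrow> 'a::complex_normed_vector"
  assumes "\<phi> \<in> borel_measurable lborel" "square_integrable f" "\<And>x. cmod (\<phi> x) \<le> K"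
  shows "square_integrable (\<lambda>x. \<phi> x *\<^sub>C f x)"
proof (rule square_integrable_bound[OF _ assms(2)])
  show "strongly_measurable (\<lambda>x. \<phi> x *\<^sub>C f x)"
    by (rule strongly_measurable_scaleC_fun[OF assms(1) strongly_measurable_square_integrable[OF assms(2)]])
  show "norm (\<phi> x *\<^sub>C f x) \<le> K * norm (f x)" for x
    unfolding norm_scaleC by (rule mult_right_mono[OF assms(3) norm_ge_zero])
qed

lemma square_integrable_scaleR_indicator:
  fixes f :: "real \<Rightarrow> 'a::complex_normed_vector"
  assumes "A \<in> sets borel" "square_integrable f"
  shows "square_integrable (\<lambda>x. indicator A x *\<^sub>R f x)"
proof (rule square_integrable_bound[OF _ assms(2)])
  show "strongly_measurable (\<lambda>x. indicator A x *\<^sub>R f x)"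
    by (rule strongly_measurable_scaleR_fun[OF _ strongly_measurable_square_integrable[OF assms(2)]])
      (use assms(1) in simp)
  show "norm (indicator A x *\<^sub>R f x) \<le> 1 * norm (f x)" for x
    by (simp add: indicator_def)
qed


section \<open>The space of square-integrable classes\<close>

lemma square_integrable_rep: "square_integrable (rep_L2R f)"
  using Quotient3_rep_reflp[OF Quotient3_L2R, of f] by (simp add: L2R_rel_def)

lemma abs_rep_L2R [simp]: "abs_L2R (rep_L2R f) = f"
  by (rule Quotient3_abs_rep[OF Quotient3_L2R])

lemma strongly_measurable_rep: "strongly_measurable (rep_L2R f)"
  by (rule strongly_measurable_square_integrable[OF square_integrable_rep])

lemma abs_L2R_eq_iff:
  assumes "square_integrable f" "square_integrable g"
  shows "abs_L2R f = abs_L2R g \<longleftrightarrow> (AE x in lborel. f x = g x)"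
  using Quotient3_rel[OF Quotient3_L2R, of f g] assms by (auto simp: L2R_rel_def)

lemma rep_abs_L2R: "square_integrable f \<Longrightarrow> AE x in lborel. rep_L2R (abs_L2R f) x = f x"
  using abs_L2R_eq_iff[OF square_integrable_rep, of f "abs_L2R f"] by simp

lemma L2R_eqI: "(AE x in lborel. rep_L2R f x = rep_L2R g x) \<Longrightarrow> f = g"
  using abs_L2R_eq_iff[OF square_integrable_rep square_integrable_rep, of f g] by simp

lemma L2R_cases:
  obtains f where "square_integrable f" "F = abs_L2R f"
  using square_integrable_rep abs_rep_L2R by metis

lemma zero_L2R_abs: "0 = abs_L2R (\<lambda>x. 0)"
  by (rule zero_L2R.abs_eq)

lemma add_L2R_abs:
  "square_integrable f \<Longrightarrow> square_integrable g \<Longrightarrow>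
    abs_L2R f + abs_L2R g = abs_L2R (\<lambda>x. f x + g x)"
  by (rule plus_L2R.abs_eq) (simp_all add: eq_onp_def L2R_rel_def)

lemma diff_L2R_abs:
  "square_integrable f \<Longrightarrow> square_integrable g \<Longrightarrow>
    abs_L2R f - abs_L2R g = abs_L2R (\<lambda>x. f x - g x)"
  by (rule minus_L2R.abs_eq) (simp_all add: eq_onp_def L2R_rel_def)

lemma scaleC_L2R_abs:
  "square_integrable f \<Longrightarrow> c *\<^sub>C abs_L2R f = abs_L2R (\<lambda>x. c *\<^sub>C f x)"
  by (rule scaleC_L2R.abs_eq) (simp_all add: eq_onp_def L2R_rel_def)

lemma norm_L2R_abs: "square_integrable f \<Longrightarrow> norm (abs_L2R f) = L2_norm f"
  by (rule norm_L2R.abs_eq) (simp_all add: eq_onp_def L2R_rel_def)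

lemma translation_abs:
  "square_integrable f \<Longrightarrow> translation h (abs_L2R f) = abs_L2R (\<lambda>t. f (t + h))"
  by (rule translation.abs_eq) (simp_all add: eq_onp_def L2R_rel_def)

lemma rep_add_L2R: "AE x in lborel. rep_L2R (f + g) x = rep_L2R f x + rep_L2R g x"
  using add_L2R_abs[OF square_integrable_rep square_integrable_rep, of f g]
    rep_abs_L2R[OF square_integrable_add[OF square_integrable_rep square_integrable_rep], of f g] by simp

lemma rep_scaleC_L2R: "AE x in lborel. rep_L2R (c *\<^sub>C f) x = c *\<^sub>C rep_L2R f x"
  using scaleC_L2R_abs[OF square_integrable_rep, of c f]
    rep_abs_L2R[OF square_integrable_scaleC[OF square_integrable_rep], of c f] by simp

lemma norm_L2R_square: "(norm f)\<^sup>2 = (\<integral>x. (norm (rep_L2R f x))\<^sup>2 \<partial>lborel)"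
  using norm_L2R_abs[OF square_integrable_rep, of f] L2_norm_power2[of "rep_L2R f"] by simp

lemma L2R_dominated_convergence:
  fixes u :: "nat \<Rightarrow> real \<Rightarrow> 'a::complex_normed_vector"
  assumes u: "\<And>n. square_integrable (u n)" and f: "square_integrable f"
    and w: "square_integrable w"
    and lim: "AE x in lborel. (\<lambda>n. u n x) \<longlonglongrightarrow> f x"
    and dom: "\<And>n. AE x in lborel. norm (u n x - f x) \<le> K * norm (w x)"
  shows "(\<lambda>n. abs_L2R (u n)) \<longlonglongrightarrow> abs_L2R f"
proof -
  have d: "square_integrable (\<lambda>x. u n x - f x)" for n by (intro square_integrable_diff u f)
  note [measurable] = measurable_norm_strongly_measurable[OF strongly_measurable_square_integrable[OF d]]
  have "(\<lambda>n. \<integral>x. (norm (u n x - f x))\<^sup>2 \<partial>lborel) \<longlonglongrightarrow> integral\<^sup>L lborel (\<lambda>x::real. 0)"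
  proof (rule integral_dominated_convergence[where w="\<lambda>x. K\<^sup>2 * (norm (w x))\<^sup>2"])
    show "integrable lborel (\<lambda>x. K\<^sup>2 * (norm (w x))\<^sup>2)"
      using w by (simp add: square_integrable_def)
    show "AE x in lborel. (\<lambda>n. (norm (u n x - f x))\<^sup>2) \<longlonglongrightarrow> 0"
      using lim
    proof eventually_elim
      case (elim x)
      have "(\<lambda>n. (norm (u n x - f x))\<^sup>2) \<longlonglongrightarrow> (norm (f x - f x))\<^sup>2"
        by (intro tendsto_intros elim)
      then show ?case by simp
    qed
    show "AE x in lborel. norm ((norm (u n x - f x))\<^sup>2) \<le> K\<^sup>2 * (norm (w x))\<^sup>2" for n
      using dom[of n]
    proof eventually_elim
      case (elim x)
      then have "(norm (u n x - f x))\<^sup>2 \<le> (K * norm (w x))\<^sup>2"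
        by (intro power_mono) auto
      then show ?case by (simp add: power_mult_distrib)
    qed
  qed simp_all
  then have "(\<lambda>n. sqrt (\<integral>x. (norm (u n x - f x))\<^sup>2 \<partial>lborel)) \<longlonglongrightarrow> sqrt 0"
    by (intro tendsto_real_sqrt) simp
  then have "(\<lambda>n. norm (abs_L2R (u n) - abs_L2R f)) \<longlonglongrightarrow> 0"
    by (simp add: diff_L2R_abs[OF u f] norm_L2R_abs[OF d] L2_norm_def)
  then show ?thesis
    by (intro LIM_zero_cancel[of "\<lambda>n. abs_L2R (u n)"]) (rule tendsto_norm_zero_cancel)
qed

lemma L2R_dominated_convergence':
  fixes u :: "nat \<Rightarrow> real \<Rightarrow> 'a::complex_normed_vector"
  assumes u: "\<And>n. strongly_measurable (u n)" and f: "square_integrable f"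
    and lim: "\<And>x. (\<lambda>n. u n x) \<longlonglongrightarrow> f x"
    and dom: "\<And>n x. norm (u n x) \<le> K * norm (f x)"
  shows "(\<lambda>n. abs_L2R (u n)) \<longlonglongrightarrow> abs_L2R f"
proof (rule L2R_dominated_convergence[where w=f and K="K + 1"])
  show "square_integrable (u n)" for n by (rule square_integrable_bound[OF u f dom])
  show "AE x in lborel. norm (u n x - f x) \<le> (K + 1) * norm (f x)" for n
  proof (rule AE_I2)
    show "norm (u n x - f x) \<le> (K + 1) * norm (f x)" for x
      using norm_triangle_ineq4[of "u n x" "f x"] dom[of n x] by (simp add: algebra_simps)
  qed
qed (use f lim in auto)

lemma L2R_simple_approx:
  fixes F :: "'a::complex_normed_vector L2R"
  assumes "0 < e"
  shows "\<exists>s. simple_function lborel s \<and> square_integrable s \<and> norm (abs_L2R s - F) < e"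
proof -
  obtain s where s: "\<And>n. simple_function lborel (s n)" "\<And>x. (\<lambda>n. s n x) \<longlonglongrightarrow> rep_L2R F x"
    "\<And>n x. norm (s n x) \<le> 2 * norm (rep_L2R F x)"
    using strongly_measurable_dominated_simple[OF strongly_measurable_rep[of F]] by blast
  have "(\<lambda>n. abs_L2R (s n)) \<longlonglongrightarrow> abs_L2R (rep_L2R F)"
    by (rule L2R_dominated_convergence'[where K=2])
      (use s in \<open>auto simp: square_integrable_rep strongly_measurable_simple\<close>)
  then obtain n where "norm (abs_L2R (s n) - F) < e"
    using \<open>0 < e\<close> by (auto dest!: LIMSEQ_D)
  moreover have "square_integrable (s n)"
    by (rule square_integrable_bound[OF strongly_measurable_simple[OF s(1)] square_integrable_rep s(3)])
  ultimately show ?thesis using s(1) by blast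
qed

text \<open>
  The Riesz--Fischer argument, run on simple functions so that the limit is strongly measurable by
  construction. With \<open>d n\<close> the pointwise distance of consecutive terms, the weighted sum \<open>H\<close> of
  the \<open>4 ^ n * (d n)\<^sup>2\<close> is integrable; where it is finite the sequence converges pointwise, and
  the Cauchy--Schwarz inequality bounds all differences by a multiple of the square root of \<open>H\<close>.
\<close>

lemma simple_L2_Cauchy_limit:
  fixes s :: "nat \<Rightarrow> real \<Rightarrow> 'a::complex_hilbert"
  assumes s: "\<And>n. simple_function lborel (s n)" and sq: "\<And>n. square_integrable (s n)"
    and cau: "\<And>n. L2_norm (\<lambda>x. s (Suc n) x - s n x) \<le> (1/4) ^ n"
  shows "\<exists>f. square_integrable f \<and> (\<lambda>n. abs_L2R (s n)) \<longlonglongrightarrow> abs_L2R f"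
proof -
  define d where "d n x = norm (s (Suc n) x - s n x)" for n x
  have sqd: "square_integrable (\<lambda>x. s (Suc n) x - s n x)" for n
    by (rule square_integrable_diff[OF sq sq])
  have d_meas [measurable]: "d n \<in> borel_measurable borel" for n
    using measurable_norm_strongly_measurable[OF strongly_measurable_square_integrable[OF sqd]]
    by (simp add: d_def[abs_def])
  have d_nonneg [simp]: "0 \<le> d n x" for n x by (simp add: d_def)
  define H where "H x = (\<Sum>n. ennreal (4 ^ n * (d n x)\<^sup>2))" for x
  have H_meas [measurable]: "H \<in> borel_measurable borel" unfolding H_def[abs_def] by measurable
  have "(\<integral>\<^sup>+x. H x \<partial>lborel) = (\<Sum>n. \<integral>\<^sup>+x. ennreal (4 ^ n * (d n x)\<^sup>2) \<partial>lborel)"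
    unfolding H_def by (rule nn_integral_suminf) simp
  also have "\<dots> \<le> (\<Sum>n. ennreal ((1/4) ^ n))"
  proof (rule suminf_le)
    fix n
    have i: "integrable lborel (\<lambda>x. 4 ^ n * (d n x)\<^sup>2)"
      using sqd[of n] by (simp add: square_integrable_def d_def)
    have "(\<integral>\<^sup>+x. ennreal (4 ^ n * (d n x)\<^sup>2) \<partial>lborel) = ennreal (\<integral>x. 4 ^ n * (d n x)\<^sup>2 \<partial>lborel)"
      by (rule nn_integral_eq_integral[OF i]) simp
    also have "(\<integral>x. 4 ^ n * (d n x)\<^sup>2 \<partial>lborel) = 4 ^ n * (L2_norm (\<lambda>x. s (Suc n) x - s n x))\<^sup>2"
      by (simp add: L2_norm_power2 d_def)
    also have "\<dots> \<le> 4 ^ n * ((1/4) ^ n)\<^sup>2"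
      by (intro mult_left_mono power_mono cau L2_norm_nonneg) simp
    also have "4 ^ n * ((1/4) ^ n)\<^sup>2 = (1/4 :: real) ^ n"
      by (simp add: power2_eq_square power_divide)
    finally show "(\<integral>\<^sup>+x. ennreal (4 ^ n * (d n x)\<^sup>2) \<partial>lborel) \<le> ennreal ((1/4) ^ n)"
      by (simp add: ennreal_leI)
  qed (rule summableI)+
  also have "\<dots> = ennreal (\<Sum>n. (1/4) ^ n)"
    by (rule suminf_ennreal2) (auto intro!: summable_geometric)
  finally have H_int: "(\<integral>\<^sup>+x. H x \<partial>lborel) < \<infinity>" by (rule le_less_trans) simp
  define G where "G = {x. H x \<noteq> \<infinity>}"
  have G_meas [measurable]: "G \<in> sets borel"
  proof -
    have "{x \<in> space borel. H x \<noteq> \<infinity>} \<in> sets borel" by measurable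
    then show ?thesis by (simp add: G_def)
  qed
  have AE_G: "AE x in lborel. x \<in> G"
    using nn_integral_PInf_AE[of H lborel] H_int by (simp add: G_def)
  define w where "w x = sqrt (2 * enn2real (H x))" for x
  have w: "square_integrable w"
  proof -
    have "integrable lborel (\<lambda>x. enn2real (H x))"
    proof (rule integrableI_nonneg)
      have "(\<integral>\<^sup>+x. ennreal (enn2real (H x)) \<partial>lborel) \<le> (\<integral>\<^sup>+x. H x \<partial>lborel)"
        by (intro nn_integral_mono) (simp add: ennreal_enn2real_if)
      then show "(\<integral>\<^sup>+x. ennreal (enn2real (H x)) \<partial>lborel) < \<infinity>" using H_int by (rule le_less_trans)
    qed auto
    then show ?thesis
      by (simp add: square_integrable_def strongly_measurable_iff_borel w_def[abs_def])
  qed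
  have summ: "summable (\<lambda>n. 4 ^ n * (d n x)\<^sup>2)" if "x \<in> G" for x
    using that by (intro summable_suminf_not_top) (auto simp: G_def H_def)
  have wG: "(\<Sum>n\<in>I. 4 ^ n * (d n x)\<^sup>2) \<le> enn2real (H x)" if "x \<in> G" "finite I" for x I
  proof -
    have "ennreal (\<Sum>n. 4 ^ n * (d n x)\<^sup>2) = H x"
      unfolding H_def by (rule suminf_ennreal2[symmetric]) (auto intro!: summ that)
    then have "enn2real (H x) = (\<Sum>n. 4 ^ n * (d n x)\<^sup>2)"
      using enn2real_ennreal[OF suminf_nonneg[OF summ[OF that(1)]]] by simp
    then show ?thesis using sum_le_suminf[OF summ[OF that(1)] that(2)] by simp
  qed
  have bound: "norm (s m x - s n x) \<le> w x" if "x \<in> G" "n \<le> m" for x m n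
  proof -
    have "norm (s m x - s n x) = norm (\<Sum>k=n..<m. s (Suc k) x - s k x)"
      by (simp add: sum_Suc_diff'[OF that(2), of "\<lambda>k. s k x"])
    also have "\<dots> \<le> (\<Sum>k=n..<m. d k x)" unfolding d_def by (rule norm_sum)
    also have "\<dots> \<le> w x"
      unfolding w_def
    proof (rule real_le_rsqrt)
      \<comment> \<open>The weight \<open>2 ^ k\<close> is split off so that both factors of the Cauchy--Schwarz bound are summable.\<close>
      have "(\<Sum>k=n..<m. d k x)\<^sup>2 = (\<Sum>k=n..<m. (1/2) ^ k * (2 ^ k * d k x))\<^sup>2"
        by (simp add: power_divide)
      also have "\<dots> \<le> (\<Sum>k=n..<m. ((1/2) ^ k)\<^sup>2) * (\<Sum>k=n..<m. (2 ^ k * d k x)\<^sup>2)"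
        by (rule Cauchy_Schwarz_ineq_sum)
      also have "\<dots> = (\<Sum>k=n..<m. (1/4) ^ k) * (\<Sum>k=n..<m. 4 ^ k * (d k x)\<^sup>2)"
        by (simp add: power_mult_distrib power_even_eq[symmetric] power_mult[symmetric] mult.commute[of _ 2] power_divide)
          (simp add: power_mult)
      also have "\<dots> \<le> 2 * enn2real (H x)"
      proof (intro mult_mono wG that)
        have "(\<Sum>k=n..<m. (1/4 :: real) ^ k) \<le> (\<Sum>k. (1/4) ^ k)"
          by (intro sum_le_suminf) (auto intro!: summable_geometric)
        also have "\<dots> \<le> 2" by (subst suminf_geometric) auto
        finally show "(\<Sum>k=n..<m. (1/4 :: real) ^ k) \<le> 2" .
      qed (auto intro!: sum_nonneg)
      finally show "(\<Sum>k=n..<m. d k x)\<^sup>2 \<le> 2 * enn2real (H x)" .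
    qed
    finally show ?thesis .
  qed
  have conv: "convergent (\<lambda>n. s n x)" if "x \<in> G" for x
  proof -
    have "summable (\<lambda>n. d n x)"
    proof (rule summable_comparison_test')
      show "summable (\<lambda>n. 4 ^ n * (d n x)\<^sup>2 + (1/4) ^ n)"
        by (intro summable_add summ that) (auto intro!: summable_geometric)
      show "norm (d n x) \<le> 4 ^ n * (d n x)\<^sup>2 + (1/4) ^ n" if "n \<ge> 0" for n
      proof (cases "d n x \<le> (1/4) ^ n")
        case False
        then have "1 * d n x \<le> (4 ^ n * d n x) * d n x"
          by (intro mult_right_mono) (auto simp: power_divide field_simps)
        then show ?thesis by (simp add: power2_eq_square mult.assoc add_increasing2)
      qed (rule add_increasing, simp_all)
    qed
    then have "summable (\<lambda>n. s (Suc n) x - s n x)"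
      unfolding d_def by (rule summable_norm_cancel)
    then have "(\<lambda>n. \<Sum>k<n. s (Suc k) x - s k x) \<longlonglongrightarrow> (\<Sum>k. s (Suc k) x - s k x)"
      by (rule summable_LIMSEQ)
    then have "(\<lambda>n. (s n x - s 0 x) + s 0 x) \<longlonglongrightarrow> (\<Sum>k. s (Suc k) x - s k x) + s 0 x"
      unfolding sum_lessThan_telescope[of "\<lambda>k. s k x"] by (intro tendsto_add tendsto_const)
    then show ?thesis unfolding convergent_def by auto
  qed
  define t where "t n x = indicator G x *\<^sub>R s n x" for n x
  define f where "f x = lim (\<lambda>n. t n x)" for x
  have t_lim: "(\<lambda>n. t n x) \<longlonglongrightarrow> f x" for x
  proof -
    have "convergent (\<lambda>n. t n x)"
      using conv[of x] convergent_const[of 0] by (cases "x \<in> G") (auto simp: t_def)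
    then show ?thesis by (simp add: f_def convergent_LIMSEQ_iff)
  qed
  have t_simple: "simple_function lborel (t n)" for n
    unfolding t_def[abs_def] by (rule simple_function_scaleR_indicator[OF s G_meas])
  have t_sq: "square_integrable (t n)" for n
    unfolding t_def[abs_def] by (rule square_integrable_scaleR_indicator[OF G_meas sq])
  have f_meas: "strongly_measurable f"
    unfolding strongly_measurable_def by (intro exI[of _ t] conjI allI t_simple t_lim)
  have t_bound: "norm (t n x - f x) \<le> w x" for n x
  proof (rule Lim_bounded[where M=n])
    show "(\<lambda>m. norm (t n x - t m x)) \<longlonglongrightarrow> norm (t n x - f x)"
      by (intro tendsto_intros t_lim)
    have "0 \<le> w x" by (simp add: w_def)
    then show "\<forall>m\<ge>n. norm (t n x - t m x) \<le> w x"
      using bound[of x n] by (auto simp: t_def indicator_def norm_minus_commute)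
  qed
  have ft: "square_integrable (\<lambda>x. f x - t 0 x)"
  proof (rule square_integrable_bound[OF _ w, where K=1])
    show "strongly_measurable (\<lambda>x. f x - t 0 x)"
      by (rule strongly_measurable_compose2[OF f_meas strongly_measurable_simple[OF t_simple] tendsto_diff])
    show "norm (f x - t 0 x) \<le> 1 * norm (w x)" for x
      using t_bound[of 0 x] by (simp add: norm_minus_commute)
  qed
  have f: "square_integrable f" using square_integrable_add[OF ft t_sq[of 0]] by simp
  have "(\<lambda>n. abs_L2R (t n)) \<longlonglongrightarrow> abs_L2R f"
  proof (rule L2R_dominated_convergence[OF t_sq f w, where K=1])
    show "AE x in lborel. norm (t n x - f x) \<le> 1 * norm (w x)" for n
      by (rule AE_I2) (use order_trans[OF t_bound abs_ge_self] in simp)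
  qed (simp add: t_lim)
  moreover have "abs_L2R (t n) = abs_L2R (s n)" for n
    unfolding abs_L2R_eq_iff[OF t_sq sq] using AE_G by eventually_elim (simp add: t_def)
  ultimately show ?thesis using f by auto
qed

text \<open>
  A Cauchy sequence of classes is shadowed by simple functions that approximate a rapidly
  converging subsequence.
\<close>

lemma L2R_Cauchy_convergent:
  fixes X :: "nat \<Rightarrow> 'a::complex_hilbert L2R"
  assumes "Cauchy X"
  shows "convergent X"
proof -
  define e :: "nat \<Rightarrow> real" where "e n = (1/4) ^ n / 4" for n
  have e: "e n > 0" for n by (simp add: e_def)
  have "\<forall>n. \<exists>N. \<forall>i\<ge>N. \<forall>j\<ge>N. norm (X i - X j) < e n"
    using assms e unfolding Cauchy_iff by blast
  then obtain N where N: "\<And>n i j. i \<ge> N n \<Longrightarrow> j \<ge> N n \<Longrightarrow> norm (X i - X j) < e n"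
    by metis
  define M where "M n = Max (N ` {..n}) + n" for n
  have M: "N k \<le> M n" if "k \<le> n" for k n
    unfolding M_def using that by (intro trans_le_add1 Max_ge) auto
  have "\<forall>n. \<exists>s. simple_function lborel s \<and> square_integrable s \<and> norm (abs_L2R s - X (M n)) < e n"
    using L2R_simple_approx e by blast
  then obtain s where s: "\<And>n. simple_function lborel (s n)" "\<And>n. square_integrable (s n)"
    and sX: "\<And>n. norm (abs_L2R (s n) - X (M n)) < e n"
    by metis
  have "L2_norm (\<lambda>x. s (Suc n) x - s n x) \<le> (1/4) ^ n" for n
  proof -
    have "L2_norm (\<lambda>x. s (Suc n) x - s n x) = norm (abs_L2R (s (Suc n)) - abs_L2R (s n))"
      by (simp add: diff_L2R_abs s norm_L2R_abs square_integrable_diff)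
    also have "\<dots> = norm ((abs_L2R (s (Suc n)) - X (M (Suc n))) + ((X (M (Suc n)) - X (M n)) + (X (M n) - abs_L2R (s n))))"
      by simp
    also have "\<dots> \<le> e (Suc n) + (e n + e n)"
    proof (intro norm_triangle_le add_mono)
      show "norm (abs_L2R (s (Suc n)) - X (M (Suc n))) \<le> e (Suc n)" using sX[of "Suc n"] by simp
      show "norm (X (M (Suc n)) - X (M n)) \<le> e n"
        using N[of n "M (Suc n)" "M n"] M[of n "Suc n"] M[of n n] by simp
      show "norm (X (M n) - abs_L2R (s n)) \<le> e n"
        using sX[of n] by (simp add: norm_minus_commute)
    qed
    also have "\<dots> \<le> (1/4) ^ n" by (simp add: e_def)
    finally show ?thesis .
  qed
  from simple_L2_Cauchy_limit[OF s this] obtain f where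
    f: "(\<lambda>n. abs_L2R (s n)) \<longlonglongrightarrow> abs_L2R f" by blast
  have e0: "e \<longlonglongrightarrow> 0"
    unfolding e_def[abs_def] by (intro tendsto_divide_zero LIMSEQ_power_zero) simp
  have "X \<longlonglongrightarrow> abs_L2R f"
  proof (rule LIMSEQ_I)
    fix r :: real assume "r > 0"
    have "\<forall>\<^sub>F n in sequentially. e n < r / 3" "\<forall>\<^sub>F n in sequentially. norm (abs_L2R (s n) - abs_L2R f) < r / 3"
      using order_tendstoD(2)[OF e0, of "r/3"] tendstoD[OF f, of "r/3"] \<open>r > 0\<close>
      by (auto simp: dist_norm)
    then have "\<forall>\<^sub>F n in sequentially. e n < r / 3 \<and> norm (abs_L2R (s n) - abs_L2R f) < r / 3"
      by (rule eventually_conj)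
    then obtain n where n: "e n < r / 3" "norm (abs_L2R (s n) - abs_L2R f) < r / 3"
      using eventually_happens'[OF sequentially_bot] by blast
    have "norm (X m - abs_L2R f) < r" if "m \<ge> N n" for m
    proof -
      have "norm (X m - abs_L2R f) = norm ((X m - X (M n)) + ((X (M n) - abs_L2R (s n)) + (abs_L2R (s n) - abs_L2R f)))"
        by simp
      also have "\<dots> \<le> norm (X m - X (M n)) + (norm (X (M n) - abs_L2R (s n)) + norm (abs_L2R (s n) - abs_L2R f))"
        by (intro norm_triangle_mono order_refl)
      also have "\<dots> < r / 3 + (r / 3 + r / 3)"
        using N[OF that, of "M n"] M[of n n] sX[of n] n norm_minus_commute[of "X (M n)" "abs_L2R (s n)"]
        by linarith
      finally show ?thesis by simp
    qed
    then show "\<exists>no. \<forall>m\<ge>no. norm (X m - abs_L2R f) < r" by blast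
  qed
  then show ?thesis unfolding convergent_def by blast
qed

section \<open>The inner product of square-integrable classes\<close>

lemma integrable_cinner:
  fixes f g :: "real \<Rightarrow> 'a::complex_hilbert"
  assumes f: "square_integrable f" and g: "square_integrable g"
  shows "integrable lborel (\<lambda>x. cinner (f x) (g x))"
proof (rule Bochner_Integration.integrable_bound)
  show "integrable lborel (\<lambda>x. (norm (f x))\<^sup>2 + (norm (g x))\<^sup>2)"
    using f g by (simp add: square_integrable_def)
  show "(\<lambda>x. cinner (f x) (g x)) \<in> borel_measurable lborel"
    by (intro borel_measurable_cinner strongly_measurable_square_integrable f g)
  show "AE x in lborel. norm (cinner (f x) (g x)) \<le> norm ((norm (f x))\<^sup>2 + (norm (g x))\<^sup>2)"
  proof (rule AE_I2)
    fix x
    have "norm (cinner (f x) (g x)) \<le> norm (f x) * norm (g x)" by (rule cinner_Cauchy_Schwarz)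
    also have "\<dots> \<le> (norm (f x))\<^sup>2 + (norm (g x))\<^sup>2"
    proof -
      have "0 \<le> norm (f x) * norm (g x)" by simp
      then show ?thesis using sum_squares_bound[of "norm (f x)" "norm (g x)"] by linarith
    qed
    finally show "norm (cinner (f x) (g x)) \<le> norm ((norm (f x))\<^sup>2 + (norm (g x))\<^sup>2)" by simp
  qed
qed

lemmas integrable_cinner_rep = integrable_cinner[OF square_integrable_rep square_integrable_rep]

lemma measurable_cinner_rep [measurable]:
  "(\<lambda>x. cinner (rep_L2R f x) (rep_L2R g x)) \<in> borel_measurable borel"
  using borel_measurable_cinner[OF strongly_measurable_rep[of f] strongly_measurable_rep[of g]] by simp

instantiation L2R :: (complex_hilbert) complex_hilbert
begin

definition cinner_L2R :: "'a L2R \<Rightarrow> 'a L2R \<Rightarrow> complex"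
  where "cinner_L2R f g = (\<integral>x. cinner (rep_L2R f x) (rep_L2R g x) \<partial>lborel)"

instance
proof
  fix f g k :: "'a L2R" and c :: complex
  show "convergent X" if "Cauchy X" for X :: "nat \<Rightarrow> 'a L2R"
    by (rule L2R_Cauchy_convergent[OF that])
  have "(\<integral>x. cinner (rep_L2R (f + g) x) (rep_L2R k x) \<partial>lborel)
      = (\<integral>x. cinner (rep_L2R f x) (rep_L2R k x) + cinner (rep_L2R g x) (rep_L2R k x) \<partial>lborel)"
  proof (rule integral_cong_AE)
    show "AE x in lborel. cinner (rep_L2R (f + g) x) (rep_L2R k x)
        = cinner (rep_L2R f x) (rep_L2R k x) + cinner (rep_L2R g x) (rep_L2R k x)"
      using rep_add_L2R[of f g] by eventually_elim (simp add: cinner_add_left)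
  qed measurable
  then show "cinner (f + g) k = cinner f k + cinner g k"
    by (simp add: cinner_L2R_def integrable_cinner_rep)
  have "(\<integral>x. cinner (rep_L2R (c *\<^sub>C f) x) (rep_L2R g x) \<partial>lborel)
      = (\<integral>x. c * cinner (rep_L2R f x) (rep_L2R g x) \<partial>lborel)"
  proof (rule integral_cong_AE)
    show "AE x in lborel. cinner (rep_L2R (c *\<^sub>C f) x) (rep_L2R g x)
        = c * cinner (rep_L2R f x) (rep_L2R g x)"
      using rep_scaleC_L2R[of c f] by eventually_elim (simp add: cinner_scaleC_left)
  qed measurable
  then show "cinner (c *\<^sub>C f) g = c * cinner f g"
    by (simp add: cinner_L2R_def)
  have "cinner f g = (\<integral>x. cnj (cinner (rep_L2R g x) (rep_L2R f x)) \<partial>lborel)"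
    unfolding cinner_L2R_def by (rule Bochner_Integration.integral_cong[OF refl]) (rule cinner_commute)
  also have "\<dots> = cnj (cinner g f)"
    unfolding cinner_L2R_def by (rule Bochner_Integration.integral_cnj)
  finally show "cinner f g = cnj (cinner g f)" .
  show "cinner f f = complex_of_real ((norm f)\<^sup>2)"
    unfolding cinner_L2R_def cinner_self norm_L2R_square by (rule integral_complex_of_real)
qed

end

lemma cinner_L2R_abs:
  fixes f g :: "real \<Rightarrow> 'a::complex_hilbert"
  assumes f: "square_integrable f" and g: "square_integrable g"
  shows "cinner (abs_L2R f) (abs_L2R g) = (\<integral>x. cinner (f x) (g x) \<partial>lborel)"
  unfolding cinner_L2R_def
proof (rule integral_cong_AE)
  show "(\<lambda>x. cinner (f x) (g x)) \<in> borel_measurable lborel"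
    by (intro borel_measurable_cinner strongly_measurable_square_integrable f g)
  show "AE x in lborel. cinner (rep_L2R (abs_L2R f) x) (rep_L2R (abs_L2R g) x) = cinner (f x) (g x)"
    using rep_abs_L2R[OF f] rep_abs_L2R[OF g] by eventually_elim simp
qed simp

section \<open>Totality of the intervals\<close>

definition tensor :: "(real \<Rightarrow> complex) \<Rightarrow> 'a::complex_normed_vector \<Rightarrow> 'a L2R"
  where "tensor \<phi> v = abs_L2R (\<lambda>x. \<phi> x *\<^sub>C v)"

lemma square_integrable_tensor:
  assumes "square_integrable \<phi>"
  shows "square_integrable (\<lambda>x. \<phi> x *\<^sub>C (v::'a::complex_normed_vector))"
proof (rule square_integrable_bound[OF _ assms])
  show "strongly_measurable (\<lambda>x. \<phi> x *\<^sub>C v)"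
    by (rule strongly_measurable_compose2[OF strongly_measurable_square_integrable[OF assms]
          strongly_measurable_const tendsto_scaleC])
  show "norm (\<phi> x *\<^sub>C v) \<le> norm v * norm (\<phi> x)" for x
    by (simp add: norm_scaleC)
qed

lemma cinner_tensor:
  fixes v w :: "'a::complex_hilbert"
  assumes "square_integrable \<phi>" "square_integrable \<psi>"
  shows "cinner (tensor \<phi> v) (tensor \<psi> w) = (\<integral>x. \<phi> x * cnj (\<psi> x) \<partial>lborel) * cinner v w"
proof -
  have "cinner (tensor \<phi> v) (tensor \<psi> w) = (\<integral>x. \<phi> x * cnj (\<psi> x) * cinner v w \<partial>lborel)"
    unfolding tensor_def
    by (simp add: cinner_L2R_abs square_integrable_tensor assms cinner_scaleC_left cinner_scaleC_right
        ac_simps)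
  then show ?thesis by simp
qed

lemma cinner_tensor_right:
  fixes v :: "'a::complex_hilbert"
  assumes "square_integrable f" "square_integrable \<psi>"
  shows "cinner (abs_L2R f) (tensor \<psi> v) = (\<integral>x. cnj (\<psi> x) * cinner (f x) v \<partial>lborel)"
  unfolding tensor_def
  by (simp add: cinner_L2R_abs square_integrable_tensor assms cinner_scaleC_right)

lemma square_integrable_indicator:
  assumes "A \<in> sets borel" "emeasure lborel A < \<infinity>"
  shows "square_integrable (indicator A :: real \<Rightarrow> complex)"
proof -
  have *: "(\<lambda>x. (norm (indicator A x :: complex))\<^sup>2) = (indicator A :: real \<Rightarrow> real)"
    by (auto simp: indicator_def)
  show ?thesis
    unfolding square_integrable_def strongly_measurable_iff_borel *
    using assms by (auto intro!: integrable_real_indicator)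
qed

lemma square_integrable_indicator_bounded:
  "A \<in> sets borel \<Longrightarrow> A \<subseteq> {a..b} \<Longrightarrow> square_integrable (indicator A :: real \<Rightarrow> complex)"
proof (rule square_integrable_indicator)
  assume A: "A \<in> sets borel" "A \<subseteq> {a..b}"
  have "emeasure lborel A \<le> emeasure lborel {a..b}" using A by (intro emeasure_mono) auto
  also have "\<dots> < \<infinity>" by (cases "a \<le> b") simp_all
  finally show "emeasure lborel A < \<infinity>" .
qed

lemma tensor_add_left:
  assumes "square_integrable \<phi>" "square_integrable \<psi>"
  shows "tensor (\<lambda>x. \<phi> x + \<psi> x) v = tensor \<phi> v + tensor \<psi> (v::'a::complex_normed_vector)"
  unfolding tensor_def
  by (simp add: add_L2R_abs square_integrable_tensor assms scaleC_add_left)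

lemma tensor_sum_left:
  assumes "finite I" "\<And>i. i \<in> I \<Longrightarrow> square_integrable (\<phi> i)"
  shows "tensor (\<lambda>x. \<Sum>i\<in>I. \<phi> i x) v = (\<Sum>i\<in>I. tensor (\<phi> i) (v::'a::complex_normed_vector))
    \<and> square_integrable (\<lambda>x. \<Sum>i\<in>I. \<phi> i x)"
  using assms
proof (induction I)
  case empty
  then show ?case by (simp add: tensor_def zero_L2R_abs square_integrable_zero)
next
  case (insert i I)
  then show ?case
    using tensor_add_left[of "\<phi> i" "\<lambda>x. \<Sum>i\<in>I. \<phi> i x" v]
      square_integrable_add[of "\<phi> i" "\<lambda>x. \<Sum>i\<in>I. \<phi> i x"] by simp
qed

lemma abs_L2R_sum:
  assumes "finite I" "\<And>i. i \<in> I \<Longrightarrow> square_integrable (u i)"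
  shows "abs_L2R (\<lambda>x. \<Sum>i\<in>I. u i x) = (\<Sum>i\<in>I. abs_L2R (u i :: real \<Rightarrow> 'a::complex_normed_vector))
    \<and> square_integrable (\<lambda>x. \<Sum>i\<in>I. u i x)"
  using assms
proof (induction I)
  case empty
  then show ?case by (simp add: zero_L2R_abs square_integrable_zero)
next
  case (insert i I)
  then show ?case
    using add_L2R_abs[of "u i" "\<lambda>x. \<Sum>i\<in>I. u i x"]
      square_integrable_add[of "u i" "\<lambda>x. \<Sum>i\<in>I. u i x"] by simp
qed

lemma closed_csubspace_limit:
  assumes "closed_csubspace S" "\<And>n. u n \<in> S" "u \<longlonglongrightarrow> x"
  shows "x \<in> S"
  using assms unfolding closed_csubspace_def closed_sequential_limits by blast

lemma closed_csubspace_sum: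
  assumes S: "closed_csubspace S" and u: "\<And>i. i \<in> I \<Longrightarrow> u i \<in> S"
  shows "(\<Sum>i\<in>I. u i) \<in> S"
  using u
proof (induction I rule: infinite_finite_induct)
  case (insert i I)
  then have "u i \<in> S" "(\<Sum>i\<in>I. u i) \<in> S" by auto
  then show ?case using insert.hyps S unfolding closed_csubspace_def by simp
qed (use S in \<open>auto simp: closed_csubspace_def\<close>)

lemma closed_csubspace_diff:
  assumes S: "closed_csubspace S" and "x \<in> S" "y \<in> S"
  shows "x - y \<in> S"
proof -
  have "(-1) *\<^sub>C y \<in> S" using assms unfolding closed_csubspace_def by blast
  then have "x + (-1) *\<^sub>C y \<in> S" using assms unfolding closed_csubspace_def by blast
  then show ?thesis by (simp add: scaleC_minus_one)
qed

definition interval_tensor :: "real \<times> real \<times> 'a::complex_normed_vector \<Rightarrow> 'a L2R"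
  where "interval_tensor = (\<lambda>(a, b, v). tensor (indicator {a<..b}) v)"

lemma tendsto_tensor_indicator:
  fixes v :: "'a::complex_normed_vector"
  assumes A: "\<And>n. A n \<in> sets borel" and sub: "\<And>n. A n \<subseteq> B"
    and B: "square_integrable (indicator B :: real \<Rightarrow> complex)"
    and lim: "\<And>x. (\<lambda>n. indicator (A n) x :: complex) \<longlonglongrightarrow> indicator B x"
  shows "(\<lambda>n. tensor (indicator (A n)) v) \<longlonglongrightarrow> tensor (indicator B) v"
  unfolding tensor_def
proof (rule L2R_dominated_convergence'[where K=1])
  show "strongly_measurable (\<lambda>x. indicator (A n) x *\<^sub>C v)" for n
    using A by (intro strongly_measurable_scaleC_fun strongly_measurable_const) simp
  show "square_integrable (\<lambda>x. indicator B x *\<^sub>C v)" by (rule square_integrable_tensor[OF B])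
  show "(\<lambda>n. indicator (A n) x *\<^sub>C v) \<longlonglongrightarrow> indicator B x *\<^sub>C v" for x
    by (rule tendsto_scaleC[OF lim tendsto_const])
  show "norm (indicator (A n) x *\<^sub>C v) \<le> 1 * norm (indicator B x *\<^sub>C v)" for n x
    using sub[of n] by (auto simp: indicator_def)
qed

text \<open>
  Half-open intervals are stable under intersection and generate the Borel sets, so Dynkin's
  induction applies; the window \<open>{-N<..N}\<close> keeps all measures finite, also under complements.
\<close>

lemma bounded_borel_tensor_mem:
  fixes v :: "'a::complex_normed_vector"
  assumes S: "closed_csubspace S" "range interval_tensor \<subseteq> S" and A: "A \<in> sets borel"
  shows "tensor (indicator (A \<inter> {-N<..N})) v \<in> S"
proof -
  define W where "W = {-N<..N}"
  have W: "W \<in> sets borel" "W \<subseteq> {-N..N}" by (auto simp: W_def)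
  have iv: "tensor (indicator {a<..b}) v \<in> S" for a b
    using subsetD[OF S(2) rangeI, of "(a, b, v)"] by (simp add: interval_tensor_def)
  have sqW: "square_integrable (indicator (B \<inter> W) :: real \<Rightarrow> complex)" if "B \<in> sets borel" for B
    by (rule square_integrable_indicator_bounded[of _ "-N" N]) (use that W in auto)
  have sets: "sets borel = sigma_sets UNIV (range (\<lambda>(a, b). {a<..b::real}))"
    by (subst borel_sigma_sets_Ioc) (simp add: sets_measure_of)
  have stable: "Int_stable (range (\<lambda>(a, b). {a<..b::real}))"
  proof (rule Int_stableI, safe)
    fix a b c d :: real
    have "{a<..b} \<inter> {c<..d} = {max a c<..min b d}" by auto
    then show "{a<..b} \<inter> {c<..d} \<in> range (\<lambda>(a, b). {a<..b})" by auto
  qed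
  have sub: "range (\<lambda>(a, b). {a<..b::real}) \<subseteq> Pow UNIV" by simp
  have "A \<in> sigma_sets UNIV (range (\<lambda>(a, b). {a<..b::real}))" using A sets by simp
  with stable sub have "tensor (indicator (A \<inter> W)) v \<in> S"
  proof (induction rule: sigma_sets_induct_disjoint)
    case (basic A)
    then obtain a b where "A = {a<..b}" by auto
    then have "A \<inter> W = {max a (- N)<..min b N}" by (auto simp: W_def)
    then show ?case using iv by simp
  next
    case empty
    have "{} \<inter> W = {0<..0}" by auto
    then show ?case using iv[of 0 0] by (simp only:)
  next
    case (compl A)
    then have A: "A \<in> sets borel" using sets by simp
    have "(indicator W :: real \<Rightarrow> complex) = (\<lambda>x. indicator ((UNIV - A) \<inter> W) x + indicator (A \<inter> W) x)"
      by (auto simp: indicator_def)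
    then have "tensor (indicator W) v = tensor (indicator ((UNIV - A) \<inter> W)) v + tensor (indicator (A \<inter> W)) v"
      using tensor_add_left[OF sqW sqW, of "UNIV - A" A v] A by simp
    then have "tensor (indicator ((UNIV - A) \<inter> W)) v = tensor (indicator W) v - tensor (indicator (A \<inter> W)) v"
      by simp
    then show ?case using closed_csubspace_diff[OF S(1) iv compl.IH, of "-N" N] by (simp add: W_def)
  next
    case (union A)
    have A: "A i \<in> sets borel" for i using union(2) sets by blast
    define B where "B n = (\<Union>i<n. A i) \<inter> W" for n
    have "(\<lambda>n. tensor (indicator (B n)) v) \<longlonglongrightarrow> tensor (indicator ((\<Union>i. A i) \<inter> W)) v"
    proof (rule tendsto_tensor_indicator)
      show "B n \<in> sets borel" for n using A W by (auto simp: B_def)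
      show "square_integrable (indicator ((\<Union>i. A i) \<inter> W) :: real \<Rightarrow> complex)"
        using A by (intro sqW) auto
      show "(\<lambda>n. indicator (B n) x :: complex) \<longlonglongrightarrow> indicator ((\<Union>i. A i) \<inter> W) x" for x
        using LIMSEQ_indicator_UN[of A x] by (cases "x \<in> W") (simp_all add: B_def indicator_def)
    qed (auto simp: B_def)
    moreover have "tensor (indicator (B n)) v \<in> S" for n
    proof -
      have "(indicator (B n) :: real \<Rightarrow> complex) = (\<lambda>x. \<Sum>i<n. indicator (A i \<inter> W) x)"
      proof
        fix x
        have disj: "disjoint_family_on A {..<n}"
          using union(1) by (rule disjoint_family_on_mono[rotated]) simp
        have "(\<Sum>i<n. indicator (A i) x :: complex) = indicator (\<Union>i<n. A i) x"
          by (rule indicator_UN_disjoint[symmetric]) (use disj in auto)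
        then show "(indicator (B n) x :: complex) = (\<Sum>i<n. indicator (A i \<inter> W) x)"
          by (simp only: B_def indicator_inter_arith sum_distrib_right[symmetric])
      qed
      then have "tensor (indicator (B n)) v = (\<Sum>i<n. tensor (indicator (A i \<inter> W)) v)"
        using tensor_sum_left[of "{..<n}" "\<lambda>i. indicator (A i \<inter> W)" v] sqW[OF A] by simp
      moreover have "(\<Sum>i<n. tensor (indicator (A i \<inter> W)) v) \<in> S"
        by (rule closed_csubspace_sum[OF S(1)]) (rule union.IH)
      ultimately show ?thesis by simp
    qed
    ultimately show ?case by (rule closed_csubspace_limit[OF S(1), rotated])
  qed
  then show ?thesis by (simp add: W_def)
qed

text \<open>
  Every class is a limit of simple functions cut off to bounded windows, and such a function is a
  finite sum of tensors of bounded Borel sets.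
\<close>

lemma total_interval_tensor: "total_family (interval_tensor :: _ \<Rightarrow> 'a::complex_normed_vector L2R)"
  unfolding total_family_def
proof (intro allI impI subset_antisym subset_UNIV subsetI)
  fix S :: "'a L2R set" and F :: "'a L2R"
  assume S: "closed_csubspace S" "range interval_tensor \<subseteq> S"
  obtain s where s: "\<And>n. simple_function lborel (s n)" "\<And>x. (\<lambda>n. s n x) \<longlonglongrightarrow> rep_L2R F x"
    "\<And>n x. norm (s n x) \<le> 2 * norm (rep_L2R F x)"
    using strongly_measurable_dominated_simple[OF strongly_measurable_rep[of F]] by blast
  define W :: "nat \<Rightarrow> real set" where "W n = {-real n<..real n}" for n
  define t where "t n x = indicator (W n) x *\<^sub>R s n x" for n x
  have "(\<lambda>n. abs_L2R (t n)) \<longlonglongrightarrow> abs_L2R (rep_L2R F)"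
  proof (rule L2R_dominated_convergence'[where K=2])
    show "strongly_measurable (t n)" for n
      unfolding t_def[abs_def]
      by (rule strongly_measurable_simple[OF simple_function_scaleR_indicator[OF s(1)]]) (simp add: W_def)
    show "square_integrable (rep_L2R F)" by (rule square_integrable_rep)
    show "(\<lambda>n. t n x) \<longlonglongrightarrow> rep_L2R F x" for x
    proof (rule Lim_transform_eventually[OF s(2)])
      obtain m :: nat where m: "\<bar>x\<bar> < real m" using reals_Archimedean2 by blast
      have "s n x = t n x" if "n \<ge> m" for n
      proof -
        have "\<bar>x\<bar> < real n" using m that by simp
        then have "x \<in> W n" by (auto simp: W_def)
        then show ?thesis by (simp add: t_def)
      qed
      then show "\<forall>\<^sub>F n in sequentially. s n x = t n x"
        using eventually_sequentially by blast
    qed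
    show "norm (t n x) \<le> 2 * norm (rep_L2R F x)" for n x
      using s(3)[of n x] by (simp add: t_def indicator_def)
  qed
  moreover have "abs_L2R (t n) \<in> S" for n
  proof -
    have meas: "s n -` {y} \<in> sets borel" for y
      using simple_functionD(2)[OF s(1)[of n], of "{y}"] by simp
    have fin: "finite (range (s n))" using simple_functionD(1)[OF s(1)[of n]] by simp
    have sqi: "square_integrable (indicator (s n -` {y} \<inter> W n) :: real \<Rightarrow> complex)" for y
      by (rule square_integrable_indicator_bounded[of _ "- real n" "real n"]) (use meas in \<open>auto simp: W_def\<close>)
    have "t n x = (\<Sum>y\<in>range (s n). indicator (s n -` {y} \<inter> W n) x *\<^sub>C y)" for x
    proof -
      have "(\<Sum>y\<in>range (s n). indicator (s n -` {y} \<inter> W n) x *\<^sub>C y)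
          = (\<Sum>y\<in>range (s n). if y = s n x then indicator (W n) x *\<^sub>C y else 0)"
        by (rule sum.cong) (auto simp: indicator_def)
      also have "\<dots> = indicator (W n) x *\<^sub>C s n x" using fin by simp
      also have "\<dots> = t n x" by (simp add: t_def indicator_def scaleC_one)
      finally show ?thesis ..
    qed
    then have "t n = (\<lambda>x. \<Sum>y\<in>range (s n). indicator (s n -` {y} \<inter> W n) x *\<^sub>C y)" by blast
    then have "abs_L2R (t n) = (\<Sum>y\<in>range (s n). tensor (indicator (s n -` {y} \<inter> W n)) y)"
      using conjunct1[OF abs_L2R_sum[OF fin square_integrable_tensor[OF sqi]]]
      by (simp add: tensor_def)
    also have "\<dots> \<in> S"
      unfolding W_def by (rule closed_csubspace_sum[OF S(1)]) (rule bounded_borel_tensor_mem[OF S meas])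
    finally show ?thesis .
  qed
  ultimately show "F \<in> S" using closed_csubspace_limit[OF S(1), of "\<lambda>n. abs_L2R (t n)" F] by simp
qed

section \<open>The Fourier transform of intervals\<close>

definition ft_set :: "real set \<Rightarrow> real \<Rightarrow> complex"
  where "ft_set A t = (\<integral>x. indicator A x * iexp (x * t) \<partial>lborel) / sqrt (2 * pi)"

lemma integrable_indicator_iexp:
  assumes "A \<in> sets borel" "emeasure lborel A < \<infinity>"
  shows "integrable lborel (\<lambda>x. indicator A x * iexp (x * t))"
proof (rule Bochner_Integration.integrable_bound[where f="indicator A :: real \<Rightarrow> real"])
  show "integrable lborel (indicator A :: real \<Rightarrow> real)"
    using assms by (intro integrable_real_indicator) auto
  show "AE x in lborel. norm (indicator A x * iexp (x * t)) \<le> norm (indicat_real A x)"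
    by (rule AE_I2) (auto simp: norm_mult indicator_def simp del: of_real_mult)
qed (use assms in measurable)

lemma measurable_ft_set [measurable]:
  assumes [measurable]: "A \<in> sets borel"
  shows "ft_set A \<in> borel_measurable borel"
proof -
  have "(\<lambda>t. \<integral>x. indicator A x * iexp (x * t) \<partial>lborel) \<in> borel_measurable lborel"
    by (rule lborel.borel_measurable_lebesgue_integral) measurable
  then show ?thesis unfolding ft_set_def[abs_def] by simp
qed

lemma integral_Ioc_iexp:
  assumes "a \<le> b" "t \<noteq> 0"
  shows "(\<integral>x. indicator {a<..b} x * iexp (x * t) \<partial>lborel) = (iexp (b * t) - iexp (a * t)) / (\<i> * t)"
proof -
  have "(\<integral>x. indicator {a<..b} x * iexp (x * t) \<partial>lborel)
      = (\<integral>x. indicator {a..b} x *\<^sub>R iexp (x * t) \<partial>lborel)"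
  proof (rule integral_cong_AE)
    show "AE x in lborel. indicator {a<..b} x * iexp (x * t) = indicator {a..b} x *\<^sub>R iexp (x * t)"
      using AE_lborel_singleton[of a] by eventually_elim (auto simp: indicator_def)
  qed measurable
  also have "\<dots> = iexp (b * t) / (\<i> * t) - iexp (a * t) / (\<i> * t)"
  proof (rule integral_FTC_atLeastAtMost[OF assms(1)])
    show "((\<lambda>x. iexp (x * t) / (\<i> * t)) has_vector_derivative iexp (x * t)) (at x within {a..b})" for x
    proof -
      have "((\<lambda>z. exp (\<i> * (z * t)) / (\<i> * t)) has_field_derivative exp (\<i> * (of_real x * t))) (at (of_real x))"
        using assms(2) by (auto intro!: derivative_eq_intros simp: ac_simps)
      from has_vector_derivative_real_field[OF this] show ?thesis by simp
    qed
  qed (intro continuous_intros)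
  finally show ?thesis by (simp add: diff_divide_distrib)
qed

lemma tendsto_integral_windows:
  fixes g :: "real \<Rightarrow> 'a::{banach, second_countable_topology}"
  assumes g: "integrable lborel g" and A: "\<And>n. A n \<in> sets borel"
    and window: "\<And>n x. \<bar>x\<bar> < real n \<Longrightarrow> x \<in> A n"
  shows "(\<lambda>n. \<integral>x. indicator (A n) x *\<^sub>R g x \<partial>lborel) \<longlonglongrightarrow> (\<integral>x. g x \<partial>lborel)"
proof (rule integral_dominated_convergence[where w="\<lambda>x. norm (g x)"])
  have [measurable]: "g \<in> borel_measurable borel" using borel_measurable_integrable[OF g] by simp
  note [measurable] = A
  show "(\<lambda>x. indicator (A n) x *\<^sub>R g x) \<in> borel_measurable lborel" for n by measurable
  show "integrable lborel (\<lambda>x. norm (g x))" using g by (rule integrable_norm)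
  show "AE x in lborel. (\<lambda>n. indicator (A n) x *\<^sub>R g x) \<longlonglongrightarrow> g x"
  proof (rule AE_I2)
    fix x :: real
    obtain m :: nat where m: "\<bar>x\<bar> < real m" using reals_Archimedean2 by blast
    have "\<forall>\<^sub>F n in sequentially. g x = indicator (A n) x *\<^sub>R g x"
      using eventually_ge_at_top[of m] by eventually_elim (use m window in simp)
    then show "(\<lambda>n. indicator (A n) x *\<^sub>R g x) \<longlonglongrightarrow> g x"
      by (rule Lim_transform_eventually[OF tendsto_const])
  qed
  show "AE x in lborel. norm (indicator (A n) x *\<^sub>R g x) \<le> norm (g x)" for n
    by (rule AE_I2) (simp add: indicator_def)
qed (use borel_measurable_integrable[OF g] in simp)

lemma integrable_inverse_quadratic: "integrable lborel (\<lambda>x::real. 1 / (1 + x\<^sup>2))"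
proof -
  have "set_integrable lborel (einterval (- \<infinity>) \<infinity>) (\<lambda>x::real. 1 / (1 + x\<^sup>2))"
  proof (rule interval_integral_FTC_nonneg[where F=arctan])
    show "DERIV arctan x :> 1 / (1 + x\<^sup>2)" for x
      by (auto intro!: derivative_eq_intros simp: inverse_eq_divide)
    show "isCont (\<lambda>x::real. 1 / (1 + x\<^sup>2)) x" for x
      by (intro continuous_intros) (simp add: add_nonneg_eq_0_iff)
    show "((arctan \<circ> real_of_ereal) \<longlongrightarrow> - (pi / 2)) (at_right (- \<infinity>))"
      unfolding ereal_tendsto_simps by (rule tendsto_arctan_at_bot)
    show "((arctan \<circ> real_of_ereal) \<longlongrightarrow> pi / 2) (at_left \<infinity>)"
      unfolding ereal_tendsto_simps by (rule tendsto_arctan_at_top)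
  qed auto
  then show ?thesis by (simp add: set_integrable_def)
qed

lemma square_integrable_decay:
  fixes \<phi> :: "real \<Rightarrow> complex"
  assumes [measurable]: "\<phi> \<in> borel_measurable borel"
    and b1: "\<And>t. cmod (\<phi> t) \<le> K" and b2: "\<And>t. cmod (\<phi> t) * \<bar>t\<bar> \<le> K"
  shows "square_integrable \<phi>"
proof -
  have "integrable lborel (\<lambda>t. 2 * K\<^sup>2 * (1 / (1 + t\<^sup>2)))"
    by (intro integrable_mult_right integrable_inverse_quadratic)
  then have "integrable lborel (\<lambda>t. (norm (\<phi> t))\<^sup>2)"
  proof (rule Bochner_Integration.integrable_bound)
    show "AE t in lborel. norm ((norm (\<phi> t))\<^sup>2) \<le> norm (2 * K\<^sup>2 * (1 / (1 + t\<^sup>2)))"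
    proof (rule AE_I2)
      fix t :: real
      have "(cmod (\<phi> t))\<^sup>2 \<le> K\<^sup>2" "(cmod (\<phi> t) * \<bar>t\<bar>)\<^sup>2 \<le> K\<^sup>2"
        by (intro power_mono b1 b2; simp)+
      then have "(cmod (\<phi> t))\<^sup>2 * (1 + t\<^sup>2) \<le> 2 * K\<^sup>2"
        by (simp add: power_mult_distrib algebra_simps)
      moreover have "0 < 1 + t\<^sup>2" by (simp add: add_pos_nonneg)
      ultimately show "norm ((norm (\<phi> t))\<^sup>2) \<le> norm (2 * K\<^sup>2 * (1 / (1 + t\<^sup>2)))"
        by (simp add: pos_le_divide_eq)
    qed
  qed measurable
  then show ?thesis by (simp add: square_integrable_def strongly_measurable_iff_borel)
qed

lemma ft_set_empty [simp]: "ft_set {} t = 0"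
  by (simp add: ft_set_def)

lemma square_integrable_ft_set: "square_integrable (ft_set {a<..b})"
proof (cases "a < b")
  case False
  then have "ft_set {a<..b} = (\<lambda>t. 0)" by (simp add: fun_eq_iff)
  then show ?thesis using square_integrable_zero by metis
next
  case True
  define q where "q = sqrt (2 * pi)"
  have q: "q \<ge> 1" using pi_gt3 by (simp add: q_def)
  have "\<bar>q\<bar> = q" using q by simp
  have div: "x / q \<le> K" if "x \<le> K" "0 \<le> x" for x K
  proof -
    have "x / q \<le> x / 1" using q that by (intro divide_left_mono) auto
    then show ?thesis using that by simp
  qed
  show ?thesis
  proof (rule square_integrable_decay)
    fix t :: real
    have "cmod (\<integral>x. indicator {a<..b} x * iexp (x * t) \<partial>lborel) \<le> (\<integral>x. indicator {a<..b} x \<partial>lborel)"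
    proof -
      have "norm (indicator {a<..b} x * iexp (x * t)) = indicator {a<..b} x" for x
        by (simp add: norm_mult indicator_def del: of_real_mult)
      then show ?thesis
        using integral_norm_bound[of lborel "\<lambda>x. indicator {a<..b} x * iexp (x * t)"] by simp
    qed
    then have 1: "cmod (\<integral>x. indicator {a<..b} x * iexp (x * t) \<partial>lborel) \<le> b - a"
      using True by simp
    then have "cmod (ft_set {a<..b} t) \<le> b - a"
      unfolding ft_set_def norm_divide norm_of_real q_def[symmetric] \<open>\<bar>q\<bar> = q\<close>
      by (intro div norm_ge_zero)
    then show "cmod (ft_set {a<..b} t) \<le> max (b - a) 2" by simp
    show "cmod (ft_set {a<..b} t) * \<bar>t\<bar> \<le> max (b - a) 2"
    proof (cases "t = 0")
      case False
      have "cmod (iexp (b * t) - iexp (a * t)) \<le> 1 + 1"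
        by (rule order_trans[OF norm_triangle_ineq4]) (simp del: of_real_mult)
      moreover have "cmod (ft_set {a<..b} t) * \<bar>t\<bar> = cmod (iexp (b * t) - iexp (a * t)) / q"
        using False True q by (simp add: ft_set_def integral_Ioc_iexp norm_divide norm_mult flip: q_def del: of_real_mult)
      ultimately have "cmod (ft_set {a<..b} t) * \<bar>t\<bar> \<le> 2"
        using div[of "cmod (iexp (b * t) - iexp (a * t))" 2] by (simp only: norm_ge_zero one_add_one)
      then show ?thesis by simp
    qed (use True in simp)
  qed measurable
qed

text \<open>
  Plancherel's identity for two intervals is the inversion formula for characteristic functions,
  applied to the uniform distribution on one of them: up to constants, the integrand of that formula
  is the product of the two transforms, and it is absolutely integrable.
\<close>

lemma ft_set_Ioc_inner_aux:
  assumes "a \<le> b" "c < d"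
  shows "(\<integral>t. ft_set {c<..d} t * cnj (ft_set {a<..b} t) \<partial>lborel) = measure lborel ({a<..b} \<inter> {c<..d})"
proof -
  define I :: "real set" where "I = {c<..d}"
  \<comment> \<open>the uniform distribution on \<open>I\<close>, whose characteristic function is a multiple of \<open>ft_set I\<close>\<close>
  define M where "M = density lborel (\<lambda>x. ennreal (indicator I x / (d - c)))"
  have I [measurable]: "I \<in> sets borel" by (simp add: I_def)
  have nonneg: "0 \<le> indicator I x / (d - c)" for x using assms by simp
  have emM: "emeasure M A = ennreal (measure lborel (A \<inter> I) / (d - c))" if [measurable]: "A \<in> sets borel" for A
  proof -
    have fin: "emeasure lborel (A \<inter> I) < \<infinity>"
      using emeasure_mono[of "A \<inter> I" I lborel] assms by (auto simp: I_def intro: le_less_trans)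
    have "emeasure M A = (\<integral>\<^sup>+x. ennreal (indicator I x / (d - c)) * indicator A x \<partial>lborel)"
      unfolding M_def by (rule emeasure_density) auto
    also have "\<dots> = (\<integral>\<^sup>+x. ennreal (indicator (A \<inter> I) x / (d - c)) \<partial>lborel)"
      by (rule nn_integral_cong) (auto simp: indicator_def)
    also have "\<dots> = ennreal (\<integral>x. indicator (A \<inter> I) x / (d - c) \<partial>lborel)"
      using fin assms by (intro nn_integral_eq_integral) (auto intro!: integrable_real_indicator)
    also have "(\<integral>x. indicator (A \<inter> I) x / (d - c) \<partial>lborel) = measure lborel (A \<inter> I) / (d - c)" by simp
    finally show ?thesis .
  qed
  have "prob_space M"
  proof (rule prob_spaceI)
    have "emeasure M UNIV = 1" using assms by (simp add: emM I_def)
    then show "emeasure M (space M) = 1" by (simp add: M_def)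
  qed
  then interpret M: real_distribution M
    by (simp add: real_distribution_def real_distribution_axioms_def M_def)
  have meM: "measure M A = measure lborel (A \<inter> I) / (d - c)" if "A \<in> sets borel" for A
    using assms by (simp add: measure_def[of M] emM[OF that])
  have char: "char M t = (sqrt (2 * pi) / (d - c)) * ft_set I t" for t
  proof -
    have "char M t = (\<integral>x. (indicator I x / (d - c)) *\<^sub>R iexp (t * x) \<partial>lborel)"
      unfolding char_def M_def using nonneg by (intro integral_density) auto
    also have "\<dots> = (\<integral>x. (1 / (d - c)) *\<^sub>R (indicator I x * iexp (x * t)) \<partial>lborel)"
      by (rule Bochner_Integration.integral_cong) (auto simp: indicator_def mult.commute)
    also have "\<dots> = (1 / (d - c)) *\<^sub>R (\<integral>x. indicator I x * iexp (x * t) \<partial>lborel)"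
      by (rule integral_scaleR_right)
    finally show ?thesis by (simp add: ft_set_def scaleR_conv_of_real)
  qed
  define g where "g t = ft_set I t * cnj (ft_set {a<..b} t)" for t
  have g_int: "integrable lborel g"
    using integrable_cinner[OF square_integrable_ft_set square_integrable_ft_set, of c d a b]
    by (simp add: g_def[abs_def] cinner_complex_def I_def)
  define F where "F t = (iexp (-(t * a)) - iexp (-(t * b))) / (\<i> * t) * char M t" for t :: real
  have F: "F t = of_real (2 * pi / (d - c)) * g t" if "t \<noteq> 0" for t
  proof -
    have "cnj (ft_set {a<..b} t) * sqrt (2 * pi) = (iexp (-(t * a)) - iexp (-(t * b))) / (\<i> * t)"
    proof -
      have "cnj (ft_set {a<..b} t) * sqrt (2 * pi) = cnj ((iexp (b * t) - iexp (a * t)) / (\<i> * t))"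
        unfolding ft_set_def integral_Ioc_iexp[OF assms(1) that] by simp
      also have "\<dots> = (iexp (-(t * a)) - iexp (-(t * b))) / (\<i> * t)"
        using that by (simp add: exp_cnj field_simps)
      finally show ?thesis .
    qed
    then have "F t = cnj (ft_set {a<..b} t) * sqrt (2 * pi) * ((sqrt (2 * pi) / (d - c)) * ft_set I t)"
      by (simp add: F_def char)
    also have "\<dots> = of_real (sqrt (2 * pi)) * of_real (sqrt (2 * pi)) / of_real (d - c) * g t"
      by (simp add: g_def)
    also have "of_real (sqrt (2 * pi)) * of_real (sqrt (2 * pi)) = complex_of_real (2 * pi)"
      unfolding of_real_mult[symmetric] by simp
    finally show ?thesis by simp
  qed
  have lim1: "(\<lambda>n. 1 / (2 * pi) * (CLBINT t=-real n..real n. F t)) \<longlonglongrightarrow> of_real (measure M {a<..b})"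
  proof -
    have "measure lborel ({x} \<inter> I) = 0" for x
      by (cases "x \<in> I") auto
    then have "measure M {a} = 0" "measure M {b} = 0" by (simp_all add: meM)
    from M.Levy_Inversion[OF assms(1) this] show ?thesis by (simp add: F_def)
  qed
  have "(\<lambda>n. \<integral>t. indicator {-real n<..<real n} t *\<^sub>R g t \<partial>lborel) \<longlonglongrightarrow> (\<integral>t. g t \<partial>lborel)"
    by (rule tendsto_integral_windows[OF g_int]) auto
  moreover have "(CLBINT t=-real n..real n. F t)
      = of_real (2 * pi / (d - c)) * (\<integral>t. indicator {-real n<..<real n} t *\<^sub>R g t \<partial>lborel)" for n
  proof -
    have "(CLBINT t=-real n..real n. F t) = (\<integral>t. indicator {-real n<..<real n} t *\<^sub>R F t \<partial>lborel)"
    proof -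
      have "einterval (- ereal (real n)) (ereal (real n)) = {-real n<..<real n}"
        "- ereal (real n) \<le> ereal (real n)"
        by (auto simp: einterval_def)
      then show ?thesis
        by (simp add: interval_lebesgue_integral_def set_lebesgue_integral_def)
    qed
    also have "\<dots> = (\<integral>t. of_real (2 * pi / (d - c)) * (indicator {-real n<..<real n} t *\<^sub>R g t) \<partial>lborel)"
    proof (rule integral_cong_AE)
      show "AE t in lborel. indicator {-real n<..<real n} t *\<^sub>R F t
          = of_real (2 * pi / (d - c)) * (indicator {-real n<..<real n} t *\<^sub>R g t)"
        using AE_lborel_singleton[of 0] by eventually_elim (simp add: F)
      show "(\<lambda>t. indicator {-real n<..<real n} t *\<^sub>R F t) \<in> borel_measurable lborel"
        unfolding F_def char by measurable
    qed (use g_int in auto)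
    also have "\<dots> = of_real (2 * pi / (d - c)) * (\<integral>t. indicator {-real n<..<real n} t *\<^sub>R g t \<partial>lborel)"
      by (rule integral_mult_right_zero)
    finally show ?thesis .
  qed
  ultimately have "(\<lambda>n. 1 / (2 * pi) * (CLBINT t=-real n..real n. F t)) \<longlonglongrightarrow>
      1 / (2 * pi) * (of_real (2 * pi / (d - c)) * (\<integral>t. g t \<partial>lborel))"
    by (simp only:) (intro tendsto_intros)
  then have "1 / (2 * pi) * (of_real (2 * pi / (d - c)) * (\<integral>t. g t \<partial>lborel)) = of_real (measure M {a<..b})"
    using lim1 by (rule LIMSEQ_unique)
  then have "(\<integral>t. g t \<partial>lborel) = of_real (measure M {a<..b} * (d - c))"
    using assms by (simp add: field_simps)
  then show ?thesis using assms by (simp add: g_def I_def meM)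
qed

lemma ft_set_Ioc_inner:
  "(\<integral>t. ft_set {a<..b} t * cnj (ft_set {c<..d} t) \<partial>lborel)
    = (\<integral>x. indicator {a<..b} x * cnj (indicator {c<..d} x) \<partial>lborel)"
proof -
  have eq: "(\<integral>x. indicator {a<..b} x * cnj (indicator {c<..d} x) \<partial>lborel)
      = of_real (measure lborel ({c<..d} \<inter> {a<..b}))"
  proof -
    have "(\<lambda>x. indicator {a<..b} x * cnj (indicator {c<..d} x)) =
        (\<lambda>x. complex_of_real (indicator ({c<..d} \<inter> {a<..b}) x))"
      by (auto simp: indicator_def)
    then show ?thesis by (simp only: integral_complex_of_real) simp
  qed
  show ?thesis
  proof (cases "a < b \<and> c \<le> d")
    case True
    then show ?thesis using ft_set_Ioc_inner_aux[of c d a b] eq by simp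
  next
    case False
    then show ?thesis by (auto simp: ft_set_def)
  qed
qed

text \<open>
  Since the Fourier kernel is symmetric in its two variables, the transform is its own transpose
  for the bilinear pairing.
\<close>

lemma integral_ft_set_swap:
  "(\<integral>t. ft_set {a<..b} t * indicator {c<..d} t \<partial>lborel)
    = (\<integral>x. indicator {a<..b} x * ft_set {c<..d} x \<partial>lborel)"
proof -
  have int: "integrable (lborel \<Otimes>\<^sub>M lborel)
      (\<lambda>(x, t). indicator {a<..b} x * indicator {c<..d} t * iexp (x * t))"
  proof (rule Bochner_Integration.integrable_bound)
    show "integrable (lborel \<Otimes>\<^sub>M lborel) (indicator ({a<..b} \<times> {c<..d}) :: real \<times> real \<Rightarrow> real)"
      by (intro integrable_real_indicator; cases "a \<le> b"; cases "c \<le> d")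
        (auto simp: lborel.emeasure_pair_measure_Times ennreal_mult_less_top)
    show "AE x in lborel \<Otimes>\<^sub>M lborel. norm (case x of (x, t) \<Rightarrow> indicator {a<..b} x * indicator {c<..d} t * iexp (x * t))
        \<le> norm (indicat_real ({a<..b} \<times> {c<..d}) x)"
      by (rule AE_I2) (auto simp: norm_mult indicator_def simp del: of_real_mult)
  qed measurable
  have "(\<integral>t. (\<integral>x. indicator {a<..b} x * indicator {c<..d} t * iexp (x * t) \<partial>lborel) \<partial>lborel)
      = (\<integral>x. (\<integral>t. indicator {a<..b} x * indicator {c<..d} t * iexp (x * t) \<partial>lborel) \<partial>lborel)"
    by (rule lborel_pair.Fubini_integral[OF int])
  moreover have "(\<integral>x. indicator {a<..b} x * indicator {c<..d} t * iexp (x * t) \<partial>lborel)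
      = sqrt (2 * pi) * (ft_set {a<..b} t * indicator {c<..d} t)" for t
  proof -
    have "(\<integral>x. indicator {a<..b} x * indicator {c<..d} t * iexp (x * t) \<partial>lborel)
       = (\<integral>x. indicator {c<..d} t * (indicator {a<..b} x * iexp (x * t)) \<partial>lborel)"
      by (simp only: ac_simps)
    then show ?thesis by (simp add: ft_set_def)
  qed
  moreover have "(\<integral>t. indicator {a<..b} x * indicator {c<..d} t * iexp (x * t) \<partial>lborel)
      = sqrt (2 * pi) * (indicator {a<..b} x * ft_set {c<..d} x)" for x
  proof -
    have "(\<integral>t. indicator {a<..b} x * indicator {c<..d} t * iexp (x * t) \<partial>lborel)
       = (\<integral>t. indicator {a<..b} x * (indicator {c<..d} t * iexp (t * x)) \<partial>lborel)"
      by (simp only: ac_simps)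
    then show ?thesis by (simp add: ft_set_def)
  qed
  ultimately show ?thesis by simp
qed

section \<open>Gauge integrals of strongly measurable functions\<close>

lemma norm_diff_triangle3:
  fixes a b c d :: "'a::real_normed_vector"
  shows "norm (a - b) \<le> norm (a - c) + norm (c - d) + norm (b - d)"
proof -
  have "a - b = (a - c) + (c - d) - (b - d)" by simp
  also have "norm \<dots> \<le> norm ((a - c) + (c - d)) + norm (b - d)" by (rule norm_triangle_ineq4)
  also have "norm ((a - c) + (c - d)) \<le> norm (a - c) + norm (c - d)" by (rule norm_triangle_ineq)
  finally show ?thesis by simp
qed

text \<open>
  If \<open>g\<close> is approximated in the mean by integrable functions \<open>s\<close>, then any two fine Riemann sums
  of \<open>g\<close> are close: each differs from the corresponding sum of \<open>s\<close> by at most a Riemann sum of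
  the majorant \<open>h\<close> of \<open>g - s\<close>, and that is close to the small integral of \<open>h\<close>.
\<close>

lemma integrable_on_cbox_of_approx:
  fixes g :: "'n::euclidean_space \<Rightarrow> 'a::banach"
  assumes approx: "\<And>e. e > 0 \<Longrightarrow> \<exists>s h. s integrable_on cbox a b \<and> h integrable_on cbox a b \<and>
    (\<forall>x. norm (g x - s x) \<le> h x) \<and> integral (cbox a b) h < e"
  shows "g integrable_on cbox a b"
  unfolding integrable_Cauchy
proof (intro allI impI)
  fix e :: real assume "e > 0"
  then have e: "e / 8 > 0" by simp
  then obtain s h where s: "s integrable_on cbox a b" and h: "h integrable_on cbox a b"
    and sh: "\<And>x. norm (g x - s x) \<le> h x" and small: "integral (cbox a b) h < e / 8"
    using approx by blast
  from integrable_integral[OF h, unfolded has_integral, rule_format, OF e]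
  obtain \<gamma>1 where g1: "gauge \<gamma>1" and fine1: "\<And>D. D tagged_division_of (cbox a b) \<and> \<gamma>1 fine D \<Longrightarrow>
      norm ((\<Sum>(x,K)\<in>D. measure lborel K *\<^sub>R h x) - integral (cbox a b) h) < e / 8"
    by (elim exE conjE) (rule that, auto)
  have "e / 4 > 0" using e by simp
  from s[unfolded integrable_Cauchy, rule_format, OF this]
  obtain \<gamma>2 where g2: "gauge \<gamma>2" and fine2: "\<And>D E. D tagged_division_of (cbox a b) \<and> \<gamma>2 fine D \<and>
      E tagged_division_of (cbox a b) \<and> \<gamma>2 fine E \<Longrightarrow>
      norm ((\<Sum>(x,K)\<in>D. measure lborel K *\<^sub>R s x) - (\<Sum>(x,K)\<in>E. measure lborel K *\<^sub>R s x)) < e / 4"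
    by (elim exE conjE) (rule that, auto)
  have close: "norm ((\<Sum>(x,K)\<in>D. measure lborel K *\<^sub>R g x) - (\<Sum>(x,K)\<in>D. measure lborel K *\<^sub>R s x)) < e / 4"
    if D: "D tagged_division_of (cbox a b)" "\<gamma>1 fine D" for D
  proof -
    have "norm ((\<Sum>(x,K)\<in>D. measure lborel K *\<^sub>R g x) - (\<Sum>(x,K)\<in>D. measure lborel K *\<^sub>R s x))
        = norm (\<Sum>(x,K)\<in>D. measure lborel K *\<^sub>R (g x - s x))"
      by (simp add: sum_subtractf[symmetric] split_def scaleR_diff_right)
    also have "\<dots> \<le> (\<Sum>(x,K)\<in>D. measure lborel K *\<^sub>R h x)"
      by (rule order_trans[OF norm_sum sum_mono]) (auto simp: sh intro!: mult_left_mono)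
    also have "\<dots> < e / 8 + integral (cbox a b) h"
      using fine1[OF conjI[OF D]] unfolding real_norm_def by linarith
    also have "\<dots> < e / 4" using small by simp
    finally show ?thesis .
  qed
  show "\<exists>\<gamma>. gauge \<gamma> \<and> (\<forall>D E. D tagged_division_of (cbox a b) \<and> \<gamma> fine D \<and>
      E tagged_division_of (cbox a b) \<and> \<gamma> fine E \<longrightarrow>
      norm ((\<Sum>(x,K)\<in>D. measure lborel K *\<^sub>R g x) - (\<Sum>(x,K)\<in>E. measure lborel K *\<^sub>R g x)) < e)"
  proof (intro exI[of _ "\<lambda>x. \<gamma>1 x \<inter> \<gamma>2 x"] conjI allI impI)
    show "gauge (\<lambda>x. \<gamma>1 x \<inter> \<gamma>2 x)" by (rule gauge_Int[OF g1 g2])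
    fix D E
    assume "D tagged_division_of (cbox a b) \<and> (\<lambda>x. \<gamma>1 x \<inter> \<gamma>2 x) fine D \<and>
      E tagged_division_of (cbox a b) \<and> (\<lambda>x. \<gamma>1 x \<inter> \<gamma>2 x) fine E"
    then have DE: "D tagged_division_of (cbox a b)" "\<gamma>1 fine D" "\<gamma>2 fine D"
      "E tagged_division_of (cbox a b)" "\<gamma>1 fine E" "\<gamma>2 fine E"
      by (auto simp: fine_Int)
    define G S where "G D = (\<Sum>(x,K)\<in>D. measure lborel K *\<^sub>R g x)"
      and "S D = (\<Sum>(x,K)\<in>D. measure lborel K *\<^sub>R s x)" for D :: "('n \<times> 'n set) set"
    have "norm (G D - S D) < e / 4" "norm (G E - S E) < e / 4" "norm (S D - S E) < e / 4"
      using close fine2 DE by (auto simp: G_def S_def)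
    moreover have "norm (G D - G E) \<le> norm (G D - S D) + norm (S D - S E) + norm (G E - S E)"
      by (rule norm_diff_triangle3)
    ultimately have "norm (G D - G E) < e" using \<open>e > 0\<close> by linarith
    then show "norm ((\<Sum>(x,K)\<in>D. measure lborel K *\<^sub>R g x) - (\<Sum>(x,K)\<in>E. measure lborel K *\<^sub>R g x)) < e"
      by (simp add: G_def S_def)
  qed
qed

lemma integrable_on_UNIV_of_approx:
  fixes g :: "'n::euclidean_space \<Rightarrow> 'a::banach"
  assumes approx: "\<And>e. e > 0 \<Longrightarrow> \<exists>s h. s integrable_on UNIV \<and> h integrable_on UNIV \<and>
    (\<forall>x. norm (g x - s x) \<le> h x) \<and> integral UNIV h < e"
  shows "g integrable_on UNIV"
proof -
  have box: "g integrable_on cbox a b" for a b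
  proof (rule integrable_on_cbox_of_approx)
    fix e :: real assume "e > 0"
    then obtain s h where s: "s integrable_on UNIV" "h integrable_on UNIV"
      and sh: "\<And>x. norm (g x - s x) \<le> h x" and small: "integral UNIV h < e"
      using approx by blast
    have "s integrable_on cbox a b" "h integrable_on cbox a b"
      using s by (auto intro: integrable_on_subcbox)
    moreover have "integral (cbox a b) h \<le> integral UNIV h"
      using sh s \<open>h integrable_on cbox a b\<close>
      by (intro integral_subset_le) (auto intro: order_trans[OF norm_ge_zero])
    ultimately show "\<exists>s h. s integrable_on cbox a b \<and> h integrable_on cbox a b \<and>
        (\<forall>x. norm (g x - s x) \<le> h x) \<and> integral (cbox a b) h < e"
      using sh small by (intro exI[of _ s] exI[of _ h]) auto
  qed
  have "\<exists>B>0. \<forall>a b c d. ball 0 B \<subseteq> cbox a b \<and> ball 0 B \<subseteq> cbox c d \<longrightarrow>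
      norm (integral (cbox a b) g - integral (cbox c d) g) < e" if "e > 0" for e
  proof -
    have e: "e / 3 > 0" using that by simp
    then obtain s h where s: "s integrable_on UNIV" "h integrable_on UNIV"
      and sh: "\<And>x. norm (g x - s x) \<le> h x" and small: "integral UNIV h < e / 3"
      using approx by blast
    obtain B where B: "B > 0" "\<And>a b c d. ball 0 B \<subseteq> cbox a b \<and> ball 0 B \<subseteq> cbox c d \<Longrightarrow>
        norm (integral (cbox a b) s - integral (cbox c d) s) < e / 3"
      using integrable_altD(2)[OF s(1) e] by auto
    have close: "norm (integral (cbox a b) g - integral (cbox a b) s) < e / 3" for a b
    proof -
      have sb: "s integrable_on cbox a b" "h integrable_on cbox a b"
        using s by (auto intro: integrable_on_subcbox)
      have "norm (integral (cbox a b) g - integral (cbox a b) s) = norm (integral (cbox a b) (\<lambda>x. g x - s x))"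
        by (simp add: integral_diff box sb)
      also have "\<dots> \<le> integral (cbox a b) h"
        by (rule Henstock_Kurzweil_Integration.integral_norm_bound_integral)
          (use box sb sh in \<open>auto intro: integrable_diff\<close>)
      also have "\<dots> \<le> integral UNIV h"
        using sh s sb by (intro integral_subset_le) (auto intro: order_trans[OF norm_ge_zero])
      finally show ?thesis using small by simp
    qed
    show ?thesis
    proof (intro exI[of _ B] conjI allI impI B(1))
      fix a b c d :: 'n
      assume "ball 0 B \<subseteq> cbox a b \<and> ball 0 B \<subseteq> cbox c d"
      then have "norm (integral (cbox a b) s - integral (cbox c d) s) < e / 3" by (rule B(2))
      moreover define G1 G2 S1 S2 where "G1 = integral (cbox a b) g" and "G2 = integral (cbox c d) g"
        and "S1 = integral (cbox a b) s" and "S2 = integral (cbox c d) s"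
      ultimately have "norm (S1 - S2) < e / 3" "norm (G1 - S1) < e / 3" "norm (G2 - S2) < e / 3"
        using close by auto
      moreover have "norm (G1 - G2) \<le> norm (G1 - S1) + norm (S1 - S2) + norm (G2 - S2)"
        by (rule norm_diff_triangle3)
      ultimately have "norm (G1 - G2) < e" by linarith
      then show "norm (integral (cbox a b) g - integral (cbox c d) g) < e"
        by (simp add: G1_def G2_def)
    qed
  qed
  then show ?thesis unfolding integrable_alt[of g UNIV] using box by simp
qed

lemma simple_integrable_on:
  fixes s :: "real \<Rightarrow> 'a::complex_hilbert"
  assumes s: "simple_function lborel s" and int: "integrable lborel (\<lambda>x. norm (s x))"
  shows "s integrable_on UNIV"
proof -
  have fin: "finite (range s)" using simple_functionD(1)[OF s] by simp
  have meas: "s -` {y} \<in> sets borel" for y using simple_functionD(2)[OF s, of "{y}"] by simp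
  have part: "(\<lambda>x. indicat_real (s -` {y}) x *\<^sub>R y) integrable_on UNIV" for y
  proof (cases "y = 0")
    case False
    have "integrable lborel (\<lambda>x. norm (s x) / norm y)" using int by simp
    then have "integrable lborel (indicat_real (s -` {y}))"
    proof (rule Bochner_Integration.integrable_bound)
      show "AE x in lborel. norm (indicat_real (s -` {y}) x) \<le> norm (norm (s x) / norm y)"
        using False by (intro AE_I2) (auto simp: indicator_def)
    qed (use meas in simp)
    then show ?thesis by (intro integrable_on_scaleR_left integrable_on_lborel)
  qed (simp add: integrable_0)
  have "s = (\<lambda>x. \<Sum>y\<in>range s. indicat_real (s -` {y}) x *\<^sub>R y)"
  proof
    fix x
    have "(\<Sum>y\<in>range s. indicat_real (s -` {y}) x *\<^sub>R y) = (\<Sum>y\<in>range s. if y = s x then y else 0)"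
      by (rule sum.cong) (auto simp: indicator_def)
    also have "\<dots> = s x" using fin by simp
    finally show "s x = (\<Sum>y\<in>range s. indicat_real (s -` {y}) x *\<^sub>R y)" ..
  qed
  moreover have "(\<lambda>x. \<Sum>y\<in>range s. indicat_real (s -` {y}) x *\<^sub>R y) integrable_on UNIV"
    by (rule integrable_sum[OF fin part])
  ultimately show ?thesis by simp
qed

text \<open>
  Bochner integrability implies gauge integrability, because the dominated simple functions
  converge in the mean.
\<close>

lemma strongly_measurable_integrable_on:
  fixes g :: "real \<Rightarrow> 'a::complex_hilbert"
  assumes g: "strongly_measurable g" and int: "integrable lborel (\<lambda>x. norm (g x))"
  shows "g integrable_on UNIV"
proof (rule integrable_on_UNIV_of_approx)
  fix e :: real assume e: "e > 0"
  obtain s where s: "\<And>n. simple_function lborel (s n)" "\<And>x. (\<lambda>n. s n x) \<longlonglongrightarrow> g x"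
    "\<And>n x. norm (s n x) \<le> 2 * norm (g x)"
    using strongly_measurable_dominated_simple[OF g] by blast
  have sm: "strongly_measurable (s n)" for n by (rule strongly_measurable_simple[OF s(1)])
  have dm: "strongly_measurable (\<lambda>x. g x - s n x)" for n
    by (rule strongly_measurable_compose2[OF g sm tendsto_diff])
  note [measurable] = measurable_norm_strongly_measurable[OF dm] measurable_norm_strongly_measurable[OF sm]
  have bound: "norm (g x - s n x) \<le> 3 * norm (g x)" for n x
    using norm_triangle_ineq4[of "g x" "s n x"] s(3)[of n x] by simp
  have w: "integrable lborel (\<lambda>x. 3 * norm (g x))" "integrable lborel (\<lambda>x. 2 * norm (g x))"
    using int by auto
  have hi: "integrable lborel (\<lambda>x. norm (g x - s n x))" for n
    by (rule Bochner_Integration.integrable_bound[OF w(1)]) (use bound in auto)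
  have si: "integrable lborel (\<lambda>x. norm (s n x))" for n
    by (rule Bochner_Integration.integrable_bound[OF w(2)]) (use s(3) in auto)
  have "(\<lambda>n. \<integral>x. norm (g x - s n x) \<partial>lborel) \<longlonglongrightarrow> integral\<^sup>L lborel (\<lambda>x::real. 0)"
  proof (rule integral_dominated_convergence[OF _ _ w(1)])
    show "AE x in lborel. (\<lambda>n. norm (g x - s n x)) \<longlonglongrightarrow> 0"
    proof (rule AE_I2)
      fix x
      have "(\<lambda>n. norm (g x - s n x)) \<longlonglongrightarrow> norm (g x - g x)" by (intro tendsto_intros s(2))
      then show "(\<lambda>n. norm (g x - s n x)) \<longlonglongrightarrow> 0" by simp
    qed
  qed (use bound in auto)
  then have "\<forall>\<^sub>F n in sequentially. (\<integral>x. norm (g x - s n x) \<partial>lborel) < e"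
    using e by (intro order_tendstoD(2)) auto
  then obtain n where n: "(\<integral>x. norm (g x - s n x) \<partial>lborel) < e"
    using eventually_happens'[OF sequentially_bot] by blast
  then have "integral UNIV (\<lambda>x. norm (g x - s n x)) < e"
    by (simp add: integral_lborel[OF hi])
  then show "\<exists>s h. s integrable_on UNIV \<and> h integrable_on UNIV \<and>
      (\<forall>x. norm (g x - s x) \<le> h x) \<and> integral UNIV h < e"
    using simple_integrable_on[OF s(1) si] integrable_on_lborel[OF hi]
    by (intro exI[of _ "s n"] exI[of _ "\<lambda>x. norm (g x - s n x)"]) simp
qed

text \<open>
  A continuous function is the pointwise limit of its samples on the grid of mesh \<open>1 / n\<close>,
  restricted to \<open>{-n..n}\<close> so that each of them takes finitely many values.
\<close>

lemma continuous_imp_strongly_measurable: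
  fixes f :: "real \<Rightarrow> 'a::real_normed_vector"
  assumes "continuous_on UNIV f"
  shows "strongly_measurable f"
proof -
  define s where "s n x = (if \<bar>x\<bar> \<le> real n then f (real_of_int \<lfloor>real n * x\<rfloor> / real n) else 0)" for n x
  have "simple_function lborel (s n)" for n
  proof -
    \<comment> \<open>The number of the grid cell; the value \<open>- n\<^sup>2 - 1\<close>, below all of them, marks the points outside.\<close>
    define h where "h x = (if \<bar>x\<bar> \<le> real n then \<lfloor>real n * x\<rfloor> else - int (n * n) - 1)" for x
    have "range h \<subseteq> {- int (n * n) - 1 .. int (n * n)}"
    proof (rule image_subsetI)
      fix x
      have "- int (n * n) \<le> \<lfloor>real n * x\<rfloor> \<and> \<lfloor>real n * x\<rfloor> \<le> int (n * n)" if "\<bar>x\<bar> \<le> real n"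
      proof -
        have "\<bar>real n * x\<bar> \<le> real n * real n"
          using that by (simp add: abs_mult mult_left_mono)
        then have "- real (n * n) \<le> real n * x" "real n * x \<le> real (n * n)" by (auto simp: abs_le_iff)
        then show ?thesis by (auto simp: le_floor_iff intro: floor_le_iff[THEN iffD2])
      qed
      then show "h x \<in> {- int (n * n) - 1 .. int (n * n)}" by (auto simp: h_def intro: order_trans[of _ 0])
    qed
    then have "finite (range h)" by (rule finite_subset) simp
    moreover have h: "h \<in> borel \<rightarrow>\<^sub>M count_space UNIV"
      unfolding h_def[abs_def] by measurable
    moreover have "h -` {y} \<in> sets borel" for y
      using measurable_sets[OF h, of "{y}"] by simp
    ultimately have "simple_function lborel h"
      by (simp add: simple_function_def)
    then have "simple_function lborel (\<lambda>x. (\<lambda>k. if k < - int (n * n) then 0 else f (real_of_int k / real n)) (h x))"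
      by (rule simple_function_compose1)
    moreover have "(\<lambda>k. if k < - int (n * n) then 0 else f (real_of_int k / real n)) (h x) = s n x" for x
    proof (cases "\<bar>x\<bar> \<le> real n")
      case True
      have "\<bar>real n * x\<bar> \<le> real n * real n"
        using True by (simp add: abs_mult mult_left_mono)
      then have "- real (n * n) \<le> real n * x" by (auto simp: abs_le_iff)
      then have "- int (n * n) \<le> \<lfloor>real n * x\<rfloor>" by (simp add: le_floor_iff)
      then show ?thesis using True by (simp add: h_def s_def)
    qed (simp add: h_def s_def)
    ultimately show ?thesis by (simp cong: simple_function_cong)
  qed
  moreover have "(\<lambda>n. s n x) \<longlonglongrightarrow> f x" for x
  proof -
    have "(\<lambda>n. real_of_int \<lfloor>real n * x\<rfloor> / real n) \<longlonglongrightarrow> x"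
    proof (rule tendsto_sandwich)
      show "(\<lambda>n. x - 1 / real n) \<longlonglongrightarrow> x"
        using tendsto_diff[OF tendsto_const lim_1_over_n, of x] by simp
      show "\<forall>\<^sub>F n in sequentially. x - 1 / real n \<le> real_of_int \<lfloor>real n * x\<rfloor> / real n"
        using eventually_gt_at_top[of 0]
      proof eventually_elim
        case (elim n)
        have "(real n * x - 1) / real n \<le> real_of_int \<lfloor>real n * x\<rfloor> / real n"
          by (intro divide_right_mono) linarith+
        moreover have "(real n * x - 1) / real n = x - 1 / real n"
          using elim by (simp add: field_simps)
        ultimately show ?case by simp
      qed
      show "\<forall>\<^sub>F n in sequentially. real_of_int \<lfloor>real n * x\<rfloor> / real n \<le> x"
        using eventually_gt_at_top[of 0]
      proof eventually_elim
        case (elim n)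
        have "real_of_int \<lfloor>real n * x\<rfloor> \<le> real n * x" by linarith
        then show ?case using elim by (simp add: field_simps)
      qed
    qed simp
    then have "(\<lambda>n. f (real_of_int \<lfloor>real n * x\<rfloor> / real n)) \<longlonglongrightarrow> f x"
      using assms by (intro continuous_on_tendsto_compose[OF assms]) auto
    moreover have "\<forall>\<^sub>F n in sequentially. f (real_of_int \<lfloor>real n * x\<rfloor> / real n) = s n x"
    proof -
      obtain m :: nat where m: "\<bar>x\<bar> < real m" using reals_Archimedean2 by blast
      show ?thesis
        using eventually_ge_at_top[of m] by eventually_elim (use m in \<open>simp add: s_def\<close>)
    qed
    ultimately show ?thesis by (rule Lim_transform_eventually)
  qed
  ultimately show ?thesis unfolding strongly_measurable_def by blast
qed

section \<open>The Fourier transform as a unitary operator\<close>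

lemma bounded_clinear_cinner_left: "bounded_clinear (\<lambda>x. cinner x (w::'a::complex_hilbert))"
  unfolding bounded_clinear_def
  by (simp add: bounded_linear_cinner_left cinner_scaleC_left scaleC_complex_def)

lemma adjoint_by_total:
  fixes A B :: "'a::complex_hilbert \<Rightarrow> 'a"
  assumes e: "total_family e" and A: "bounded_clinear A" and B: "bounded_clinear B"
    and eq: "\<And>i j. cinner (A (e i)) (e j) = cinner (e i) (B (e j))"
  shows "cinner (A x) y = cinner x (B y)"
proof -
  have 1: "(\<lambda>x. cinner (A x) (e j)) = (\<lambda>x. cinner x (B (e j)))" for j
    by (rule bounded_clinear_eq_total[OF e bounded_clinear_compose[OF bounded_clinear_cinner_left A]
          bounded_clinear_cinner_left]) (rule eq)
  have "(\<lambda>y. cinner y (A x)) = (\<lambda>y. cinner (B y) x)"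
  proof (rule bounded_clinear_eq_total[OF e bounded_clinear_cinner_left
          bounded_clinear_compose[OF bounded_clinear_cinner_left B]])
    fix j
    have "cinner (e j) (A x) = cnj (cinner (A x) (e j))" by (rule cinner_commute)
    also have "\<dots> = cnj (cinner x (B (e j)))" using fun_cong[OF 1[of j], of x] by simp
    also have "\<dots> = cinner (B (e j)) x" by (rule cinner_commute[symmetric])
    finally show "cinner (e j) (A x) = cinner (B (e j)) x" .
  qed
  then have "cinner y (A x) = cinner (B y) x" by (rule fun_cong)
  then have "cnj (cinner y (A x)) = cnj (cinner (B y) x)" by simp
  then show ?thesis by (simp flip: cinner_commute)
qed

text \<open>
  For an isometry \<open>A\<close> the operator \<open>A A\<^sup>*\<close> is the projection onto the range. If the adjoint is an
  isometry as well, this projection preserves norms, so it is the identity.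
\<close>

lemma isometric_adjoint_inverse:
  fixes A B :: "'a::complex_hilbert \<Rightarrow> 'a"
  assumes A: "\<And>x y. cinner (A x) (A y) = cinner x y" and B: "\<And>x y. cinner (B x) (B y) = cinner x y"
    and adj: "\<And>x y. cinner (A x) y = cinner x (B y)"
  shows "A (B x) = x"
proof -
  have "(norm (A (B x) - x))\<^sup>2 = Re (cinner (A (B x)) (A (B x))) - 2 * Re (cinner (A (B x)) x) + Re (cinner x x)"
    by (simp only: norm_diff_square norm_eq_cinner[symmetric])
  also have "cinner (A (B x)) (A (B x)) = cinner x x" by (simp only: A B)
  also have "cinner (A (B x)) x = cinner x x" unfolding adj by (rule B)
  finally have "(norm (A (B x) - x))\<^sup>2 = 0" by simp
  then show ?thesis by simp
qed

definition ft_tensor :: "real \<times> real \<times> 'a::complex_normed_vector \<Rightarrow> 'a L2R"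
  where "ft_tensor = (\<lambda>(a, b, v). tensor (ft_set {a<..b}) v)"

definition cnj_ft_tensor :: "real \<times> real \<times> 'a::complex_normed_vector \<Rightarrow> 'a L2R"
  where "cnj_ft_tensor = (\<lambda>(a, b, v). tensor (\<lambda>t. cnj (ft_set {a<..b} t)) v)"

lemma square_integrable_cnj:
  fixes \<phi> :: "real \<Rightarrow> complex"
  assumes "square_integrable \<phi>"
  shows "square_integrable (\<lambda>t. cnj (\<phi> t))"
proof -
  have "(\<lambda>t. cnj (\<phi> t)) \<in> borel_measurable borel"
    using assms by (intro borel_measurable_continuous_on[where f=cnj])
      (auto simp: square_integrable_def strongly_measurable_iff_borel intro!: continuous_intros)
  then show ?thesis using assms by (simp add: square_integrable_def strongly_measurable_iff_borel)
qed

lemma square_integrable_Ioc: "square_integrable (indicator {a<..b::real} :: real \<Rightarrow> complex)"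
  by (rule square_integrable_indicator_bounded[of _ a b]) auto

lemma cinner_ft_tensor:
  "cinner (ft_tensor i) (ft_tensor j) = cinner (interval_tensor i) (interval_tensor (j :: _ \<times> _ \<times> 'a::complex_hilbert))"
proof -
  obtain a b v c d w where ij: "i = (a, b, v)" "j = (c, d, w)" by (cases i, cases j) auto
  show ?thesis
    by (simp add: ij ft_tensor_def interval_tensor_def cinner_tensor square_integrable_ft_set
        square_integrable_Ioc ft_set_Ioc_inner)
qed

lemma cinner_cnj_ft_tensor:
  "cinner (cnj_ft_tensor i) (cnj_ft_tensor j) = cinner (interval_tensor i) (interval_tensor (j :: _ \<times> _ \<times> 'a::complex_hilbert))"
proof -
  obtain a b v c d w where ij: "i = (a, b, v)" "j = (c, d, w)" by (cases i, cases j) auto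
  have "(\<integral>t. cnj (ft_set {a<..b} t) * cnj (cnj (ft_set {c<..d} t)) \<partial>lborel)
      = (\<integral>t. ft_set {c<..d} t * cnj (ft_set {a<..b} t) \<partial>lborel)"
    by (simp add: mult.commute)
  also have "\<dots> = (\<integral>x. indicator {c<..d} x * cnj (indicator {a<..b} x) \<partial>lborel)"
    by (rule ft_set_Ioc_inner)
  also have "\<dots> = (\<integral>x. indicator {a<..b} x * cnj (indicator {c<..d} x) \<partial>lborel)"
    by (rule Bochner_Integration.integral_cong) (auto simp: indicator_def)
  finally show ?thesis
    by (simp add: ij cnj_ft_tensor_def interval_tensor_def cinner_tensor square_integrable_ft_set
        square_integrable_Ioc square_integrable_cnj)
qed

lemma cinner_ft_tensor_interval:
  "cinner (ft_tensor i) (interval_tensor j) = cinner (interval_tensor i) (cnj_ft_tensor (j :: _ \<times> _ \<times> 'a::complex_hilbert))"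
proof -
  obtain a b v c d w where ij: "i = (a, b, v)" "j = (c, d, w)" by (cases i, cases j) auto
  have "(\<integral>t. ft_set {a<..b} t * cnj (indicator {c<..d} t) \<partial>lborel)
      = (\<integral>t. ft_set {a<..b} t * indicator {c<..d} t \<partial>lborel)"
    by (rule Bochner_Integration.integral_cong) (auto simp: indicator_def)
  then show ?thesis
    by (simp add: ij ft_tensor_def cnj_ft_tensor_def interval_tensor_def cinner_tensor square_integrable_ft_set
        square_integrable_Ioc square_integrable_cnj integral_ft_set_swap)
qed

text \<open>
  Plancherel's theorem. The transform of intervals and its complex conjugate counterpart both
  preserve inner products, hence extend to isometries; these are adjoint to each other, hence
  mutually inverse.
\<close>

lemma fourier_pair_exists:
  "\<exists>(U :: 'h::complex_hilbert L2R \<Rightarrow> 'h L2R) V. bounded_clinear U \<and> bounded_clinear V \<and>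
    (\<forall>i. U (interval_tensor i) = ft_tensor i) \<and> (\<forall>i. V (interval_tensor i) = cnj_ft_tensor i) \<and>
    (\<forall>x y. cinner (U x) y = cinner x (V y)) \<and> (\<forall>x. U (V x) = x) \<and> (\<forall>x. V (U x) = x)"
proof -
  obtain U :: "'h L2R \<Rightarrow> 'h L2R" where U: "bounded_clinear U" "\<And>i. U (interval_tensor i) = ft_tensor i"
    "\<And>x y. cinner (U x) (U y) = cinner x y"
    using isometric_extension[of interval_tensor ft_tensor, OF total_interval_tensor cinner_ft_tensor] by blast
  obtain V :: "'h L2R \<Rightarrow> 'h L2R" where V: "bounded_clinear V" "\<And>i. V (interval_tensor i) = cnj_ft_tensor i"
    "\<And>x y. cinner (V x) (V y) = cinner x y"
    using isometric_extension[of interval_tensor cnj_ft_tensor, OF total_interval_tensor cinner_cnj_ft_tensor] by blast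
  have adj: "cinner (U x) y = cinner x (V y)" for x y
    by (rule adjoint_by_total[OF total_interval_tensor U(1) V(1)])
      (simp add: U(2) V(2) cinner_ft_tensor_interval)
  have adj': "cinner (V x) y = cinner x (U y)" for x y
  proof -
    have "cinner (V x) y = cnj (cinner y (V x))" by (rule cinner_commute)
    also have "\<dots> = cnj (cinner (U y) x)" by (simp only: adj)
    also have "\<dots> = cinner x (U y)" by (rule cinner_commute[symmetric])
    finally show ?thesis .
  qed
  have "U (V x) = x" "V (U x) = x" for x
    using isometric_adjoint_inverse[OF U(3) V(3) adj] isometric_adjoint_inverse[OF V(3) U(3) adj'] by auto
  then show ?thesis using U V adj by blast
qed

definition fourier_integral :: "(real \<Rightarrow> 'h::complex_hilbert) \<Rightarrow> real \<Rightarrow> 'h"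
  where "fourier_integral f t = (1 / sqrt (2 * pi)) *\<^sub>R integral UNIV (\<lambda>x. exp (\<i> * x * t) *\<^sub>C f x)"

lemma integrable_on_fourier:
  fixes f :: "real \<Rightarrow> 'h::complex_hilbert" and t :: real
  assumes f: "strongly_measurable f" and int: "integrable lborel (\<lambda>x. norm (f x))"
  shows "(\<lambda>x. exp (\<i> * x * t) *\<^sub>C f x) integrable_on UNIV"
proof (rule strongly_measurable_integrable_on)
  show "strongly_measurable (\<lambda>x. exp (\<i> * complex_of_real x * complex_of_real t) *\<^sub>C f x)"
    by (rule strongly_measurable_scaleC_fun[OF _ f]) measurable
  have "cmod (exp (\<i> * complex_of_real x * complex_of_real t)) = 1" for x
    using norm_exp_i_times[of "x * t"] by (simp add: mult.assoc)
  then show "integrable lborel (\<lambda>x. norm (exp (\<i> * complex_of_real x * complex_of_real t) *\<^sub>C f x))"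
    using int by (simp add: norm_scaleC)
qed

lemma integrable_cinner_const:
  fixes f :: "real \<Rightarrow> 'h::complex_hilbert"
  assumes f: "strongly_measurable f" and int: "integrable lborel (\<lambda>x. norm (f x))"
  shows "integrable lborel (\<lambda>x. cinner (f x) w)"
proof (rule Bochner_Integration.integrable_bound)
  show "integrable lborel (\<lambda>x. norm (f x) * norm w)" using int by simp
  show "(\<lambda>x. cinner (f x) w) \<in> borel_measurable lborel"
    by (rule borel_measurable_cinner[OF f strongly_measurable_const])
qed (simp add: cinner_Cauchy_Schwarz)

text \<open>
  Pairing with a vector turns the gauge integral into a scalar Lebesgue integral, to which Fubini's
  theorem applies.
\<close>

lemma cinner_fourier_integral:
  fixes f :: "real \<Rightarrow> 'h::complex_hilbert"
  assumes f: "strongly_measurable f" and int: "integrable lborel (\<lambda>x. norm (f x))"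
  shows "cinner (fourier_integral f t) w
    = (\<integral>x. cinner (f x) w * iexp (x * t) \<partial>lborel) / sqrt (2 * pi)"
proof -
  define g where "g x = exp (\<i> * complex_of_real x * complex_of_real t) *\<^sub>C f x" for x
  have g: "g integrable_on UNIV"
    unfolding g_def by (rule integrable_on_fourier[OF f int])
  have eq: "cinner (g x) w = cinner (f x) w * iexp (x * t)" for x
    by (simp add: g_def cinner_scaleC_left mult_ac)
  have gi: "integrable lborel (\<lambda>x. cinner (f x) w * iexp (x * t))"
  proof (rule Bochner_Integration.integrable_bound[OF integrable_cinner_const[OF f int, of w]])
    have [measurable]: "(\<lambda>x. cinner (f x) w) \<in> borel_measurable borel"
      using borel_measurable_cinner[OF f strongly_measurable_const, of w] by simp
    show "(\<lambda>x. cinner (f x) w * iexp (x * t)) \<in> borel_measurable lborel" by measurable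
  qed (simp add: norm_mult del: of_real_mult)
  have "cinner (integral UNIV g) w = integral UNIV ((\<lambda>y. cinner y w) \<circ> g)"
    by (rule integral_linear[OF g bounded_linear_cinner_left, symmetric])
  also have "\<dots> = integral UNIV (\<lambda>x. cinner (f x) w * iexp (x * t))"
    by (simp only: comp_def eq)
  also have "\<dots> = (\<integral>x. cinner (f x) w * iexp (x * t) \<partial>lborel)"
    by (rule integral_lborel[OF gi])
  finally show ?thesis
    by (simp add: fourier_integral_def g_def[abs_def] cinner_scaleR_left)
qed

lemma fourier_integral_bound:
  fixes f :: "real \<Rightarrow> 'h::complex_hilbert"
  assumes f: "strongly_measurable f" and int: "integrable lborel (\<lambda>x. norm (f x))"
  shows "norm (fourier_integral f t) \<le> (\<integral>x. norm (f x) \<partial>lborel)"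
proof -
  have n: "cmod (exp (\<i> * complex_of_real x * complex_of_real t)) = 1" for x
    using norm_exp_i_times[of "x * t"] by (simp add: mult.assoc)
  have "norm (integral UNIV (\<lambda>x. exp (\<i> * x * t) *\<^sub>C f x)) \<le> integral UNIV (\<lambda>x. norm (f x))"
    by (rule Henstock_Kurzweil_Integration.integral_norm_bound_integral)
      (simp_all add: integrable_on_fourier[OF f int] integrable_on_lborel[OF int] norm_scaleC n)
  then have *: "norm (integral UNIV (\<lambda>x. exp (\<i> * x * t) *\<^sub>C f x)) \<le> (\<integral>x. norm (f x) \<partial>lborel)"
    by (simp add: integral_lborel[OF int])
  have "1 \<le> sqrt (2 * pi)" using pi_gt3 by simp
  then have "1 / sqrt (2 * pi) * norm (integral UNIV (\<lambda>x. exp (\<i> * x * t) *\<^sub>C f x))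
      \<le> 1 * norm (integral UNIV (\<lambda>x. exp (\<i> * x * t) *\<^sub>C f x))"
    by (intro mult_right_mono) auto
  with * show ?thesis by (simp add: fourier_integral_def)
qed

lemma continuous_fourier_integral:
  fixes f :: "real \<Rightarrow> 'h::complex_hilbert"
  assumes f: "strongly_measurable f" and int: "integrable lborel (\<lambda>x. norm (f x))"
  shows "continuous_on UNIV (fourier_integral f)"
proof -
  have "(\<lambda>n. fourier_integral f (u n)) \<longlonglongrightarrow> fourier_integral f t" if u: "u \<longlonglongrightarrow> t" for u t
  proof -
    define h where "h n x = cmod (exp (\<i> * complex_of_real x * complex_of_real (u n)) - exp (\<i> * complex_of_real x * complex_of_real t)) * norm (f x)" for n x
    note [measurable] = measurable_norm_strongly_measurable[OF f]
    have hm: "h n \<in> borel_measurable lborel" for n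
      unfolding h_def[abs_def] by measurable
    have w: "integrable lborel (\<lambda>x. 2 * norm (f x))" using int by simp
    have n: "cmod (exp (\<i> * complex_of_real x * complex_of_real t)) = 1" for x t
      using norm_exp_i_times[of "x * t"] by (simp add: mult.assoc)
    have hb: "norm (h n x) \<le> 2 * norm (f x)" for n x
      unfolding h_def using norm_triangle_ineq4[of "exp (\<i> * complex_of_real x * complex_of_real (u n))" "exp (\<i> * complex_of_real x * complex_of_real t)"]
      by (simp add: n mult_right_mono)
    have hi: "integrable lborel (h n)" for n
      by (rule Bochner_Integration.integrable_bound[OF w hm]) (use hb in auto)
    have "(\<lambda>n. \<integral>x. h n x \<partial>lborel) \<longlonglongrightarrow> integral\<^sup>L lborel (\<lambda>x::real. 0)"
    proof (rule integral_dominated_convergence[OF _ hm w])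
      show "AE x in lborel. (\<lambda>n. h n x) \<longlonglongrightarrow> 0"
      proof (rule AE_I2)
        fix x
        have "(\<lambda>n. h n x) \<longlonglongrightarrow> cmod (exp (\<i> * complex_of_real x * complex_of_real t) - exp (\<i> * complex_of_real x * complex_of_real t)) * norm (f x)"
          unfolding h_def by (intro tendsto_intros u)
        then show "(\<lambda>n. h n x) \<longlonglongrightarrow> 0" by simp
      qed
    qed (use hb in auto)
    then have lim: "(\<lambda>n. \<integral>x. h n x \<partial>lborel) \<longlonglongrightarrow> 0" by simp
    have "norm (fourier_integral f (u n) - fourier_integral f t) \<le> 1 * (\<integral>x. h n x \<partial>lborel)" for n
    proof -
      define A where "A t = integral UNIV (\<lambda>x. exp (\<i> * complex_of_real x * complex_of_real t) *\<^sub>C f x)" for t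
      have "A (u n) - A t = integral UNIV (\<lambda>x. exp (\<i> * complex_of_real x * complex_of_real (u n)) *\<^sub>C f x - exp (\<i> * complex_of_real x * complex_of_real t) *\<^sub>C f x)"
        unfolding A_def by (rule integral_diff[symmetric]) (rule integrable_on_fourier[OF f int])+
      also have "norm \<dots> \<le> integral UNIV (h n)"
      proof (rule Henstock_Kurzweil_Integration.integral_norm_bound_integral)
        show "h n integrable_on UNIV" by (rule integrable_on_lborel[OF hi])
        show "norm (exp (\<i> * complex_of_real x * complex_of_real (u n)) *\<^sub>C f x - exp (\<i> * complex_of_real x * complex_of_real t) *\<^sub>C f x) \<le> h n x" for x
          by (simp add: h_def norm_scaleC flip: scaleC_diff_left)
      qed (intro integrable_diff integrable_on_fourier[OF f int])
      also have "\<dots> = (\<integral>x. h n x \<partial>lborel)" by (rule integral_lborel[OF hi])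
      finally have 1: "norm (A (u n) - A t) \<le> (\<integral>x. h n x \<partial>lborel)" .
      have "1 \<le> sqrt (2 * pi)" using pi_gt3 by simp
      then have "1 / sqrt (2 * pi) * norm (A (u n) - A t) \<le> 1 * norm (A (u n) - A t)"
        by (intro mult_right_mono) auto
      moreover have "fourier_integral f (u n) - fourier_integral f t = (1 / sqrt (2 * pi)) *\<^sub>R (A (u n) - A t)"
        by (simp add: fourier_integral_def A_def scaleR_diff_right)
      ultimately show ?thesis using 1 by simp
    qed
    then have "\<forall>n. norm (fourier_integral f (u n) - fourier_integral f t) \<le> norm (\<integral>x. h n x \<partial>lborel) * 1"
      by (auto intro: order_trans[OF _ abs_ge_self])
    then have "(\<lambda>n. fourier_integral f (u n) - fourier_integral f t) \<longlonglongrightarrow> 0"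
      by (intro tendsto_0_le[OF lim, where K=1] always_eventually)
    then show ?thesis by (rule LIM_zero_cancel)
  qed
  then show ?thesis
    by (auto simp: continuous_on_sequentially comp_def)
qed

lemma emeasure_Ioc_finite: "emeasure lborel {a<..b::real} < \<infinity>"
  by (cases "a \<le> b") auto

lemma fourier_integral_Ioc:
  fixes f :: "real \<Rightarrow> 'h::complex_hilbert"
  assumes f: "strongly_measurable f" and int: "integrable lborel (\<lambda>x. norm (f x))"
  shows "(\<integral>t. indicator {a<..b} t * cinner (fourier_integral f t) w \<partial>lborel)
    = (\<integral>x. ft_set {a<..b} x * cinner (f x) w \<partial>lborel)"
proof -
  have [measurable]: "(\<lambda>x. cinner (f x) w) \<in> borel_measurable borel"
    using borel_measurable_cinner[OF f strongly_measurable_const, of w] by simp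
  define G where "G = (\<lambda>(x, t). indicator {a<..b} t * (cinner (f x) w * iexp (x * t)))"
  have int2: "integrable (lborel \<Otimes>\<^sub>M lborel) G"
  proof (rule lborel_pair.Fubini_integrable)
    show "G \<in> borel_measurable (lborel \<Otimes>\<^sub>M lborel)"
      unfolding G_def by measurable
    have "(\<integral>t. norm (G (x, t)) \<partial>lborel) = cmod (cinner (f x) w) * measure lborel {a<..b}" for x
    proof -
      have "(\<lambda>t. norm (G (x, t))) = (\<lambda>t. cmod (cinner (f x) w) * indicator {a<..b} t)"
        by (auto simp: G_def norm_mult indicator_def fun_eq_iff simp del: of_real_mult)
      then show ?thesis by simp
    qed
    then show "integrable lborel (\<lambda>x. \<integral>t. norm (G (x, t)) \<partial>lborel)"
      using integrable_norm[OF integrable_cinner_const[OF f int, of w]] by simp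
    show "AE x in lborel. integrable lborel (\<lambda>t. G (x, t))"
    proof (rule AE_I2)
      fix x
      have "integrable lborel (\<lambda>t. cinner (f x) w * (indicator {a<..b} t * iexp (t * x)))"
        by (intro integrable_mult_right integrable_indicator_iexp) (auto simp: emeasure_Ioc_finite[simplified])
      then show "integrable lborel (\<lambda>t. G (x, t))"
        by (simp add: G_def mult_ac)
    qed
  qed
  have "(\<integral>t. (\<integral>x. G (x, t) \<partial>lborel) \<partial>lborel) = (\<integral>x. (\<integral>t. G (x, t) \<partial>lborel) \<partial>lborel)"
    using lborel_pair.Fubini_integral[of "\<lambda>x t. G (x, t)"] int2 by simp
  moreover have "(\<integral>x. G (x, t) \<partial>lborel) = sqrt (2 * pi) * (indicator {a<..b} t * cinner (fourier_integral f t) w)" for t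
    by (simp add: G_def cinner_fourier_integral[OF f int])
  moreover have "(\<integral>t. G (x, t) \<partial>lborel) = sqrt (2 * pi) * (ft_set {a<..b} x * cinner (f x) w)" for x
  proof -
    have "(\<integral>t. G (x, t) \<partial>lborel) = (\<integral>t. cinner (f x) w * (indicator {a<..b} t * iexp (t * x)) \<partial>lborel)"
      by (simp add: G_def mult_ac)
    then show ?thesis by (simp add: ft_set_def)
  qed
  ultimately show ?thesis by simp
qed

text \<open>
  Two square-integrable functions agree almost everywhere if their pairings with all interval
  tensors agree. For \<open>U f\<close> the pairing is evaluated by moving \<open>U\<close> to the interval, where the adjoint \<open>V\<close> is explicit;
  for the Fourier integral it is evaluated by Fubini's theorem. The results coincide.
\<close>

lemma rep_fourier_eq_integral:
  fixes U V :: "'h::complex_hilbert L2R \<Rightarrow> 'h L2R"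
  assumes V: "\<And>i. V (interval_tensor i) = cnj_ft_tensor i"
    and adj: "\<And>x y. cinner (U x) y = cinner x (V y)"
    and int: "integrable lborel (\<lambda>x. norm (rep_L2R f x))"
  shows "AE t in lborel. rep_L2R (U f) t = fourier_integral (rep_L2R f) t"
proof -
  define F where "F = fourier_integral (rep_L2R f)"
  note rf = strongly_measurable_rep[of f]
  have F_meas: "strongly_measurable F"
    unfolding F_def by (rule continuous_imp_strongly_measurable[OF continuous_fourier_integral[OF rf int]])
  \<comment> \<open>The Fourier integral is bounded, hence square-integrable over each bounded window.\<close>
  define W :: "nat \<Rightarrow> real set" where "W n = {-real n<..real n}" for n
  have "AE t in lborel. indicator (W n) t *\<^sub>R (rep_L2R (U f) t - F t) = 0" for n
  proof -
    define d where "d t = indicator (W n) t *\<^sub>R (rep_L2R (U f) t - F t)" for t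
    have sqF: "square_integrable (\<lambda>t. indicator (W n) t *\<^sub>R F t)"
    proof (rule square_integrable_bound)
      show "strongly_measurable (\<lambda>t. indicator (W n) t *\<^sub>R F t)"
        by (rule strongly_measurable_scaleR_fun[OF _ F_meas]) (simp add: W_def)
      show "square_integrable (indicator (W n) :: real \<Rightarrow> complex)"
        unfolding W_def by (rule square_integrable_Ioc)
      show "norm (indicator (W n) t *\<^sub>R F t) \<le> (\<integral>x. norm (rep_L2R f x) \<partial>lborel) * norm (indicator (W n) t :: complex)" for t
        using fourier_integral_bound[OF rf int, of t] by (simp add: F_def indicator_def)
    qed
    have sqU: "square_integrable (\<lambda>t. indicator (W n) t *\<^sub>R rep_L2R (U f) t)"
      by (rule square_integrable_scaleR_indicator[OF _ square_integrable_rep]) (simp add: W_def)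
    have sqd: "square_integrable d"
      using square_integrable_diff[OF sqU sqF] by (simp add: d_def[abs_def] scaleR_diff_right)
    have "abs_L2R d = 0"
    proof (rule zero_of_orthogonal_total[OF total_interval_tensor])
      fix i :: "real \<times> real \<times> 'h"
      obtain a b w where i: "i = (a, b, w)" by (cases i) auto
      define I where "I = {max a (- real n)<..min b (real n)}"
      have "cinner (abs_L2R d) (interval_tensor i) = (\<integral>t. cnj (indicator {a<..b} t) * cinner (d t) w \<partial>lborel)"
        by (simp add: i interval_tensor_def cinner_tensor_right[OF sqd square_integrable_Ioc])
      also have "\<dots> = (\<integral>t. indicator I t * cinner (rep_L2R (U f) t) w - indicator I t * cinner (F t) w \<partial>lborel)"
        by (rule Bochner_Integration.integral_cong[OF refl])
          (auto simp: d_def I_def W_def cinner_diff_left indicator_def)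
      also have "\<dots> = (\<integral>t. indicator I t * cinner (rep_L2R (U f) t) w \<partial>lborel)
          - (\<integral>t. indicator I t * cinner (F t) w \<partial>lborel)"
      proof (rule Bochner_Integration.integral_diff)
        have sq: "square_integrable (\<lambda>t. indicator I t *\<^sub>C w)" "square_integrable (\<lambda>t. indicator I t *\<^sub>R F t)"
          "square_integrable (\<lambda>t. indicator I t *\<^sub>R rep_L2R (U f) t)"
        proof -
          show "square_integrable (\<lambda>t. indicator I t *\<^sub>C w)"
            unfolding I_def by (rule square_integrable_tensor[OF square_integrable_Ioc])
          show "square_integrable (\<lambda>t. indicator I t *\<^sub>R rep_L2R (U f) t)"
            by (rule square_integrable_scaleR_indicator[OF _ square_integrable_rep]) (simp add: I_def)
          have "(\<lambda>t. indicator I t *\<^sub>R F t) = (\<lambda>t. indicator {a<..b} t *\<^sub>R indicator (W n) t *\<^sub>R F t)"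
            by (auto simp: I_def W_def indicator_def)
          then show "square_integrable (\<lambda>t. indicator I t *\<^sub>R F t)"
            using square_integrable_scaleR_indicator[OF _ sqF, of "{a<..b}"] by simp
        qed
        have eq: "cinner (indicator I t *\<^sub>R g t) (indicator I t *\<^sub>C w) = indicator I t * cinner (g t) w" for t and g :: "real \<Rightarrow> 'h"
          by (auto simp: indicator_def scaleC_one)
        show "integrable lborel (\<lambda>t. indicator I t * cinner (rep_L2R (U f) t) w)"
          "integrable lborel (\<lambda>t. indicator I t * cinner (F t) w)"
          using integrable_cinner[OF sq(3) sq(1)] integrable_cinner[OF sq(2) sq(1)] by (simp_all only: eq)
      qed
      also have "(\<integral>t. indicator I t * cinner (F t) w \<partial>lborel) = (\<integral>x. ft_set I x * cinner (rep_L2R f x) w \<partial>lborel)"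
        unfolding F_def I_def by (rule fourier_integral_Ioc[OF rf int])
      also have "(\<integral>t. indicator I t * cinner (rep_L2R (U f) t) w \<partial>lborel) = cinner (U f) (tensor (indicator I) w)"
      proof -
        have "cnj (indicator I t) = indicator I t" for t :: real by (simp add: indicator_def)
        then show ?thesis
          using cinner_tensor_right[OF square_integrable_rep square_integrable_Ioc, of "U f" "max a (- real n)" "min b (real n)" w]
          by (simp add: I_def)
      qed
      also have "\<dots> = cinner (abs_L2R (rep_L2R f)) (tensor (\<lambda>t. cnj (ft_set I t)) w)"
        using V[of "(max a (- real n), min b (real n), w)"]
        by (simp add: adj I_def interval_tensor_def cnj_ft_tensor_def)
      also have "\<dots> = (\<integral>x. ft_set I x * cinner (rep_L2R f x) w \<partial>lborel)"
        unfolding I_def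
        by (subst cinner_tensor_right[OF square_integrable_rep square_integrable_cnj[OF square_integrable_ft_set]]) simp
      finally have "cinner (abs_L2R d) (interval_tensor i) = 0" by simp
      then have "cnj (cinner (abs_L2R d) (interval_tensor i)) = 0" by simp
      then show "cinner (interval_tensor i) (abs_L2R d) = 0" by (simp flip: cinner_commute)
    qed
    then show ?thesis
      using abs_L2R_eq_iff[OF sqd square_integrable_zero] unfolding zero_L2R_abs d_def by blast
  qed
  then have "AE t in lborel. \<forall>n. indicator (W n) t *\<^sub>R (rep_L2R (U f) t - F t) = 0"
    unfolding AE_all_countable by (rule allI)
  then show ?thesis
  proof eventually_elim
    case (elim t)
    obtain m :: nat where m: "\<bar>t\<bar> < real m" using reals_Archimedean2 by blast
    then have "t \<in> W m" by (auto simp: W_def)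
    then show ?case using elim[rule_format, of m] by (simp add: F_def)
  qed
qed

lemma integrable_norm_interval_tensor:
  "integrable lborel (\<lambda>x. norm (rep_L2R (interval_tensor (a, b, v :: 'h::complex_hilbert)) x))"
proof -
  have sq: "square_integrable (\<lambda>x. indicator {a<..b} x *\<^sub>C v)"
    by (rule square_integrable_tensor[OF square_integrable_Ioc])
  have ae: "AE x in lborel. indicator {a<..b} x * norm v = norm (rep_L2R (interval_tensor (a, b, v)) x)"
    using rep_abs_L2R[OF sq]
    by eventually_elim (auto simp: interval_tensor_def tensor_def indicator_def scaleC_one)
  have int: "integrable lborel (\<lambda>x. indicator {a<..b} x * norm v)"
    by (intro integrable_mult_left integrable_real_indicator) (auto simp: emeasure_Ioc_finite[simplified])
  show ?thesis
    by (rule integrable_cong_AE[THEN iffD1, OF borel_measurable_integrable[OF int]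
          measurable_norm_strongly_measurable[OF strongly_measurable_rep] ae int])
qed

text \<open>
  The two conditions defining the Fourier transform determine it, because the interval tensors are
  integrable and total.
\<close>

lemma fourier_eqI:
  fixes U V :: "'h::complex_hilbert L2R \<Rightarrow> 'h L2R"
  assumes U: "bounded_clinear U"
    and V: "\<And>i. V (interval_tensor i) = cnj_ft_tensor i"
    and adj: "\<And>x y. cinner (U x) y = cinner x (V y)"
  shows "fourier = U"
  unfolding fourier_def
proof (rule the_equality, intro conjI allI impI)
  show "bounded_clinear U" by (rule U)
  show "AE t in lborel. rep_L2R (U f) t = (1 / sqrt (2 * pi)) *\<^sub>R integral UNIV (\<lambda>x. exp (\<i> * x * t) *\<^sub>C rep_L2R f x)"
    if "integrable lborel (\<lambda>x. norm (rep_L2R f x))" for f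
    using rep_fourier_eq_integral[of V U f, OF V adj that] by (simp add: fourier_integral_def)
  fix U' :: "'h L2R \<Rightarrow> 'h L2R"
  assume U': "bounded_clinear U' \<and> (\<forall>f. integrable lborel (\<lambda>x. norm (rep_L2R f x)) \<longrightarrow>
      (AE t in lborel. rep_L2R (U' f) t =
        (1 / sqrt (2 * pi)) *\<^sub>R integral UNIV (\<lambda>x. exp (\<i> * x * t) *\<^sub>C rep_L2R f x)))"
  show "U' = U"
  proof (rule bounded_clinear_eq_total[OF total_interval_tensor _ U])
    show "bounded_clinear U'" using U' by blast
    fix i :: "real \<times> real \<times> 'h"
    have i: "integrable lborel (\<lambda>x. norm (rep_L2R (interval_tensor i) x))"
      using integrable_norm_interval_tensor by (cases i) auto
    have "AE t in lborel. rep_L2R (U' (interval_tensor i)) t = fourier_integral (rep_L2R (interval_tensor i)) t"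
      using U' i by (simp add: fourier_integral_def)
    then have "AE t in lborel. rep_L2R (U' (interval_tensor i)) t = rep_L2R (U (interval_tensor i)) t"
      using rep_fourier_eq_integral[of V U, OF V adj i] by eventually_elim simp
    then show "U' (interval_tensor i) = U (interval_tensor i)" by (rule L2R_eqI)
  qed
qed

definition modulate :: "real \<Rightarrow> 'h::complex_normed_vector L2R \<Rightarrow> 'h L2R"
  where "modulate h F = abs_L2R (\<lambda>x. iexp (h * x) *\<^sub>C rep_L2R F x)"

lemma square_integrable_iexp:
  fixes f :: "real \<Rightarrow> 'h::complex_normed_vector"
  assumes "square_integrable f"
  shows "square_integrable (\<lambda>x. iexp (h * x) *\<^sub>C f x)"
  by (rule square_integrable_scaleC_fun[OF _ assms, where K=1]) (simp_all del: of_real_mult)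

lemma modulate_abs:
  fixes f :: "real \<Rightarrow> 'h::complex_normed_vector"
  assumes f: "square_integrable f"
  shows "modulate h (abs_L2R f) = abs_L2R (\<lambda>x. iexp (h * x) *\<^sub>C f x)"
  unfolding modulate_def abs_L2R_eq_iff[OF square_integrable_iexp[OF square_integrable_rep] square_integrable_iexp[OF f]]
  using rep_abs_L2R[OF f] by eventually_elim simp

lemma bounded_clinear_modulate: "bounded_clinear (modulate h :: 'h::complex_normed_vector L2R \<Rightarrow> 'h L2R)"
proof (rule bounded_clinearI[where K=1])
  fix F G :: "'h L2R" and c
  obtain f where f: "square_integrable f" "F = abs_L2R f" by (rule L2R_cases)
  obtain g where g: "square_integrable g" "G = abs_L2R g" by (rule L2R_cases)
  show "modulate h (F + G) = modulate h F + modulate h G"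
    by (simp add: f g modulate_abs add_L2R_abs square_integrable_add square_integrable_iexp scaleC_add_right
        del: of_real_mult)
  show "modulate h (c *\<^sub>C F) = c *\<^sub>C modulate h F"
    by (simp add: f(2) modulate_abs[OF f(1)] modulate_abs[OF square_integrable_scaleC[OF f(1)]]
        scaleC_L2R_abs[OF f(1)] scaleC_L2R_abs[OF square_integrable_iexp[OF f(1)]]
        scaleC_scaleC mult.commute[of c] del: of_real_mult)
  show "norm (modulate h F) \<le> 1 * norm F"
    by (simp add: f modulate_abs norm_L2R_abs square_integrable_iexp L2_norm_def norm_scaleC del: of_real_mult)
qed

lemma bounded_clinear_translation: "bounded_clinear (translation h :: 'h::complex_normed_vector L2R \<Rightarrow> 'h L2R)"
proof (rule bounded_clinearI[where K=1])
  fix F G :: "'h L2R" and c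
  obtain f where f: "square_integrable f" "F = abs_L2R f" by (rule L2R_cases)
  obtain g where g: "square_integrable g" "G = abs_L2R g" by (rule L2R_cases)
  show "translation h (F + G) = translation h F + translation h G"
    by (simp add: f g translation_abs add_L2R_abs square_integrable_add square_integrable_translate)
  show "translation h (c *\<^sub>C F) = c *\<^sub>C translation h F"
    by (simp add: f translation_abs scaleC_L2R_abs square_integrable_scaleC square_integrable_translate)
  have "(\<integral>x. (norm (f (x + h)))\<^sup>2 \<partial>lborel) = (\<integral>x. (norm (f x))\<^sup>2 \<partial>lborel)"
    using lborel_integral_real_affine[of 1 "\<lambda>x. (norm (f x))\<^sup>2" h] by (simp add: add.commute)
  then show "norm (translation h F) \<le> 1 * norm F"
    by (simp add: f translation_abs norm_L2R_abs square_integrable_translate L2_norm_def)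
qed

lemma ft_set_shift: "ft_set {a - h<..b - h} t = iexp (- h * t) * ft_set {a<..b} t"
proof -
  have "(\<integral>x. indicator {a<..b} x * iexp (x * t) \<partial>lborel)
      = (\<integral>x. indicator {a<..b} (h + 1 * x) * iexp ((h + 1 * x) * t) \<partial>lborel)"
    using lborel_integral_real_affine[of 1 "\<lambda>x. indicator {a<..b} x * iexp (x * t)" h] by simp
  also have "\<dots> = (\<integral>x. iexp (h * t) * (indicator {a - h<..b - h} x * iexp (x * t)) \<partial>lborel)"
    by (rule Bochner_Integration.integral_cong[OF refl])
      (auto simp: indicator_def ring_distribs exp_add[symmetric])
  also have "\<dots> = iexp (h * t) * (\<integral>x. indicator {a - h<..b - h} x * iexp (x * t) \<partial>lborel)"
    by (rule integral_mult_right_zero)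
  finally have "ft_set {a<..b} t = iexp (h * t) * ft_set {a - h<..b - h} t"
    by (simp add: ft_set_def)
  then have "iexp (- h * t) * ft_set {a<..b} t = (iexp (- h * t) * iexp (h * t)) * ft_set {a - h<..b - h} t"
    by simp
  also have "iexp (- h * t) * iexp (h * t) = 1" by (simp add: exp_add[symmetric])
  finally show ?thesis by simp
qed

text \<open>
  The translation rule is checked on intervals, whose translates are intervals, and extends to all
  classes by totality.
\<close>

proposition fourier_unitary:
  obtains V :: "'h::complex_hilbert L2R \<Rightarrow> 'h L2R" where
    "bounded_clinear (fourier :: 'h L2R \<Rightarrow> 'h L2R)" "bounded_clinear V"
    "inv fourier = V" "\<And>f. fourier (V f) = f" "\<And>f. V (fourier f) = f"
    "\<And>h (f :: 'h L2R). fourier (translation h f) = modulate (- h) (fourier f)"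
proof -
  obtain U V :: "'h L2R \<Rightarrow> 'h L2R" where U: "bounded_clinear U" and V: "bounded_clinear V"
    and Ui: "\<And>i. U (interval_tensor i) = ft_tensor i" and Vi: "\<And>i. V (interval_tensor i) = cnj_ft_tensor i"
    and adj: "\<And>x y. cinner (U x) y = cinner x (V y)" and UV: "\<And>x. U (V x) = x" and VU: "\<And>x. V (U x) = x"
    using fourier_pair_exists[where 'h='h] by blast
  have F: "fourier = U" by (rule fourier_eqI[OF U Vi adj])
  have inv: "inv U = V" by (rule inv_unique_comp) (simp_all add: fun_eq_iff UV VU)
  have "(\<lambda>f. U (translation h f)) = (\<lambda>f. modulate (- h) (U f))" for h
  proof (rule bounded_clinear_eq_total[OF total_interval_tensor
          bounded_clinear_compose[OF U bounded_clinear_translation]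
          bounded_clinear_compose[OF bounded_clinear_modulate U]])
    fix i :: "real \<times> real \<times> 'h"
    obtain a b v where i: "i = (a, b, v)" by (cases i) auto
    have "(\<lambda>t. indicator {a<..b} (t + h) *\<^sub>C v) = (\<lambda>t. indicator {a - h<..b - h} t *\<^sub>C v)"
      by (auto simp: indicator_def)
    then have "translation h (interval_tensor i) = interval_tensor (a - h, b - h, v)"
      by (simp add: i interval_tensor_def tensor_def translation_abs square_integrable_tensor square_integrable_Ioc)
    moreover have "modulate (- h) (ft_tensor i) = ft_tensor (a - h, b - h, v)"
      by (simp add: i ft_tensor_def tensor_def modulate_abs square_integrable_tensor square_integrable_ft_set
          ft_set_shift scaleC_scaleC del: of_real_mult of_real_minus)
    ultimately show "U (translation h (interval_tensor i)) = modulate (- h) (U (interval_tensor i))"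
      by (simp add: Ui)
  qed
  then have "U (translation h f) = modulate (- h) (U f)" for h f by (rule fun_cong)
  then show thesis
    using U V UV VU inv by (intro that[of V]) (simp_all add: F)
qed

section \<open>Weak and strong analyticity\<close>

lemma holomorphic_ball_Lipschitz:
  assumes hol: "f holomorphic_on ball a r" and bound: "\<And>z. z \<in> ball a r \<Longrightarrow> cmod (f z) \<le> B"
    and r: "r > 0" and z: "z \<in> ball a (r / 2)" and w: "w \<in> ball a (r / 2)"
  shows "cmod (f z - f w) \<le> 2 * B / r * cmod (z - w)"
proof (rule field_differentiable_bound[OF convex_ball _ _ z w])
  fix u assume u: "u \<in> ball a (r / 2)"
  have sub: "cball u (r / 2) \<subseteq> ball a r"
  proof
    fix v assume "v \<in> cball u (r / 2)"
    then have "dist a v < r" using u dist_triangle[of a v u] by (simp add: dist_commute)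
    then show "v \<in> ball a r" by simp
  qed
  moreover have "u \<in> cball u (r / 2)" using r by simp
  ultimately have ua: "u \<in> ball a r" by blast
  show "(f has_field_derivative deriv f u) (at u within ball a (r / 2))"
    using holomorphic_derivI[OF hol open_ball ua] by (rule has_field_derivative_at_within)
  have "cmod ((deriv ^^ 1) f u) \<le> fact 1 * B / (r / 2) ^ 1"
  proof (rule Cauchy_inequality)
    show "f holomorphic_on ball u (r / 2)"
      using hol by (rule holomorphic_on_subset) (use sub ball_subset_cball in blast)
    show "continuous_on (cball u (r / 2)) f"
      using holomorphic_on_imp_continuous_on[OF hol] sub by (rule continuous_on_subset)
    show "cmod (f x) \<le> B" if "cmod (u - x) = r / 2" for x
      using sub that by (intro bound) (auto simp: dist_norm subset_eq)
  qed (use r in simp)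
  then show "cmod (deriv f u) \<le> 2 * B / r" by (simp add: mult.commute)
qed

text \<open>
  The difference quotients of the scalar functions \<open>\<langle>F, w\<rangle>\<close> are Lipschitz with a constant
  proportional to the norm of \<open>w\<close>, by Cauchy's estimate. Hence the difference quotients of \<open>F\<close>
  are Cauchy in norm.
\<close>

lemma weakly_holomorphic_imp_derivative:
  fixes F :: "complex \<Rightarrow> 'h::complex_hilbert"
  assumes hol: "\<And>w. (\<lambda>z. cinner (F z) w) holomorphic_on ball a r" and r: "r > 0"
    and bound: "\<And>z. z \<in> ball a r \<Longrightarrow> norm (F z) \<le> B"
  shows "\<exists>D. (F has_derivative (\<lambda>h. h *\<^sub>C D)) (at a)"
proof -
  have B: "0 \<le> B" using bound[of a] r order_trans[OF norm_ge_zero] by auto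
  define K where "K = 8 * B / r\<^sup>2"
  have K: "0 \<le> K" using B by (simp add: K_def)
  define q where "q z = inverse (z - a) *\<^sub>C (F z - F a)" for z
  have q_Lip: "norm (q z - q w) \<le> K * cmod (z - w)"
    if z: "z \<in> ball a (r / 4)" "z \<noteq> a" and w: "w \<in> ball a (r / 4)" "w \<noteq> a" for z w
  proof (rule norm_le_of_cinner_le)
    show "0 \<le> K * cmod (z - w)" using K by simp
    fix v
    define f where "f z = cinner (F z) v" for z
    define p where "p z = (if z = a then deriv f a else (f z - f a) / (z - a))" for z
    have fh: "f holomorphic_on ball a r" using hol[of v] by (simp add: f_def[abs_def])
    have fb: "cmod (f z) \<le> B * norm v" if "z \<in> ball a r" for z
    proof -
      have "cmod (f z) \<le> norm (F z) * norm v" unfolding f_def by (rule cinner_Cauchy_Schwarz)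
      also have "\<dots> \<le> B * norm v" by (intro mult_right_mono bound that norm_ge_zero)
      finally show ?thesis .
    qed
    have "p holomorphic_on ball a r"
      unfolding p_def[abs_def] by (rule pole_lemma_open[OF fh open_ball])
    then have ph: "p holomorphic_on ball a (r / 2)"
      by (rule holomorphic_on_subset) (use r in auto)
    have pb: "cmod (p z) \<le> 2 * (B * norm v) / r" if z: "z \<in> ball a (r / 2)" for z
    proof (cases "z = a")
      case False
      have "cmod (f z - f a) \<le> 2 * (B * norm v) / r * cmod (z - a)"
        by (rule holomorphic_ball_Lipschitz[OF fh fb r z]) (use r in auto)
      then show ?thesis using False by (simp add: p_def norm_divide divide_le_eq)
    next
      case True
      have "cmod ((deriv ^^ 1) f a) \<le> fact 1 * (B * norm v) / (r / 2) ^ 1"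
      proof (rule Cauchy_inequality)
        show "f holomorphic_on ball a (r / 2)"
          using fh by (rule holomorphic_on_subset) (use r in auto)
        show "continuous_on (cball a (r / 2)) f"
          using holomorphic_on_imp_continuous_on[OF fh] by (rule continuous_on_subset) (use r in auto)
        show "cmod (f x) \<le> B * norm v" if "cmod (a - x) = r / 2" for x
          using that r by (intro fb) (auto simp: dist_norm)
      qed (use r in simp)
      then show ?thesis using True by (simp add: p_def mult.commute)
    qed
    have "cmod (p z - p w) \<le> 2 * (2 * (B * norm v) / r) / (r / 2) * cmod (z - w)"
    proof (rule holomorphic_ball_Lipschitz[OF ph pb])
      show "z \<in> ball a (r / 2 / 2)" "w \<in> ball a (r / 2 / 2)" "0 < r / 2" using z(1) w(1) r by auto
    qed
    also have "\<dots> = K * cmod (z - w) * norm v"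
      by (simp add: K_def power2_eq_square)
    also have "p z - p w = cinner (q z - q w) v"
      using z(2) w(2) by (simp add: p_def q_def f_def cinner_diff_left cinner_scaleC_left divide_inverse algebra_simps)
    finally show "cmod (cinner (q z - q w) v) \<le> K * cmod (z - w) * norm v" .
  qed
  define u where "u n = a + of_real (r / 8 * inverse (real (Suc n)))" for n
  have u_ne: "u n \<noteq> a" for n using r by (simp add: u_def del: of_nat_Suc)
  have u_in: "u n \<in> ball a (r / 4)" for n
  proof -
    have "inverse (real (Suc n)) \<le> 1" by (simp add: inverse_le_1_iff)
    then have "r / 8 * inverse (real (Suc n)) \<le> r / 8 * 1" using r by (intro mult_left_mono) auto
    moreover have "dist a (u n) = r / 8 * inverse (real (Suc n))"
      using r by (simp add: u_def dist_norm norm_mult norm_divide norm_inverse norm_of_nat del: of_nat_Suc)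
    ultimately show ?thesis using r by (simp only: mem_ball)
  qed
  have u_lim: "u \<longlonglongrightarrow> a"
  proof -
    have "u \<longlonglongrightarrow> a + of_real (r / 8 * 0)"
      unfolding u_def[abs_def] by (intro tendsto_intros LIMSEQ_inverse_real_of_nat)
    then show ?thesis by simp
  qed
  have "Cauchy (\<lambda>n. q (u n))"
  proof (rule CauchyI)
    fix e :: real assume e: "e > 0"
    have "Cauchy u" using u_lim by (rule LIMSEQ_imp_Cauchy)
    then obtain M where M: "\<And>m n. m \<ge> M \<Longrightarrow> n \<ge> M \<Longrightarrow> norm (u m - u n) < e / (K + 1)"
      using CauchyD[of u "e / (K + 1)"] e K by force
    have "norm (q (u m) - q (u n)) < e" if "m \<ge> M" "n \<ge> M" for m n
    proof -
      have "norm (q (u m) - q (u n)) \<le> K * norm (u m - u n)" by (rule q_Lip[OF u_in u_ne u_in u_ne])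
      also have "\<dots> \<le> K * (e / (K + 1))" using M[OF that] K by (intro mult_left_mono) auto
      also have "\<dots> < e" using e K by (simp add: field_simps)
      finally show ?thesis .
    qed
    then show "\<exists>M. \<forall>m\<ge>M. \<forall>n\<ge>M. norm (q (u m) - q (u n)) < e" by blast
  qed
  then obtain D where D: "(\<lambda>n. q (u n)) \<longlonglongrightarrow> D"
    using Cauchy_convergent convergent_def by blast
  have qD: "norm (q z - D) \<le> K * cmod (z - a)" if z: "z \<in> ball a (r / 4)" "z \<noteq> a" for z
  proof (rule LIMSEQ_le)
    show "(\<lambda>n. norm (q z - q (u n))) \<longlonglongrightarrow> norm (q z - D)" by (intro tendsto_intros D)
    show "(\<lambda>n. K * cmod (z - u n)) \<longlonglongrightarrow> K * cmod (z - a)" by (intro tendsto_intros u_lim)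
    show "\<exists>N. \<forall>n\<ge>N. norm (q z - q (u n)) \<le> K * cmod (z - u n)"
      using q_Lip[OF z u_in u_ne] by blast
  qed
  have "(F has_derivative (\<lambda>h. h *\<^sub>C D)) (at a)"
    unfolding has_derivative_at_alt
  proof (intro conjI allI impI)
    show "bounded_linear (\<lambda>h. h *\<^sub>C D)"
      by (rule bounded_bilinear.bounded_linear_left[OF bounded_bilinear_scaleC])
    fix e :: real assume e: "e > 0"
    define d where "d = min (r / 4) (e / (K + 1))"
    have d: "d > 0" using r e K by (simp add: d_def)
    have "norm (F y - F a - (y - a) *\<^sub>C D) \<le> e * norm (y - a)" if y: "norm (y - a) < d" for y
    proof (cases "y = a")
      case False
      have "F y - F a - (y - a) *\<^sub>C D = (y - a) *\<^sub>C (q y - D)"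
        using False by (simp add: q_def scaleC_diff_right scaleC_scaleC scaleC_one)
      then have "norm (F y - F a - (y - a) *\<^sub>C D) = cmod (y - a) * norm (q y - D)"
        by (simp add: norm_scaleC)
      also have "\<dots> \<le> cmod (y - a) * (K * cmod (y - a))"
        using y False by (intro mult_left_mono qD) (auto simp: d_def dist_norm norm_minus_commute)
      also have "\<dots> \<le> cmod (y - a) * e"
      proof (rule mult_left_mono)
        have "K * cmod (y - a) \<le> (K + 1) * (e / (K + 1))"
          using y K by (intro mult_mono) (auto simp: d_def)
        then show "K * cmod (y - a) \<le> e" using K by simp
      qed simp
      finally show ?thesis by (simp add: mult.commute)
    qed simp
    then show "\<exists>d>0. \<forall>y. norm (y - a) < d \<longrightarrow> norm (F y - F a - (y - a) *\<^sub>C D) \<le> e * norm (y - a)"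
      using d by blast
  qed
  then show ?thesis by blast
qed

section \<open>Scalar functions in the upper half-plane\<close>

lemma integral_interval_le_lborel:
  fixes g :: "real \<Rightarrow> real"
  assumes int: "integrable lborel g" and nonneg: "\<And>x. 0 \<le> g x"
  shows "integral {a..b} g \<le> (\<integral>x. g x \<partial>lborel)"
proof -
  have "g integrable_on {a..b}"
    using integrable_on_subcbox[OF integrable_on_lborel[OF int], of a b] by simp
  then have "integral {a..b} g \<le> integral UNIV g"
    by (intro integral_subset_le integrable_on_lborel int) (auto simp: nonneg)
  then show ?thesis by (simp add: integral_lborel[OF int])
qed

lemma convex_Im_greater: "convex {z. Im z > c}" and open_Im_greater: "open {z. Im z > c}"
  using convex_halfspace_Im_gt[of c] open_halfspace_Im_gt[of c] by simp_all

text \<open>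
  If \<open>\<Phi>\<close> is a primitive of \<open>f\<close>, the increments \<open>\<Phi> (z + s) - \<Phi> z\<close> are integrals over horizontal
  segments, hence bounded, so Cauchy's estimate bounds their derivative \<open>f (z + s) - f z\<close>. The
  mean of \<open>f\<close> over a horizontal segment of length \<open>1\<close> is bounded as well.
\<close>

lemma hardy_interior_bound:
  fixes f :: "complex \<Rightarrow> complex"
  assumes hol: "f holomorphic_on {z. Im z > 0}"
    and int: "\<And>y. y > 0 \<Longrightarrow> integrable lborel (\<lambda>x. (cmod (f (Complex x y)))\<^sup>2)"
    and bound: "\<And>y. y > 0 \<Longrightarrow> (\<integral>x. (cmod (f (Complex x y)))\<^sup>2 \<partial>lborel) \<le> C"
    and z: "Im z > 0"
  shows "cmod (f z) \<le> (C + 1) * (1 + 2 / Im z)"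
proof -
  define H where "H = {z. Im z > 0}"
  have H: "convex H" "open H" unfolding H_def by (rule convex_Im_greater open_Im_greater)+
  have fH: "f holomorphic_on H" using hol by (simp add: H_def)
  obtain \<Phi> where \<Phi>: "\<And>x. x \<in> H \<Longrightarrow> (\<Phi> has_field_derivative f x) (at x within H)"
    using holomorphic_convex_primitive'[OF H fH] by blast
  have \<Phi>': "(\<Phi> has_field_derivative f x) (at x)" if "x \<in> H" for x
    using \<Phi>[OF that] at_within_open[OF that H(2)] by simp
  have shift: "u + of_real s \<in> H" if "u \<in> H" for u s using that by (simp add: H_def)
  have cont: "continuous_on {0..s} (\<lambda>x. f (u + of_real x))" if "u \<in> H" for u s
    by (rule continuous_on_compose2[OF holomorphic_on_imp_continuous_on[OF fH]])
      (auto intro!: continuous_intros shift that)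
  \<comment> \<open>The constant \<open>C + 1\<close> comes from \<open>r \<le> r\<^sup>2 + 1\<close> and the length of the segment being at most \<open>1\<close>.\<close>
  have mean: "integral {0..s} (\<lambda>x. cmod (f (u + of_real x))) \<le> C + 1"
    if u: "u \<in> H" and s: "0 \<le> s" "s \<le> 1" for u s
  proof -
    have line: "u + of_real x = Complex (Re u + 1 * x) (Im u)" for x by (simp add: complex_eq_iff)
    have y: "Im u > 0" using u by (simp add: H_def)
    have i: "integrable lborel (\<lambda>x. (cmod (f (u + of_real x)))\<^sup>2)"
      unfolding line by (rule lborel_integrable_real_affine[OF int[OF y]]) simp
    have "integral {0..s} (\<lambda>x. cmod (f (u + of_real x)))
        \<le> integral {0..s} (\<lambda>x. (cmod (f (u + of_real x)))\<^sup>2 + 1)"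
    proof (rule integral_le)
      show "cmod (f (u + of_real x)) \<le> (cmod (f (u + of_real x)))\<^sup>2 + 1" for x
      proof -
        have "2 * cmod (f (u + of_real x)) \<le> (cmod (f (u + of_real x)))\<^sup>2 + 1"
          using sum_squares_bound[of "cmod (f (u + of_real x))" 1] by simp
        moreover have "0 \<le> cmod (f (u + of_real x))" by simp
        ultimately show ?thesis by linarith
      qed
    qed (auto intro!: integrable_continuous_real continuous_intros cont u)
    also have "\<dots> = integral {0..s} (\<lambda>x. (cmod (f (u + of_real x)))\<^sup>2) + s"
      using s by (subst integral_add) (auto intro!: integrable_continuous_real continuous_intros cont u)
    also have "integral {0..s} (\<lambda>x. (cmod (f (u + of_real x)))\<^sup>2) \<le> (\<integral>x. (cmod (f (u + of_real x)))\<^sup>2 \<partial>lborel)"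
      by (rule integral_interval_le_lborel[OF i]) simp
    also have "(\<integral>x. (cmod (f (u + of_real x)))\<^sup>2 \<partial>lborel) = (\<integral>x. (cmod (f (Complex x (Im u))))\<^sup>2 \<partial>lborel)"
      unfolding line using lborel_integral_real_affine[of 1 "\<lambda>x. (cmod (f (Complex x (Im u))))\<^sup>2" "Re u"] by simp
    also have "\<dots> \<le> C" by (rule bound[OF y])
    finally show ?thesis using s by simp
  qed
  have C: "0 \<le> C"
    by (rule order_trans[OF Bochner_Integration.integral_nonneg bound[of 1]]) simp_all
  have incr: "cmod (\<Phi> (u + of_real s) - \<Phi> u) \<le> C + 1" if u: "u \<in> H" and s: "0 \<le> s" "s \<le> 1" for u s
  proof -
    have "((\<lambda>x. f (u + of_real x)) has_integral (\<Phi> (u + of_real s) - \<Phi> (u + of_real 0))) {0..s}"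
    proof (rule fundamental_theorem_of_calculus[OF s(1)])
      fix x assume "x \<in> {0..s}"
      have "((\<lambda>w. \<Phi> (u + w)) has_field_derivative f (u + of_real x)) (at (of_real x))"
      proof -
        have "((\<lambda>w. \<Phi> (u + w)) has_field_derivative f (u + of_real x) * 1) (at (of_real x))"
          by (rule DERIV_chain2[where f=\<Phi> and g="\<lambda>w. u + w"])
            (auto intro!: \<Phi>' shift u derivative_eq_intros)
        then show ?thesis by simp
      qed
      then show "((\<lambda>x. \<Phi> (u + of_real x)) has_vector_derivative f (u + of_real x)) (at x within {0..s})"
        by (rule has_vector_derivative_real_field)
    qed
    then have "\<Phi> (u + of_real s) - \<Phi> u = integral {0..s} (\<lambda>x. f (u + of_real x))"
      by (simp add: has_integral_iff)
    also have "cmod \<dots> \<le> integral {0..s} (\<lambda>x. cmod (f (u + of_real x)))"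
      by (rule Henstock_Kurzweil_Integration.integral_norm_bound_integral)
        (auto intro!: integrable_continuous_real continuous_intros cont u)
    also have "\<dots> \<le> C + 1" by (rule mean[OF u s])
    finally show ?thesis .
  qed
  have zH: "z \<in> H" using z by (simp add: H_def)
  have sub: "cball z (Im z / 2) \<subseteq> H"
  proof
    fix w assume "w \<in> cball z (Im z / 2)"
    then have "\<bar>Im (z - w)\<bar> \<le> Im z / 2" using abs_Im_le_cmod[of "z - w"] by (simp add: dist_norm)
    then have "Im (z - w) \<le> Im z / 2" by (rule order_trans[OF abs_ge_self])
    then have "0 < Im w" using z by simp
    then show "w \<in> H" by (simp add: H_def)
  qed
  have diff: "cmod (f (z + of_real s) - f z) \<le> 2 * (C + 1) / Im z" if s: "0 \<le> s" "s \<le> 1" for s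
  proof -
    define \<Psi> where "\<Psi> u = \<Phi> (u + of_real s) - \<Phi> u" for u
    have \<Psi>': "(\<Psi> has_field_derivative f (u + of_real s) - f u) (at u)" if "u \<in> H" for u
    proof -
      have "((\<lambda>u. \<Phi> (u + of_real s)) has_field_derivative f (u + of_real s) * 1) (at u)"
        by (rule DERIV_chain2[where f=\<Phi> and g="\<lambda>u. u + of_real s"])
          (auto intro!: \<Phi>' shift that derivative_eq_intros)
      then show ?thesis
        unfolding \<Psi>_def[abs_def] using \<Phi>'[OF that] by (intro DERIV_diff) simp_all
    qed
    have "\<Psi> holomorphic_on H"
      using \<Psi>' by (auto simp: holomorphic_on_open[OF H(2)])
    then have hol: "\<Psi> holomorphic_on cball z (Im z / 2)" using sub by (rule holomorphic_on_subset)
    have "cmod ((deriv ^^ 1) \<Psi> z) \<le> fact 1 * (C + 1) / (Im z / 2) ^ 1"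
    proof (rule Cauchy_inequality)
      show "\<Psi> holomorphic_on ball z (Im z / 2)"
        using hol by (rule holomorphic_on_subset) auto
      show "continuous_on (cball z (Im z / 2)) \<Psi>" by (rule holomorphic_on_imp_continuous_on[OF hol])
      show "cmod (\<Psi> x) \<le> C + 1" if "cmod (z - x) = Im z / 2" for x
        unfolding \<Psi>_def using sub that by (intro incr s) (auto simp: dist_norm subset_eq)
    qed (use z in simp)
    moreover have "deriv \<Psi> z = f (z + of_real s) - f z" by (rule DERIV_imp_deriv[OF \<Psi>'[OF zH]])
    ultimately show ?thesis by (simp add: mult.commute)
  qed
  have "cmod (f z) = integral {0..1::real} (\<lambda>x. cmod (f z))" by simp
  also have "\<dots> \<le> integral {0..1} (\<lambda>x. cmod (f (z + of_real x)) + 2 * (C + 1) / Im z)"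
  proof (rule integral_le)
    show "cmod (f z) \<le> cmod (f (z + of_real x)) + 2 * (C + 1) / Im z" if "x \<in> {0..1}" for x
    proof -
      have "cmod (f z) \<le> cmod (f (z + of_real x)) + cmod (f (z + of_real x) - f z)"
        by (rule norm_triangle_sub[of "f z" "f (z + of_real x)", unfolded norm_minus_commute[of "f z"]])
      then show ?thesis using diff[of x] that by simp
    qed
  qed (auto intro!: integrable_continuous_real continuous_intros cont zH)
  also have "\<dots> = integral {0..1} (\<lambda>x. cmod (f (z + of_real x))) + 2 * (C + 1) / Im z"
    by (subst integral_add) (auto intro!: integrable_continuous_real continuous_intros cont zH)
  also have "\<dots> \<le> (C + 1) + 2 * (C + 1) / Im z"
    by (intro add_right_mono mean zH) auto
  also have "\<dots> = (C + 1) * (1 + 2 / Im z)" by (simp add: algebra_simps)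
  finally show ?thesis .
qed

section \<open>The Poisson formula\<close>

text \<open>The Poisson kernel of the upper half-plane without its factor \<open>Im t / \<pi>\<close>.\<close>

definition poisson :: "complex \<Rightarrow> real \<Rightarrow> real"
  where "poisson t x = 1 / (cmod (of_real x - t))\<^sup>2"

lemma cmod_real_minus: "(cmod (of_real x - t))\<^sup>2 = (x - Re t)\<^sup>2 + (Im t)\<^sup>2"
  by (simp add: cmod_power2)

lemma poisson_bounds:
  assumes "Im t > 0"
  shows "0 < poisson t x" "poisson t x \<le> 1 / (Im t)\<^sup>2"
proof -
  have "0 < (Im t)\<^sup>2" and "(Im t)\<^sup>2 \<le> (cmod (of_real x - t))\<^sup>2"
    using assms by (simp_all add: cmod_real_minus)
  then have "0 < (cmod (of_real x - t))\<^sup>2" by (rule less_le_trans)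
  then show "0 < poisson t x" unfolding poisson_def by (intro divide_pos_pos zero_less_one)
  show "poisson t x \<le> 1 / (Im t)\<^sup>2"
    unfolding poisson_def by (rule frac_le) (use \<open>0 < (Im t)\<^sup>2\<close> \<open>(Im t)\<^sup>2 \<le> _\<close> in auto)
qed

lemma measurable_poisson [measurable]: "poisson t \<in> borel_measurable borel"
  unfolding poisson_def[abs_def] by measurable

lemma integrable_poisson:
  assumes "Im t > 0"
  shows "integrable lborel (poisson t)"
proof -
  define b where "b = Im t"
  have b: "b > 0" using assms by (simp add: b_def)
  have "integrable lborel (\<lambda>x. 1 / (1 + (- Re t / b + (1 / b) * x)\<^sup>2))"
    by (rule lborel_integrable_real_affine[OF integrable_inverse_quadratic]) (use b in simp)
  then have "integrable lborel (\<lambda>x. (1 / b\<^sup>2) * (1 / (1 + (- Re t / b + (1 / b) * x)\<^sup>2)))"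
    by (rule integrable_mult_right)
  moreover have "(1 / b\<^sup>2) * (1 / (1 + (- Re t / b + (1 / b) * x)\<^sup>2)) = poisson t x" for x
  proof -
    have gen: "b\<^sup>2 * (1 + y\<^sup>2) = b\<^sup>2 + (b * y)\<^sup>2" for y
      by (simp add: algebra_simps power_mult_distrib)
    have "b\<^sup>2 * (1 + (- Re t / b + (1 / b) * x)\<^sup>2) = b\<^sup>2 + (b * (- Re t / b + (1 / b) * x))\<^sup>2"
      by (rule gen)
    also have "b * (- Re t / b + (1 / b) * x) = x - Re t" using b by (simp add: field_simps)
    also have "b\<^sup>2 + (x - Re t)\<^sup>2 = (cmod (of_real x - t))\<^sup>2" by (simp add: cmod_real_minus b_def)
    finally show ?thesis by (simp add: poisson_def)
  qed
  ultimately show ?thesis by simp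
qed

lemma integral_poisson_pos:
  assumes "Im t > 0"
  shows "(\<integral>x. poisson t x \<partial>lborel) > 0"
proof -
  define c where "c = 1 / (1 + (Im t)\<^sup>2)"
  have c: "c > 0" by (simp add: c_def add_pos_nonneg)
  have "c * indicator {Re t..Re t + 1} x \<le> poisson t x" for x
  proof (cases "x \<in> {Re t..Re t + 1}")
    case True
    then have "(x - Re t)\<^sup>2 \<le> 1" by (simp add: abs_square_le_1)
    then have "(cmod (of_real x - t))\<^sup>2 \<le> 1 + (Im t)\<^sup>2" by (simp add: cmod_real_minus)
    moreover have "0 < (cmod (of_real x - t))\<^sup>2" using poisson_bounds(1)[OF assms, of x] by (simp add: poisson_def)
    ultimately have "c \<le> poisson t x" unfolding c_def poisson_def by (intro frac_le) auto
    then show ?thesis using True by simp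
  qed (use poisson_bounds(1)[OF assms, of x] in simp)
  then have "(\<integral>x. c * indicator {Re t..Re t + 1} x \<partial>lborel) \<le> (\<integral>x. poisson t x \<partial>lborel)"
    by (intro Bochner_Integration.integral_mono integrable_poisson assms) auto
  then show ?thesis using c by simp
qed

text \<open>
  The Poisson formula for a bounded function, without the value of the normalizing constant. Up to
  that constant the kernel is \<open>1 / ((z - t) * (z - cnj t))\<close>; subtracting \<open>g t\<close> removes the pole in
  the upper half-plane, so the integral over a large closed semicircle vanishes, and the arc
  contributes \<open>O(1 / R)\<close>.
\<close>

lemma poisson_formula:
  assumes hol: "g holomorphic_on {z. Im z > - \<delta>}" and \<delta>: "\<delta> > 0"
    and bound: "\<And>z. Im z \<ge> 0 \<Longrightarrow> cmod (g z) \<le> B" and t: "Im t > 0"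
  shows "g t * (\<integral>x. poisson t x \<partial>lborel) = (\<integral>x. g (of_real x) * poisson t x \<partial>lborel)"
proof -
  have B: "0 \<le> B" using bound[of t] t order_trans[OF norm_ge_zero] by auto
  define S where "S = {z. Im z > - min \<delta> (Im t)}"
  have S: "convex S" "open S" unfolding S_def by (rule convex_Im_greater open_Im_greater)+
  have S_sub: "S \<subseteq> {z. Im z > - \<delta>}" by (auto simp: S_def)
  define q where "q z = (if z = t then deriv g t else (g z - g t) / (z - t)) / (z - cnj t)" for z
  have "(\<lambda>z. if z = t then deriv g t else (g z - g t) / (z - t)) holomorphic_on S"
    by (rule pole_lemma_open[OF holomorphic_on_subset[OF hol S_sub] S(2)])
  moreover have "z - cnj t \<noteq> 0" if "z \<in> S" for z using that by (auto simp: S_def)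
  ultimately have qh: "q holomorphic_on S"
    unfolding q_def[abs_def] by (intro holomorphic_intros)
  have real_in: "of_real x \<in> S" for x using \<delta> t by (simp add: S_def)
  have q_real: "q (of_real x) = (g (of_real x) - g t) * poisson t x" for x
  proof -
    have ne: "of_real x \<noteq> t" using t by auto
    have "(of_real x - t) * (of_real x - cnj t) = of_real ((cmod (of_real x - t))\<^sup>2)"
      unfolding complex_norm_square by simp
    then show ?thesis using ne by (simp add: q_def poisson_def)
  qed
  have gc: "continuous_on UNIV (\<lambda>x. g (complex_of_real x))"
    by (rule continuous_on_compose2[OF holomorphic_on_imp_continuous_on[OF hol]])
      (use \<delta> in \<open>auto intro!: continuous_intros\<close>)
  then have [measurable]: "(\<lambda>x. g (complex_of_real x)) \<in> borel_measurable borel"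
    by (rule borel_measurable_continuous_onI)
  have gP: "integrable lborel (\<lambda>x. g (of_real x) * poisson t x)"
  proof (rule Bochner_Integration.integrable_bound)
    show "integrable lborel (\<lambda>x. B * poisson t x)" using integrable_poisson[OF t] by simp
    show "AE x in lborel. norm (g (of_real x) * poisson t x) \<le> norm (B * poisson t x)"
    proof (rule AE_I2)
      fix x
      have "cmod (g (of_real x)) * poisson t x \<le> B * poisson t x"
        by (intro mult_right_mono bound less_imp_le[OF poisson_bounds(1)[OF t]]) simp
      then show "norm (g (of_real x) * poisson t x) \<le> norm (B * poisson t x)"
        using poisson_bounds(1)[OF t, of x] B by (simp add: norm_mult abs_of_pos)
    qed
  qed measurable
  have PI: "integrable lborel (\<lambda>x. complex_of_real (poisson t x))"
    using integrable_poisson[OF t] by (rule integrable_of_real)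
  have qI: "integrable lborel (\<lambda>x. q (of_real x))"
    unfolding q_real left_diff_distrib
    by (intro Bochner_Integration.integrable_diff gP integrable_mult_right PI)
  have arc: "cmod (integral {- R..R} (\<lambda>x. q (of_real x))) \<le> 2 * B / (R - cmod t)\<^sup>2 * R * pi"
    if R: "R > cmod t" for R
  proof -
    have R0: "R > 0" using R norm_ge_zero[of t] by linarith
    define l where "l = linepath (complex_of_real (- R)) (complex_of_real R)"
    define a where "a = part_circlepath 0 R 0 pi"
    have l_in: "path_image l \<subseteq> S"
    proof -
      have "path_image l \<subseteq> {z. Im z = 0}"
        unfolding l_def path_image_linepath
        by (rule closed_segment_subset) (auto intro!: convexI simp: algebra_simps)
      then show ?thesis using \<delta> t by (auto simp: S_def)
    qed
    have a_pt: "cmod z = R \<and> Im z \<ge> 0" if "z \<in> path_image a" for z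
    proof -
      obtain x where x: "z = 0 + of_real R * exp (\<i> * of_real x)" "0 \<le> x" "x \<le> pi"
        using \<open>z \<in> path_image a\<close> unfolding a_def by (auto simp: path_image_part_circlepath)
      have "Im z = R * sin x" using x(1) by (simp add: Im_exp)
      moreover have "0 \<le> sin x" using x by (intro sin_ge_zero) auto
      moreover have "cmod z = R" using x(1) R0 by (simp add: norm_mult)
      ultimately show ?thesis using R0 by simp
    qed
    have a_in: "path_image a \<subseteq> S"
    proof
      fix z assume "z \<in> path_image a"
      then have "Im z \<ge> 0" using a_pt by blast
      then show "z \<in> S" using \<delta> t by (simp add: S_def)
    qed
    have vp: "valid_path l" "valid_path a" by (simp_all add: l_def a_def)
    have join: "pathfinish l = pathstart a" "pathfinish a = pathstart l"
      by (simp_all add: l_def a_def exp_Euler flip: of_real_minus)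
    have ci: "q contour_integrable_on l" "q contour_integrable_on a"
      by (intro contour_integrable_holomorphic_simple[OF qh S(2)] vp l_in a_in)+
    have "(q has_contour_integral 0) (l +++ a)"
    proof (rule Cauchy_theorem_convex_simple[OF qh S(1)])
      show "valid_path (l +++ a)" by (rule valid_path_join[OF vp join(1)])
      show "path_image (l +++ a) \<subseteq> S" using l_in a_in path_image_join_subset[of l a] by blast
      show "pathfinish (l +++ a) = pathstart (l +++ a)" by (simp add: join)
    qed
    then have "contour_integral (l +++ a) q = 0" by (rule contour_integral_unique)
    then have sum: "contour_integral l q = - contour_integral a q"
      using contour_integral_join[OF ci vp] by (simp add: eq_neg_iff_add_eq_0)
    have "contour_integral l q = integral {- R..R} (\<lambda>x. q (of_real x))"
      using contour_integral_linepath_Reals_eq[of "complex_of_real (- R)" "complex_of_real R" q] R0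
      by (simp add: l_def)
    moreover have "cmod (contour_integral a q) \<le> 2 * B / (R - cmod t)\<^sup>2 * R * \<bar>pi - 0\<bar>"
      unfolding a_def
    proof (rule contour_integral_bound_part_circlepath)
      show "q contour_integrable_on part_circlepath 0 R 0 pi" using ci(2) by (simp add: a_def)
      fix z assume "z \<in> path_image (part_circlepath 0 R 0 pi)"
      then have z: "cmod z = R" "Im z \<ge> 0" using a_pt by (auto simp: a_def)
      have zt: "z \<noteq> t" using z(1) R by auto
      have "cmod (g z - g t) \<le> B + B"
        by (rule order_trans[OF norm_triangle_ineq4 add_mono]) (use z t in \<open>auto intro: bound\<close>)
      moreover have "(R - cmod t)\<^sup>2 \<le> cmod (z - t) * cmod (z - cnj t)"
      proof -
        have "R - cmod t \<le> cmod (z - t)" using norm_triangle_ineq2[of z t] z(1) by simp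
        moreover have "R - cmod t \<le> cmod (z - cnj t)" using norm_triangle_ineq2[of z "cnj t"] z(1) by simp
        ultimately show ?thesis using R unfolding power2_eq_square by (intro mult_mono) auto
      qed
      moreover have "0 < (R - cmod t)\<^sup>2" using R by simp
      ultimately have "cmod (g z - g t) / (cmod (z - t) * cmod (z - cnj t)) \<le> 2 * B / (R - cmod t)\<^sup>2"
        using B by (intro frac_le) auto
      then show "cmod (q z) \<le> 2 * B / (R - cmod t)\<^sup>2"
        using zt by (simp add: q_def norm_divide norm_mult)
    qed (use B R0 in auto)
    moreover have "cmod (contour_integral l q) = cmod (contour_integral a q)"
      unfolding sum by (rule norm_minus_cancel)
    ultimately show ?thesis by simp
  qed
  have lim1: "((\<lambda>n. integral {- real n..real n} (\<lambda>x. q (of_real x))) \<longlongrightarrow> 0) sequentially"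
  proof (rule Lim_null_comparison)
    show "\<forall>\<^sub>F n in sequentially. norm (integral {- real n..real n} (\<lambda>x. q (of_real x)))
        \<le> 2 * B / (real n - cmod t)\<^sup>2 * real n * pi"
    proof -
      obtain m :: nat where m: "cmod t < real m" using reals_Archimedean2 by blast
      show ?thesis
        using eventually_ge_at_top[of m] by eventually_elim (rule arc, use m in simp)
    qed
    show "(\<lambda>n. 2 * B / (real n - cmod t)\<^sup>2 * real n * pi) \<longlonglongrightarrow> 0"
      by real_asymp
  qed
  have lim2: "(\<lambda>n. integral {- real n..real n} (\<lambda>x. q (of_real x))) \<longlonglongrightarrow> (\<integral>x. q (of_real x) \<partial>lborel)"
  proof -
    have "(\<lambda>n. \<integral>x. indicator {- real n..real n} x *\<^sub>R q (of_real x) \<partial>lborel) \<longlonglongrightarrow> (\<integral>x. q (of_real x) \<partial>lborel)"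
      by (rule tendsto_integral_windows[OF qI]) auto
    moreover have "(\<integral>x. indicator {- real n..real n} x *\<^sub>R q (of_real x) \<partial>lborel)
        = integral {- real n..real n} (\<lambda>x. q (of_real x))" for n
    proof -
      have "set_integrable lborel {- real n..real n} (\<lambda>x. q (of_real x))"
        unfolding set_integrable_def by (rule integrable_mult_indicator[OF _ qI]) simp
      from set_borel_integral_eq_integral(2)[OF this] show ?thesis
        by (simp add: set_lebesgue_integral_def)
    qed
    ultimately show ?thesis by simp
  qed
  have "(\<integral>x. q (of_real x) \<partial>lborel) = 0" by (rule LIMSEQ_unique[OF lim2 lim1])
  then have "(\<integral>x. g (of_real x) * poisson t x \<partial>lborel) - (\<integral>x. g t * complex_of_real (poisson t x) \<partial>lborel) = 0"
    unfolding q_real left_diff_distrib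
    by (subst (asm) Bochner_Integration.integral_diff[OF gP integrable_mult_right[OF PI]]) simp
  moreover have "(\<integral>x. g t * complex_of_real (poisson t x) \<partial>lborel) = g t * (\<integral>x. poisson t x \<partial>lborel)"
    by (simp only: integral_mult_right_zero integral_complex_of_real)
  ultimately show ?thesis by simp
qed

text \<open>
  Convergence almost everywhere together with a bound in mean square gives convergence in the mean
  with respect to a bounded integrable weight: dominated convergence handles \<open>min (u n) K\<close>, and the
  part where \<open>u n\<close> exceeds \<open>K\<close> contributes at most \<open>M * C / K\<close>.
\<close>

lemma tendsto_weighted_mean:
  fixes u :: "nat \<Rightarrow> real \<Rightarrow> real"
  assumes [measurable]: "\<And>n. u n \<in> borel_measurable borel" "p \<in> borel_measurable borel"
    and nonneg: "\<And>n x. 0 \<le> u n x" "\<And>x. 0 \<le> p x"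
    and sq: "\<And>n. integrable lborel (\<lambda>x. (u n x)\<^sup>2)" "\<And>n. (\<integral>x. (u n x)\<^sup>2 \<partial>lborel) \<le> C"
    and p: "integrable lborel p" "\<And>x. p x \<le> M"
    and lim: "AE x in lborel. (\<lambda>n. u n x) \<longlonglongrightarrow> 0"
  shows "(\<lambda>n. \<integral>x. u n x * p x \<partial>lborel) \<longlonglongrightarrow> 0 \<and> (\<forall>n. integrable lborel (\<lambda>x. u n x * p x))"
proof -
  have M: "0 \<le> M" using nonneg(2) p(2) order_trans by blast
  have C: "0 \<le> C" using sq(2)[of 0] by (rule order_trans[OF Bochner_Integration.integral_nonneg, rotated]) simp
  have split: "u n x * p x \<le> min (u n x) K * p x + M / K * (u n x)\<^sup>2" if "K > 0" for n x K
  proof (cases "u n x \<le> K")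
    case True
    then show ?thesis using M that by simp
  next
    case False
    have "u n x * 1 \<le> u n x * (u n x / K)"
      using False that nonneg(1)[of n x] by (intro mult_left_mono) auto
    then have "u n x * p x \<le> ((u n x)\<^sup>2 / K) * M"
      using nonneg p(2)[of x] that by (intro mult_mono) (auto simp: power2_eq_square)
    moreover have "0 \<le> min (u n x) K * p x" using nonneg that by simp
    ultimately show ?thesis by (simp add: mult.commute)
  qed
  have i1: "integrable lborel (\<lambda>x. min (u n x) K * p x)" if "K > 0" for n K
  proof (rule Bochner_Integration.integrable_bound)
    show "integrable lborel (\<lambda>x. K * p x)" using p by simp
    show "AE x in lborel. norm (min (u n x) K * p x) \<le> norm (K * p x)"
      using nonneg that by (intro AE_I2) (auto simp: abs_mult intro!: mult_right_mono)
  qed measurable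
  have i2: "integrable lborel (\<lambda>x. M / K * (u n x)\<^sup>2)" for n K using sq by simp
  have int: "integrable lborel (\<lambda>x. u n x * p x)" for n
  proof (rule Bochner_Integration.integrable_bound[OF Bochner_Integration.integrable_add[OF i1[of 1] i2[of 1]]])
    show "AE x in lborel. norm (u n x * p x) \<le> norm (min (u n x) 1 * p x + M / 1 * (u n x)\<^sup>2)"
      using split[of 1] nonneg by (intro AE_I2) (auto intro: order_trans[OF _ abs_ge_self])
  qed (simp, measurable)
  have le: "(\<integral>x. u n x * p x \<partial>lborel) \<le> (\<integral>x. min (u n x) K * p x \<partial>lborel) + M * C / K" if K: "K > 0" for n K
  proof -
    have "(\<integral>x. u n x * p x \<partial>lborel) \<le> (\<integral>x. min (u n x) K * p x + M / K * (u n x)\<^sup>2 \<partial>lborel)"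
      by (rule Bochner_Integration.integral_mono[OF int Bochner_Integration.integrable_add[OF i1[OF K] i2]])
        (rule split[OF K])
    also have "\<dots> = (\<integral>x. min (u n x) K * p x \<partial>lborel) + M / K * (\<integral>x. (u n x)\<^sup>2 \<partial>lborel)"
      by (subst Bochner_Integration.integral_add[OF i1[OF K] i2]) simp
    also have "M / K * (\<integral>x. (u n x)\<^sup>2 \<partial>lborel) \<le> M / K * C"
      using M K by (intro mult_left_mono sq(2)) auto
    finally show ?thesis by simp
  qed
  have trunc: "(\<lambda>n. \<integral>x. min (u n x) K * p x \<partial>lborel) \<longlonglongrightarrow> 0" if K: "K > 0" for K
  proof -
    have "(\<lambda>n. \<integral>x. min (u n x) K * p x \<partial>lborel) \<longlonglongrightarrow> integral\<^sup>L lborel (\<lambda>x::real. 0)"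
    proof (rule integral_dominated_convergence[where w="\<lambda>x. K * p x"])
      show "integrable lborel (\<lambda>x. K * p x)" using p by simp
      show "AE x in lborel. (\<lambda>n. min (u n x) K * p x) \<longlonglongrightarrow> 0"
        using lim
      proof eventually_elim
        case (elim x)
        have "(\<lambda>n. min (u n x) K * p x) \<longlonglongrightarrow> min 0 K * p x" by (intro tendsto_intros elim)
        then show ?case using K by simp
      qed
      show "AE x in lborel. norm (min (u n x) K * p x) \<le> K * p x" for n
        using nonneg that by (intro AE_I2) (auto simp: abs_mult intro!: mult_right_mono)
    qed measurable
    then show ?thesis by simp
  qed
  have "(\<lambda>n. \<integral>x. u n x * p x \<partial>lborel) \<longlonglongrightarrow> 0"
  proof (rule LIMSEQ_I)
    fix r :: real assume r: "r > 0"
    define K where "K = 2 * (M * C + 1) / r"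
    have MC: "0 \<le> M * C" using M C by simp
    have K: "K > 0" using r MC by (simp add: K_def)
    have "M * C / K < r / 2"
    proof -
      have "M * C / K = r / 2 * (M * C / (M * C + 1))" using r MC by (simp add: K_def field_simps)
      also have "\<dots> < r / 2 * 1" using r MC by (intro mult_strict_left_mono) auto
      finally show ?thesis by simp
    qed
    have "\<forall>\<^sub>F n in sequentially. (\<integral>x. min (u n x) K * p x \<partial>lborel) < r / 2"
      by (rule order_tendstoD(2)[OF trunc[OF K]]) (use r in simp)
    then have ev: "\<forall>\<^sub>F n in sequentially. (\<integral>x. u n x * p x \<partial>lborel) < r"
    proof eventually_elim
      case (elim n)
      then show ?case using le[OF K, of n] \<open>M * C / K < r / 2\<close> by linarith
    qed
    have "0 \<le> (\<integral>x. u n x * p x \<partial>lborel)" for n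
      using nonneg by (intro Bochner_Integration.integral_nonneg) simp
    then show "\<exists>no. \<forall>n\<ge>no. norm ((\<integral>x. u n x * p x \<partial>lborel) - 0) < r"
      using ev by (simp add: eventually_sequentially)
  qed
  then show ?thesis using int by blast
qed

section \<open>The vector-valued Hardy space\<close>

lemma analytic_upper_holomorphic_cinner:
  fixes F :: "complex \<Rightarrow> 'h::complex_hilbert"
  assumes "analytic_upper F"
  shows "(\<lambda>z. cinner (F z) w) holomorphic_on {z. Im z > 0}"
  unfolding holomorphic_on_open[OF open_Im_greater]
proof (intro ballI)
  fix z :: complex assume "z \<in> {z. Im z > 0}"
  then obtain D where D: "(F has_derivative (\<lambda>h. h *\<^sub>C D)) (at z)"
    using assms unfolding analytic_upper_def by blast
  have "((\<lambda>z. cinner (F z) w) has_derivative (\<lambda>h. cinner (h *\<^sub>C D) w)) (at z)"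
    by (rule bounded_linear.has_derivative[OF bounded_linear_cinner_left D])
  then have "((\<lambda>z. cinner (F z) w) has_field_derivative cinner D w) (at z)"
    by (simp add: has_field_derivative_def cinner_scaleC_left mult_commute_abs)
  then show "\<exists>f'. ((\<lambda>z. cinner (F z) w) has_field_derivative f') (at z)" by blast
qed

lemma analytic_upper_isCont:
  assumes "analytic_upper F" "Im z > 0"
  shows "isCont F z"
  using assms has_derivative_continuous unfolding analytic_upper_def by blast

lemma analytic_upper_continuous_line:
  assumes "analytic_upper F" "y > 0"
  shows "continuous_on UNIV (\<lambda>x. F (Complex x y))"
proof -
  have "continuous_on {z. Im z > 0} F"
    using analytic_upper_isCont[OF assms(1)] by (intro continuous_at_imp_continuous_on) auto
  then show ?thesis
    by (rule continuous_on_compose2) (use assms(2) in \<open>auto intro!: continuous_intros simp: Complex_eq\<close>)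
qed

lemma hardy_function_iff:
  fixes F :: "complex \<Rightarrow> 'h::complex_normed_vector"
  shows "hardy_function F \<longleftrightarrow> analytic_upper F \<and>
    (\<exists>K. \<forall>y>0. square_integrable (\<lambda>x. F (Complex x y)) \<and> L2_norm (\<lambda>x. F (Complex x y)) \<le> K)"
proof
  assume "hardy_function F"
  then obtain C where F: "analytic_upper F"
    and C: "\<And>y. y > 0 \<Longrightarrow> integrable lborel (\<lambda>x. (norm (F (Complex x y)))\<^sup>2)"
      "\<And>y. y > 0 \<Longrightarrow> (\<integral>x. (norm (F (Complex x y)))\<^sup>2 \<partial>lborel) \<le> C"
    unfolding hardy_function_def by blast
  have "square_integrable (\<lambda>x. F (Complex x y)) \<and> L2_norm (\<lambda>x. F (Complex x y)) \<le> sqrt C" if "y > 0" for y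
    using C(1)[OF that] C(2)[OF that]
      continuous_imp_strongly_measurable[OF analytic_upper_continuous_line[OF F that]]
    by (simp add: square_integrable_def L2_norm_def)
  then show "analytic_upper F \<and>
    (\<exists>K. \<forall>y>0. square_integrable (\<lambda>x. F (Complex x y)) \<and> L2_norm (\<lambda>x. F (Complex x y)) \<le> K)"
    using F by blast
next
  assume "analytic_upper F \<and>
    (\<exists>K. \<forall>y>0. square_integrable (\<lambda>x. F (Complex x y)) \<and> L2_norm (\<lambda>x. F (Complex x y)) \<le> K)"
  then obtain K where F: "analytic_upper F"
    and K: "\<And>y. y > 0 \<Longrightarrow> square_integrable (\<lambda>x. F (Complex x y)) \<and> L2_norm (\<lambda>x. F (Complex x y)) \<le> K"
    by blast
  have "integrable lborel (\<lambda>x. (norm (F (Complex x y)))\<^sup>2) \<and>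
      (\<integral>x. (norm (F (Complex x y)))\<^sup>2 \<partial>lborel) \<le> K\<^sup>2" if "y > 0" for y
  proof -
    have "(L2_norm (\<lambda>x. F (Complex x y)))\<^sup>2 \<le> K\<^sup>2"
      using K[OF that] by (intro power_mono) (auto simp: L2_norm_nonneg)
    then show ?thesis using K[OF that] by (simp add: L2_norm_power2 square_integrable_def)
  qed
  then show "hardy_function F" using F unfolding hardy_function_def by blast
qed

lemma square_integrable_poisson:
  assumes "Im t > 0"
  shows "square_integrable (\<lambda>x. complex_of_real (poisson t x))"
proof -
  have "integrable lborel (\<lambda>x. 1 / (Im t)\<^sup>2 * poisson t x)"
    using integrable_poisson[OF assms] by simp
  then have "integrable lborel (\<lambda>x. (norm (complex_of_real (poisson t x)))\<^sup>2)"
  proof (rule Bochner_Integration.integrable_bound)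
    show "AE x in lborel. norm ((norm (complex_of_real (poisson t x)))\<^sup>2) \<le> norm (1 / (Im t)\<^sup>2 * poisson t x)"
    proof (rule AE_I2)
      fix x
      have "poisson t x * poisson t x \<le> 1 / (Im t)\<^sup>2 * poisson t x"
        using poisson_bounds[OF assms, of x] by (intro mult_right_mono) auto
      then show "norm ((norm (complex_of_real (poisson t x)))\<^sup>2) \<le> norm (1 / (Im t)\<^sup>2 * poisson t x)"
        using poisson_bounds(1)[OF assms, of x] by (simp add: power2_eq_square abs_of_pos)
    qed
  qed measurable
  then show ?thesis by (simp add: square_integrable_def strongly_measurable_iff_borel)
qed

text \<open>
  The functions \<open>z \<mapsto> \<langle>F (z + \<i> \<epsilon>), w\<rangle>\<close> are bounded and analytic beyond the real axis, so that the
  Poisson formula holds for them. As \<open>\<epsilon>\<close> tends to \<open>0\<close> their restrictions to the real axis stay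
  bounded in mean square and converge almost everywhere, hence in the mean for the Poisson weight.
\<close>

lemma hardy_poisson_formula:
  fixes F :: "complex \<Rightarrow> 'h::complex_hilbert"
  assumes F: "hardy_function F" and bv: "has_boundary_values F f" and t: "Im t > 0"
  shows "cinner (F t) w * (\<integral>x. poisson t x \<partial>lborel)
    = (\<integral>x. cinner (rep_L2R f x) w * poisson t x \<partial>lborel)"
proof -
  have an: "analytic_upper F" using F by (simp add: hardy_function_def)
  obtain K where sqF: "\<And>y. y > 0 \<Longrightarrow> square_integrable (\<lambda>x. F (Complex x y))"
    and K: "\<And>y. y > 0 \<Longrightarrow> L2_norm (\<lambda>x. F (Complex x y)) \<le> K"
    using F unfolding hardy_function_iff by blast
  have K0: "0 \<le> K" by (rule order_trans[OF L2_norm_nonneg K[OF zero_less_one]])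
  define \<phi> where "\<phi> z = cinner (F z) w" for z
  have hol: "\<phi> holomorphic_on {z. Im z > 0}"
    unfolding \<phi>_def[abs_def] by (rule analytic_upper_holomorphic_cinner[OF an])
  have pair_sq: "square_integrable (\<lambda>x. cinner (h x) w)" if "square_integrable h" for h :: "real \<Rightarrow> 'h"
  proof (rule square_integrable_bound[OF _ that])
    show "strongly_measurable (\<lambda>x. cinner (h x) w)"
      unfolding strongly_measurable_iff_borel
      by (rule borel_measurable_cinner[OF strongly_measurable_square_integrable[OF that] strongly_measurable_const])
    show "norm (cinner (h x) w) \<le> norm w * norm (h x)" for x
      using cinner_Cauchy_Schwarz[of "h x" w] by (simp add: mult.commute)
  qed
  have \<phi>_sq: "square_integrable (\<lambda>x. \<phi> (Complex x y))" if "y > 0" for y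
    unfolding \<phi>_def by (rule pair_sq[OF sqF[OF that]])
  have \<phi>_L2: "L2_norm (\<lambda>x. \<phi> (Complex x y)) \<le> K * norm w" if y: "y > 0" for y
  proof -
    have "(\<integral>x. (cmod (\<phi> (Complex x y)))\<^sup>2 \<partial>lborel) \<le> (\<integral>x. (norm w)\<^sup>2 * (norm (F (Complex x y)))\<^sup>2 \<partial>lborel)"
    proof (rule Bochner_Integration.integral_mono)
      show "integrable lborel (\<lambda>x. (cmod (\<phi> (Complex x y)))\<^sup>2)"
        "integrable lborel (\<lambda>x. (norm w)\<^sup>2 * (norm (F (Complex x y)))\<^sup>2)"
        using \<phi>_sq[OF y] sqF[OF y] by (auto simp: square_integrable_def)
      show "(cmod (\<phi> (Complex x y)))\<^sup>2 \<le> (norm w)\<^sup>2 * (norm (F (Complex x y)))\<^sup>2" for x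
        unfolding \<phi>_def power_mult_distrib[symmetric]
        using cinner_Cauchy_Schwarz[of "F (Complex x y)" w] by (intro power_mono) (auto simp: mult.commute)
    qed
    also have "\<dots> = (norm w)\<^sup>2 * (L2_norm (\<lambda>x. F (Complex x y)))\<^sup>2" by (simp add: L2_norm_power2)
    also have "\<dots> \<le> (norm w)\<^sup>2 * K\<^sup>2"
      by (intro mult_left_mono power_mono K y L2_norm_nonneg) simp
    also have "\<dots> = (K * norm w)\<^sup>2" by (simp add: power_mult_distrib)
    finally show ?thesis using K0 unfolding L2_norm_def by (intro real_le_lsqrt) auto
  qed
  define \<epsilon> where "\<epsilon> n = inverse (real (Suc n))" for n
  have \<epsilon>: "\<epsilon> n > 0" for n by (simp add: \<epsilon>_def)
  have \<epsilon>_lim: "\<epsilon> \<longlonglongrightarrow> 0" unfolding \<epsilon>_def[abs_def] by (rule LIMSEQ_inverse_real_of_nat)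
  define g where "g n z = \<phi> (z + Complex 0 (\<epsilon> n))" for n z
  have g_real: "g n (of_real x) = \<phi> (Complex x (\<epsilon> n))" for n x
  proof -
    have "of_real x + Complex 0 (\<epsilon> n) = Complex x (\<epsilon> n)" by (simp add: complex_eq_iff)
    then show ?thesis by (simp add: g_def)
  qed
  define P where "P = poisson t"
  define \<psi> where "\<psi> x = cinner (rep_L2R f x) w" for x
  have \<psi>_sq: "square_integrable \<psi>"
    unfolding \<psi>_def[abs_def] by (rule pair_sq[OF square_integrable_rep])
  have formula: "g n t * (\<integral>x. P x \<partial>lborel) = (\<integral>x. g n (of_real x) * P x \<partial>lborel)" for n
    unfolding P_def
  proof (rule poisson_formula[OF _ \<epsilon>[of n] _ t])
    show "g n holomorphic_on {z. Im z > - \<epsilon> n}"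
      unfolding g_def[abs_def]
      by (rule holomorphic_on_compose_gen[OF _ hol, unfolded comp_def]) (auto intro!: holomorphic_intros)
    define C where "C = (K * norm w)\<^sup>2"
    have C: "(\<integral>x. (cmod (\<phi> (Complex x y)))\<^sup>2 \<partial>lborel) \<le> C" if "y > 0" for y
      using power_mono[OF \<phi>_L2[OF that] L2_norm_nonneg, of 2] by (simp add: L2_norm_power2 C_def)
    show "cmod (g n z) \<le> (C + 1) * (1 + 2 / \<epsilon> n)" if z: "Im z \<ge> 0" for z
    proof -
      have y: "Im (z + Complex 0 (\<epsilon> n)) \<ge> \<epsilon> n" using z by simp
      have "cmod (g n z) \<le> (C + 1) * (1 + 2 / Im (z + Complex 0 (\<epsilon> n)))"
        unfolding g_def
      proof (rule hardy_interior_bound[OF hol _ C])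
        show "integrable lborel (\<lambda>x. (cmod (\<phi> (Complex x y)))\<^sup>2)" if "y > 0" for y
          using \<phi>_sq[OF that] by (simp add: square_integrable_def)
        show "Im (z + Complex 0 (\<epsilon> n)) > 0" using y \<epsilon>[of n] by linarith
      qed
      also have "\<dots> \<le> (C + 1) * (1 + 2 / \<epsilon> n)"
        using y \<epsilon>[of n] by (intro mult_left_mono add_left_mono divide_left_mono) (auto simp: C_def)
      finally show ?thesis .
    qed
  qed
  define u where "u n x = cmod (g n (of_real x) - \<psi> x)" for n x
  have d_sq: "square_integrable (\<lambda>x. g n (of_real x) - \<psi> x)" for n
    unfolding g_real by (rule square_integrable_diff[OF \<phi>_sq[OF \<epsilon>] \<psi>_sq])
  have u_meas: "u n \<in> borel_measurable borel" for n
    using measurable_norm_strongly_measurable[OF strongly_measurable_square_integrable[OF d_sq]]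
    by (simp add: u_def[abs_def])
  have u_lim: "AE x in lborel. (\<lambda>n. u n x) \<longlonglongrightarrow> 0"
    using bv unfolding has_boundary_values_def
  proof eventually_elim
    case (elim x)
    have "filterlim \<epsilon> (at_right 0) sequentially"
      unfolding filterlim_at using \<epsilon>_lim \<epsilon> by (auto intro!: always_eventually simp: less_imp_neq[THEN not_sym])
    from filterlim_compose[OF elim this] have "(\<lambda>n. F (Complex x (\<epsilon> n))) \<longlonglongrightarrow> rep_L2R f x" .
    then have "(\<lambda>n. cmod (cinner (F (Complex x (\<epsilon> n))) w - cinner (rep_L2R f x) w)) \<longlonglongrightarrow>
        cmod (cinner (rep_L2R f x) w - cinner (rep_L2R f x) w)"
      by (intro tendsto_intros tendsto_cinner)
    then show ?case by (simp add: u_def g_real \<phi>_def \<psi>_def)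
  qed
  have "(\<lambda>n. \<integral>x. u n x * P x \<partial>lborel) \<longlonglongrightarrow> 0 \<and> (\<forall>n. integrable lborel (\<lambda>x. u n x * P x))"
  proof (rule tendsto_weighted_mean[OF u_meas _ _ _ _ _ _ _ u_lim])
    show "P \<in> borel_measurable borel" by (simp add: P_def)
    show "0 \<le> P x" "P x \<le> 1 / (Im t)\<^sup>2" for x
      using poisson_bounds[OF t, of x] by (simp_all add: P_def)
    show "integrable lborel P" unfolding P_def by (rule integrable_poisson[OF t])
    show "integrable lborel (\<lambda>x. (u n x)\<^sup>2)" for n
      using d_sq[of n] by (simp add: square_integrable_def u_def)
    show "(\<integral>x. (u n x)\<^sup>2 \<partial>lborel) \<le> (K * norm w + L2_norm \<psi>)\<^sup>2" for n
    proof -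
      have "L2_norm (\<lambda>x. g n (of_real x) - \<psi> x) \<le> L2_norm (\<lambda>x. g n (of_real x)) + L2_norm (\<lambda>x. - \<psi> x)"
        using L2_norm_triangle[OF \<phi>_sq[OF \<epsilon>] square_integrable_uminus[OF \<psi>_sq], of n] by (simp add: g_real)
      also have "L2_norm (\<lambda>x. g n (of_real x)) \<le> K * norm w" unfolding g_real by (rule \<phi>_L2[OF \<epsilon>])
      also have "L2_norm (\<lambda>x. - \<psi> x) = L2_norm \<psi>" by (simp add: L2_norm_def)
      finally have "L2_norm (\<lambda>x. g n (of_real x) - \<psi> x) \<le> K * norm w + L2_norm \<psi>" by simp
      then have "(L2_norm (\<lambda>x. g n (of_real x) - \<psi> x))\<^sup>2 \<le> (K * norm w + L2_norm \<psi>)\<^sup>2"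
        by (intro power_mono L2_norm_nonneg)
      then show ?thesis by (simp add: L2_norm_power2 u_def)
    qed
  qed (simp_all add: u_def)
  then have uP: "(\<lambda>n. \<integral>x. u n x * P x \<partial>lborel) \<longlonglongrightarrow> 0" "\<And>n. integrable lborel (\<lambda>x. u n x * P x)"
    by auto
  have P_pos: "0 \<le> P x" for x using poisson_bounds(1)[OF t, of x] by (simp add: P_def)
  have int_P: "integrable lborel (\<lambda>x. h x * P x)" if "square_integrable h" for h :: "real \<Rightarrow> complex"
    using integrable_cinner[OF that square_integrable_poisson[OF t]] by (simp add: cinner_complex_def P_def)
  have "(\<lambda>n. (\<integral>x. g n (of_real x) * P x \<partial>lborel) - (\<integral>x. \<psi> x * P x \<partial>lborel)) \<longlonglongrightarrow> 0"
  proof (rule Lim_null_comparison[OF always_eventually uP(1)], intro allI)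
    fix n
    have "(\<integral>x. g n (of_real x) * P x \<partial>lborel) - (\<integral>x. \<psi> x * P x \<partial>lborel) = (\<integral>x. (g n (of_real x) - \<psi> x) * P x \<partial>lborel)"
      using int_P[OF \<phi>_sq[OF \<epsilon>[of n]]] int_P[OF \<psi>_sq]
      by (simp add: g_real left_diff_distrib)
    also have "norm \<dots> \<le> (\<integral>x. norm ((g n (of_real x) - \<psi> x) * P x) \<partial>lborel)"
      by (rule integral_norm_bound)
    also have "\<dots> = (\<integral>x. u n x * P x \<partial>lborel)"
      using P_pos by (simp add: u_def norm_mult)
    finally show "norm ((\<integral>x. g n (of_real x) * P x \<partial>lborel) - (\<integral>x. \<psi> x * P x \<partial>lborel)) \<le> (\<integral>x. u n x * P x \<partial>lborel)" .
  qed
  then have lim1: "(\<lambda>n. g n t * (\<integral>x. P x \<partial>lborel)) \<longlonglongrightarrow> (\<integral>x. \<psi> x * P x \<partial>lborel)"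
    unfolding formula by (rule LIM_zero_cancel)
  have "isCont \<phi> t"
    unfolding \<phi>_def[abs_def]
    by (rule bounded_linear.isCont[OF bounded_linear_cinner_left analytic_upper_isCont[OF an t]])
  moreover have "(\<lambda>n. t + Complex 0 (\<epsilon> n)) \<longlonglongrightarrow> t"
  proof -
    have "(\<lambda>n. t + \<i> * of_real (\<epsilon> n)) \<longlonglongrightarrow> t + \<i> * of_real 0" by (intro tendsto_intros \<epsilon>_lim)
    then show ?thesis by (simp add: Complex_eq)
  qed
  ultimately have "(\<lambda>n. g n t) \<longlonglongrightarrow> \<phi> t"
    unfolding g_def by (rule isCont_tendsto_compose)
  then have "(\<lambda>n. g n t * (\<integral>x. P x \<partial>lborel)) \<longlonglongrightarrow> \<phi> t * (\<integral>x. P x \<partial>lborel)"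
    by (intro tendsto_intros)
  then have "\<phi> t * (\<integral>x. P x \<partial>lborel) = (\<integral>x. \<psi> x * P x \<partial>lborel)"
    using lim1 by (rule LIMSEQ_unique)
  then show ?thesis by (simp add: \<phi>_def \<psi>_def P_def)
qed

text \<open>
  The Poisson formula writes the value at \<open>t\<close> as a pairing of the boundary values with a fixed
  square-integrable function. In particular the boundary values determine the function.
\<close>

lemma hardy_evaluation_bound:
  assumes t: "Im t > 0"
  obtains K where "\<And>(F :: complex \<Rightarrow> 'h::complex_hilbert) f.
    hardy_function F \<Longrightarrow> has_boundary_values F f \<Longrightarrow> norm (F t) \<le> K * norm f"
proof -
  define I where "I = (\<integral>x. poisson t x \<partial>lborel)"
  have I: "I > 0" unfolding I_def by (rule integral_poisson_pos[OF t])
  define N where "N = L2_norm (\<lambda>x. complex_of_real (poisson t x))"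
  have N: "0 \<le> N" by (simp add: N_def L2_norm_nonneg)
  have "norm (F t) \<le> (N / I) * norm f"
    if F: "hardy_function F" "has_boundary_values F f" for F :: "complex \<Rightarrow> 'h" and f
  proof (rule norm_le_of_cinner_le)
    show "0 \<le> N / I * norm f" using N I by simp
    fix w :: 'h
    note sq = square_integrable_poisson[OF t]
    have "norm (tensor (\<lambda>x. complex_of_real (poisson t x)) w) = N * norm w"
    proof -
      have "norm (tensor (\<lambda>x. complex_of_real (poisson t x)) w) = L2_norm (\<lambda>x. complex_of_real (poisson t x) *\<^sub>C w)"
        unfolding tensor_def by (rule norm_L2R_abs[OF square_integrable_tensor[OF sq]])
      then show ?thesis by (simp add: L2_norm_def N_def norm_scaleC power_mult_distrib real_sqrt_mult)
    qed
    moreover have "cinner f (tensor (\<lambda>x. complex_of_real (poisson t x)) w) = cinner (F t) w * I"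
      using cinner_tensor_right[OF square_integrable_rep sq, of f w] hardy_poisson_formula[OF F t, of w]
      by (simp add: I_def mult.commute)
    ultimately have "cmod (cinner (F t) w * I) \<le> norm f * (N * norm w)"
      using cinner_Cauchy_Schwarz[of f "tensor (\<lambda>x. complex_of_real (poisson t x)) w"] by simp
    then show "cmod (cinner (F t) w) \<le> N / I * norm f * norm w"
      using I by (simp add: norm_mult field_simps)
  qed
  then show thesis by (rule that)
qed

section \<open>Operations on the Hardy space\<close>

lemma analytic_upper_scaleC_fun:
  fixes F :: "complex \<Rightarrow> 'h::complex_normed_vector"
  assumes F: "analytic_upper F" and m: "m holomorphic_on {z. Im z > 0}"
  shows "analytic_upper (\<lambda>z. m z *\<^sub>C F z)"
  unfolding analytic_upper_def
proof (intro allI impI)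
  fix z :: complex assume z: "Im z > 0"
  obtain D where D: "(F has_derivative (\<lambda>h. h *\<^sub>C D)) (at z)"
    using F z unfolding analytic_upper_def by blast
  obtain m' where m': "(m has_derivative (\<lambda>h. m' * h)) (at z)"
    using m z unfolding holomorphic_on_open[OF open_Im_greater] has_field_derivative_def by blast
  have "((\<lambda>z. m z *\<^sub>C F z) has_derivative (\<lambda>h. m z *\<^sub>C h *\<^sub>C D + (m' * h) *\<^sub>C F z)) (at z)"
    by (rule bounded_bilinear.FDERIV[OF bounded_bilinear_scaleC m' D])
  moreover have "m z *\<^sub>C h *\<^sub>C D + (m' * h) *\<^sub>C F z = h *\<^sub>C (m z *\<^sub>C D + m' *\<^sub>C F z)" for h
    by (simp add: scaleC_scaleC scaleC_add_right mult.commute)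
  ultimately show "\<exists>D. ((\<lambda>z. m z *\<^sub>C F z) has_derivative (\<lambda>h. h *\<^sub>C D)) (at z)"
    by (intro exI[of _ "m z *\<^sub>C D + m' *\<^sub>C F z"]) simp
qed

lemma L2_norm_mono:
  fixes f :: "real \<Rightarrow> 'a::real_normed_vector" and g :: "real \<Rightarrow> 'b::real_normed_vector"
  assumes "square_integrable f" "square_integrable g" "\<And>x. norm (f x) \<le> norm (g x)"
  shows "L2_norm f \<le> L2_norm g"
  unfolding L2_norm_def
  by (intro real_sqrt_le_mono Bochner_Integration.integral_mono power_mono)
    (use assms in \<open>auto simp: square_integrable_def\<close>)

lemma hardy_functionI:
  fixes F :: "complex \<Rightarrow> 'h::complex_normed_vector" and G :: "real \<Rightarrow> real \<Rightarrow> 'b::real_normed_vector"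
  assumes F: "analytic_upper F"
    and G: "\<And>y. y > 0 \<Longrightarrow> square_integrable (G y)" "\<And>y. y > 0 \<Longrightarrow> L2_norm (G y) \<le> K"
    and le: "\<And>x y. y > 0 \<Longrightarrow> norm (F (Complex x y)) \<le> norm (G y x)"
  shows "hardy_function F"
  unfolding hardy_function_iff
proof (intro conjI F exI[of _ K] allI impI)
  fix y :: real assume y: "y > 0"
  show sq: "square_integrable (\<lambda>x. F (Complex x y))"
    by (rule square_integrable_bound[OF continuous_imp_strongly_measurable[OF analytic_upper_continuous_line[OF F y]]
          G(1)[OF y], where K=1]) (simp add: le[OF y])
  show "L2_norm (\<lambda>x. F (Complex x y)) \<le> K"
    by (rule order_trans[OF L2_norm_mono[OF sq G(1)[OF y] le[OF y]] G(2)[OF y]])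
qed

lemma hardy_function_multiplier:
  fixes F :: "complex \<Rightarrow> 'h::complex_normed_vector"
  assumes F: "hardy_function F" and m: "m holomorphic_on {z. Im z > 0}"
    and B: "\<And>z. Im z > 0 \<Longrightarrow> cmod (m z) \<le> B"
  shows "hardy_function (\<lambda>z. m z *\<^sub>C F z)"
proof -
  obtain K where K: "\<And>y. y > 0 \<Longrightarrow> square_integrable (\<lambda>x. F (Complex x y))"
    "\<And>y. y > 0 \<Longrightarrow> L2_norm (\<lambda>x. F (Complex x y)) \<le> K"
    using F unfolding hardy_function_iff by blast
  have B0: "0 \<le> B" using B[of \<i>] order_trans[OF norm_ge_zero] by auto
  show ?thesis
  proof (rule hardy_functionI[where G="\<lambda>y x. of_real B *\<^sub>C F (Complex x y)" and K="B * K"])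
    show "analytic_upper (\<lambda>z. m z *\<^sub>C F z)"
      using F m by (intro analytic_upper_scaleC_fun) (auto simp: hardy_function_def)
    fix y :: real assume y: "y > 0"
    show "square_integrable (\<lambda>x. of_real B *\<^sub>C F (Complex x y))" by (rule square_integrable_scaleC[OF K(1)[OF y]])
    show "L2_norm (\<lambda>x. of_real B *\<^sub>C F (Complex x y)) \<le> B * K"
      using B0 K(2)[OF y] by (simp add: L2_norm_scaleC mult_left_mono)
    show "norm (m (Complex x y) *\<^sub>C F (Complex x y)) \<le> norm (of_real B *\<^sub>C F (Complex x y))" for x
      using B[of "Complex x y"] B0 y by (simp add: norm_scaleC mult_right_mono)
  qed
qed

lemma hardy_function_add:
  fixes F G :: "complex \<Rightarrow> 'h::complex_normed_vector"
  assumes F: "hardy_function F" and G: "hardy_function G"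
  shows "hardy_function (\<lambda>z. F z + G z)"
  unfolding hardy_function_iff
proof
  show "analytic_upper (\<lambda>z. F z + G z)"
    unfolding analytic_upper_def
  proof (intro allI impI)
    fix z :: complex assume z: "Im z > 0"
    obtain D E where "(F has_derivative (\<lambda>h. h *\<^sub>C D)) (at z)" "(G has_derivative (\<lambda>h. h *\<^sub>C E)) (at z)"
      using F G z unfolding hardy_function_def analytic_upper_def by blast
    then have "((\<lambda>z. F z + G z) has_derivative (\<lambda>h. h *\<^sub>C (D + E))) (at z)"
      by (auto simp: scaleC_add_right intro: has_derivative_add)
    then show "\<exists>D. ((\<lambda>z. F z + G z) has_derivative (\<lambda>h. h *\<^sub>C D)) (at z)" by blast
  qed
  obtain K where K: "\<And>y. y > 0 \<Longrightarrow> square_integrable (\<lambda>x. F (Complex x y))"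
    "\<And>y. y > 0 \<Longrightarrow> L2_norm (\<lambda>x. F (Complex x y)) \<le> K"
    using F unfolding hardy_function_iff by blast
  obtain L where L: "\<And>y. y > 0 \<Longrightarrow> square_integrable (\<lambda>x. G (Complex x y))"
    "\<And>y. y > 0 \<Longrightarrow> L2_norm (\<lambda>x. G (Complex x y)) \<le> L"
    using G unfolding hardy_function_iff by blast
  have "square_integrable (\<lambda>x. F (Complex x y) + G (Complex x y)) \<and>
      L2_norm (\<lambda>x. F (Complex x y) + G (Complex x y)) \<le> K + L" if y: "y > 0" for y
    using square_integrable_add[OF K(1)[OF y] L(1)[OF y]] L2_norm_triangle[OF K(1)[OF y] L(1)[OF y]]
      K(2)[OF y] L(2)[OF y] by linarith
  then show "\<exists>M. \<forall>y>0. square_integrable (\<lambda>x. F (Complex x y) + G (Complex x y)) \<and>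
      L2_norm (\<lambda>x. F (Complex x y) + G (Complex x y)) \<le> M" by blast
qed

lemma hardy_function_scaleC:
  fixes F :: "complex \<Rightarrow> 'h::complex_normed_vector"
  assumes "hardy_function F"
  shows "hardy_function (\<lambda>z. c *\<^sub>C F z)"
  using hardy_function_multiplier[OF assms, of "\<lambda>z. c" "cmod c"] by simp

lemma has_boundary_values_add:
  assumes "has_boundary_values F f" "has_boundary_values G g"
  shows "has_boundary_values (\<lambda>z. F z + G z) (f + g)"
  using assms rep_add_L2R[of f g] unfolding has_boundary_values_def
  by eventually_elim (auto intro: tendsto_add)

lemma has_boundary_values_multiplier:
  fixes F :: "complex \<Rightarrow> 'h::complex_normed_vector"
  assumes F: "has_boundary_values F f"
    and m: "\<And>x. isCont m (of_real x)"
    and g: "AE x in lborel. rep_L2R g x = m (of_real x) *\<^sub>C rep_L2R f x"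
  shows "has_boundary_values (\<lambda>z. m z *\<^sub>C F z) g"
  using F g unfolding has_boundary_values_def
proof eventually_elim
  case (elim x)
  have "((\<lambda>y. of_real x + \<i> * of_real y) \<longlongrightarrow> of_real x + \<i> * of_real 0) (at_right (0::real))"
    by (intro tendsto_intros)
  then have "((\<lambda>y. Complex x y) \<longlongrightarrow> of_real x) (at_right 0)" by (simp add: Complex_eq)
  then have "((\<lambda>y. m (Complex x y)) \<longlongrightarrow> m (of_real x)) (at_right 0)"
    by (rule isCont_tendsto_compose[OF m])
  then show ?case unfolding elim(2) using elim(1) by (rule tendsto_scaleC)
qed

lemma has_boundary_values_scaleC:
  fixes F :: "complex \<Rightarrow> 'h::complex_normed_vector"
  assumes "has_boundary_values F f"
  shows "has_boundary_values (\<lambda>z. c *\<^sub>C F z) (c *\<^sub>C f)"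
  by (rule has_boundary_values_multiplier[OF assms _ rep_scaleC_L2R]) simp

lemma hardy_ext_properties:
  assumes "f \<in> hardy2"
  shows "hardy_function (hardy_ext f)" "has_boundary_values (hardy_ext f) f"
  using someI_ex[of "\<lambda>F. hardy_function F \<and> has_boundary_values F f"] assms
  unfolding hardy_ext_def hardy2_def by blast+

lemma hardy_ext_add_scaleC:
  fixes F G :: "complex \<Rightarrow> 'h::complex_hilbert"
  assumes F: "hardy_function F" "has_boundary_values F f"
    and G: "hardy_function G" "has_boundary_values G g"
  shows "hardy_function (\<lambda>z. F z + c *\<^sub>C G z)" "has_boundary_values (\<lambda>z. F z + c *\<^sub>C G z) (f + c *\<^sub>C g)"
  by (intro hardy_function_add F hardy_function_scaleC G has_boundary_values_add has_boundary_values_scaleC)+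

lemma hardy_function_unique:
  fixes F G :: "complex \<Rightarrow> 'h::complex_hilbert"
  assumes F: "hardy_function F" "has_boundary_values F f"
    and G: "hardy_function G" "has_boundary_values G f" and t: "Im t > 0"
  shows "F t = G t"
proof -
  obtain K where K: "\<And>(F :: complex \<Rightarrow> 'h) f. hardy_function F \<Longrightarrow> has_boundary_values F f \<Longrightarrow> norm (F t) \<le> K * norm f"
    using hardy_evaluation_bound[OF t] by blast
  have "norm (F t + (-1) *\<^sub>C G t) \<le> K * norm (f + (-1) *\<^sub>C f)"
    by (rule K[OF hardy_ext_add_scaleC[OF F G]])
  then show ?thesis by (simp add: scaleC_minus_one)
qed

lemma hardy_ext_eq:
  fixes F :: "complex \<Rightarrow> 'h::complex_hilbert"
  assumes F: "hardy_function F" "has_boundary_values F f"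
  shows "f \<in> hardy2" "Im t > 0 \<Longrightarrow> hardy_ext f t = F t"
proof -
  show f: "f \<in> hardy2" using F unfolding hardy2_def by blast
  show "Im t > 0 \<Longrightarrow> hardy_ext f t = F t"
    by (rule hardy_function_unique[OF hardy_ext_properties[OF f] F])
qed

lemma hardy2_add_scaleC:
  assumes f: "f \<in> hardy2" and g: "g \<in> hardy2"
  shows "f + c *\<^sub>C g \<in> hardy2"
    "Im t > 0 \<Longrightarrow> hardy_ext (f + c *\<^sub>C g) t = hardy_ext f t + c *\<^sub>C hardy_ext g t"
  using hardy_ext_eq[OF hardy_ext_add_scaleC[OF hardy_ext_properties[OF f] hardy_ext_properties[OF g]]]
  by auto

lemma hardy2_modulate:
  fixes f :: "'h::complex_hilbert L2R"
  assumes f: "f \<in> hardy2" and h: "h \<ge> 0"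
  shows "modulate h f \<in> hardy2"
    "Im t > 0 \<Longrightarrow> hardy_ext (modulate h f) t = exp (\<i> * h * t) *\<^sub>C hardy_ext f t"
proof -
  note F = hardy_ext_properties[OF f]
  have 1: "hardy_function (\<lambda>z. exp (\<i> * of_real h * z) *\<^sub>C hardy_ext f z)"
  proof (rule hardy_function_multiplier[OF F(1), where B=1])
    show "cmod (exp (\<i> * of_real h * z)) \<le> 1" if "Im z > 0" for z
      using that h by simp
  qed (intro holomorphic_intros)
  have "AE x in lborel. rep_L2R (modulate h f) x = iexp (h * x) *\<^sub>C rep_L2R f x"
    unfolding modulate_def by (rule rep_abs_L2R[OF square_integrable_iexp[OF square_integrable_rep]])
  then have "AE x in lborel. rep_L2R (modulate h f) x = exp (\<i> * of_real h * of_real x) *\<^sub>C rep_L2R f x"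
    by (simp add: mult.assoc)
  then have 2: "has_boundary_values (\<lambda>z. exp (\<i> * of_real h * z) *\<^sub>C hardy_ext f z) (modulate h f)"
    by (intro has_boundary_values_multiplier[OF F(2)]) (auto intro!: continuous_intros)
  show "modulate h f \<in> hardy2"
    "Im t > 0 \<Longrightarrow> hardy_ext (modulate h f) t = exp (\<i> * h * t) *\<^sub>C hardy_ext f t"
    by (rule hardy_ext_eq[OF 1 2])+
qed

text \<open>
  Division by \<open>z - t\<close> at a zero \<open>t\<close>. Near \<open>t\<close> the quotient is continuous and weakly analytic,
  hence analytic and bounded; away from \<open>t\<close> the factor \<open>1 / (z - t)\<close> is bounded.
\<close>

lemma hardy_function_divide:
  fixes F :: "complex \<Rightarrow> 'h::complex_hilbert"
  assumes F: "hardy_function F" and t: "Im t > 0" and zero: "F t = 0"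
  obtains D where "hardy_function (\<lambda>z. if z = t then D else inverse (z - t) *\<^sub>C F z)"
proof -
  have an: "analytic_upper F" using F by (simp add: hardy_function_def)
  obtain D where D: "(F has_derivative (\<lambda>h. h *\<^sub>C D)) (at t)"
    using an t unfolding analytic_upper_def by blast
  define G where "G z = (if z = t then D else inverse (z - t) *\<^sub>C F z)" for z
  obtain d where d: "d > 0" and dF: "\<And>z. norm (z - t) < d \<Longrightarrow> norm (F z - F t - (z - t) *\<^sub>C D) \<le> 1 * norm (z - t)"
    using D zero_less_one unfolding has_derivative_at_alt by blast
  define L where "L = norm D + 1"
  have L: "0 \<le> L" by (simp add: L_def)
  have G_near: "norm (G z) \<le> L" if z: "norm (z - t) < d" for z
  proof (cases "z = t")
    case False
    have "norm (F z) \<le> norm (F z - (z - t) *\<^sub>C D) + norm ((z - t) *\<^sub>C D)"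
      using norm_triangle_ineq[of "F z - (z - t) *\<^sub>C D" "(z - t) *\<^sub>C D"] by simp
    also have "\<dots> \<le> L * norm (z - t)"
      using dF[OF z] zero by (simp add: norm_scaleC L_def algebra_simps)
    finally show ?thesis using False
      by (simp add: G_def norm_scaleC norm_inverse divide_le_eq flip: divide_inverse_commute)
  qed (simp add: G_def L_def)
  define r where "r = min d (Im t)"
  have r: "r > 0" using d t by (simp add: r_def)
  have ball_H: "ball t r \<subseteq> {z. Im z > 0}"
  proof
    fix z assume "z \<in> ball t r"
    then have "cmod (t - z) < Im t" by (simp add: r_def dist_norm)
    then have "Im (t - z) < Im t" by (rule le_less_trans[OF order_trans[OF abs_ge_self abs_Im_le_cmod]])
    then show "z \<in> {z. Im z > 0}" by simp
  qed
  have "analytic_upper G"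
    unfolding analytic_upper_def
  proof (intro allI impI)
    fix z :: complex assume z: "Im z > 0"
    show "\<exists>D. (G has_derivative (\<lambda>h. h *\<^sub>C D)) (at z)"
    proof (cases "z = t")
      case True
      have "\<exists>D. (G has_derivative (\<lambda>h. h *\<^sub>C D)) (at t)"
      proof (rule weakly_holomorphic_imp_derivative[OF _ r])
        show "norm (G z) \<le> L" if "z \<in> ball t r" for z
          using that by (intro G_near) (simp add: r_def dist_norm norm_minus_commute)
        fix w
        define \<phi> where "\<phi> z = cinner (F z) w" for z
        have hol: "\<phi> holomorphic_on ball t r"
          unfolding \<phi>_def[abs_def]
          by (rule holomorphic_on_subset[OF analytic_upper_holomorphic_cinner[OF an] ball_H])
        have "((\<lambda>z. cinner (F z) w) has_derivative (\<lambda>h. cinner (h *\<^sub>C D) w)) (at t)"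
          by (rule bounded_linear.has_derivative[OF bounded_linear_cinner_left D])
        then have "(\<phi> has_field_derivative cinner D w) (at t)"
          by (simp add: \<phi>_def[abs_def] has_field_derivative_def cinner_scaleC_left mult_commute_abs)
        then have "deriv \<phi> t = cinner D w" by (rule DERIV_imp_deriv)
        then have "(\<lambda>z. cinner (G z) w) = (\<lambda>z. if z = t then deriv \<phi> t else (\<phi> z - \<phi> t) / (z - t))"
          using zero by (auto simp: G_def \<phi>_def cinner_scaleC_left divide_inverse mult.commute)
        then show "(\<lambda>z. cinner (G z) w) holomorphic_on ball t r"
          using pole_lemma_open[OF hol open_ball, of t] by simp
      qed
      then show ?thesis using True by simp
    next
      case False
      obtain E where E: "(F has_derivative (\<lambda>h. h *\<^sub>C E)) (at z)"
        using an z unfolding analytic_upper_def by blast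
      have "((\<lambda>z. inverse (z - t)) has_field_derivative - inverse ((z - t)\<^sup>2)) (at z)"
        using False by (auto intro!: derivative_eq_intros simp: power2_eq_square)
      then have "((\<lambda>z. inverse (z - t)) has_derivative (\<lambda>h. - inverse ((z - t)\<^sup>2) * h)) (at z)"
        unfolding has_field_derivative_def .
      from bounded_bilinear.FDERIV[OF bounded_bilinear_scaleC this E]
      have "((\<lambda>z. inverse (z - t) *\<^sub>C F z) has_derivative
          (\<lambda>h. inverse (z - t) *\<^sub>C h *\<^sub>C E + (- inverse ((z - t)\<^sup>2) * h) *\<^sub>C F z)) (at z)" .
      moreover have "inverse (z - t) *\<^sub>C h *\<^sub>C E + (- inverse ((z - t)\<^sup>2) * h) *\<^sub>C F z
          = h *\<^sub>C (inverse (z - t) *\<^sub>C E + (- inverse ((z - t)\<^sup>2)) *\<^sub>C F z)" for h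
        by (simp add: scaleC_scaleC scaleC_add_right mult.commute)
      ultimately have "((\<lambda>z. inverse (z - t) *\<^sub>C F z) has_derivative
          (\<lambda>h. h *\<^sub>C (inverse (z - t) *\<^sub>C E + (- inverse ((z - t)\<^sup>2)) *\<^sub>C F z))) (at z)"
        by simp
      then have "(G has_derivative (\<lambda>h. h *\<^sub>C (inverse (z - t) *\<^sub>C E + (- inverse ((z - t)\<^sup>2)) *\<^sub>C F z))) (at z)"
        by (rule has_derivative_transform_within_open[where s="- {t}"]) (use False in \<open>auto simp: G_def\<close>)
      then show ?thesis by blast
    qed
  qed
  obtain K where K: "\<And>y. y > 0 \<Longrightarrow> square_integrable (\<lambda>x. F (Complex x y))"
    "\<And>y. y > 0 \<Longrightarrow> L2_norm (\<lambda>x. F (Complex x y)) \<le> K"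
    using F unfolding hardy_function_iff by blast
  define J where "J = {Re t - d<..Re t + d}"
  define b where "b x = of_real L * (indicator J x :: complex)" for x
  have b: "square_integrable b"
    unfolding b_def[abs_def] J_def
    using square_integrable_scaleC[OF square_integrable_Ioc, of "of_real L"] by (simp add: scaleC_complex_def)
  define M where "M y x = norm (inverse d *\<^sub>R F (Complex x y)) + norm (b x)" for y x
  have norm_sq: "square_integrable (\<lambda>x. norm (f x))" if "square_integrable f" for f :: "real \<Rightarrow> 'c::real_normed_vector"
    using that measurable_norm_strongly_measurable[OF strongly_measurable_square_integrable[OF that]]
    by (simp add: square_integrable_def strongly_measurable_iff_borel)
  have "hardy_function G"
  proof (rule hardy_functionI[OF \<open>analytic_upper G\<close>, where G=M and K="inverse d * K + L2_norm b"])
    fix y :: real assume y: "y > 0"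
    have s: "square_integrable (\<lambda>x. inverse d *\<^sub>R F (Complex x y))"
      by (rule square_integrable_scaleR[OF K(1)[OF y]])
    show "square_integrable (M y)"
      unfolding M_def[abs_def] by (rule square_integrable_add[OF norm_sq[OF s] norm_sq[OF b]])
    have "L2_norm (M y) \<le> L2_norm (\<lambda>x. norm (inverse d *\<^sub>R F (Complex x y))) + L2_norm (\<lambda>x. norm (b x))"
      unfolding M_def[abs_def] by (rule L2_norm_triangle[OF norm_sq[OF s] norm_sq[OF b]])
    also have "L2_norm (\<lambda>x. norm (inverse d *\<^sub>R F (Complex x y))) = inverse d * L2_norm (\<lambda>x. F (Complex x y))"
      using d by (simp add: L2_norm_def power_mult_distrib real_sqrt_mult)
    also have "\<dots> \<le> inverse d * K" using d K(2)[OF y] by (intro mult_left_mono) auto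
    also have "L2_norm (\<lambda>x. norm (b x)) = L2_norm b" by (simp add: L2_norm_def)
    finally show "L2_norm (M y) \<le> inverse d * K + L2_norm b" by simp
    fix x
    have Mnn: "norm (M y x) = norm (inverse d *\<^sub>R F (Complex x y)) + norm (b x)" by (simp add: M_def)
    show "norm (G (Complex x y)) \<le> norm (M y x)"
    proof (cases "cmod (Complex x y - t) < d")
      case True
      have "\<bar>Re (Complex x y - t)\<bar> < d" by (rule le_less_trans[OF abs_Re_le_cmod True])
      then have "x \<in> J" by (auto simp: J_def)
      then have "norm (b x) = L" using L by (simp add: b_def norm_mult)
      then show ?thesis using G_near[OF True] unfolding Mnn by (simp add: add_increasing)
    next
      case False
      then have "Complex x y \<noteq> t" using d by auto
      then have "norm (G (Complex x y)) = inverse (cmod (Complex x y - t)) * norm (F (Complex x y))"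
        by (simp add: G_def norm_scaleC norm_inverse)
      also have "\<dots> \<le> inverse d * norm (F (Complex x y))"
        using False d by (intro mult_right_mono le_imp_inverse_le) auto
      finally show ?thesis unfolding Mnn using d by (simp add: add_increasing2)
    qed
  qed
  then show thesis using that[of D] by (simp add: G_def[abs_def])
qed

section \<open>Reproducing kernels and the multiplier\<close>

lemma cmod_one_minus_exp_le:
  assumes "Re w \<le> c" "0 \<le> c"
  shows "cmod (1 - exp w) \<le> exp c * cmod w"
proof -
  have "cmod (exp w - exp 0) \<le> exp c * cmod (w - 0)"
  proof (rule field_differentiable_bound[where S="{z. Re z \<le> c}" and f'=exp])
    show "convex {z. Re z \<le> c}" by (rule convex_halfspace_Re_le)
    show "(exp has_field_derivative exp z) (at z within {z. Re z \<le> c})" for z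
      by (rule DERIV_subset[OF DERIV_exp]) simp
  qed (use assms in auto)
  then show ?thesis by (simp add: norm_minus_commute)
qed

text \<open>
  An element of the Hardy space that vanishes at \<open>t\<close> is a limit of elements
  \<open>(g - exp (- \<i> h t) * (exp (\<i> h _) g)) / (- \<i> h)\<close> with \<open>g\<close> in the Hardy space: take for \<open>g\<close> the
  quotient by \<open>z - t\<close> and use that \<open>(1 - exp (\<i> h (z - t))) / (- \<i> h)\<close> tends to \<open>z - t\<close> as
  \<open>h\<close> tends to \<open>0\<close>.
\<close>

lemma hardy2_zero_approx:
  fixes f :: "'h::complex_hilbert L2R"
  assumes f: "f \<in> hardy2" and t: "Im t > 0" and zero: "hardy_ext f t = 0"
  obtains g h where "g \<in> hardy2" "\<forall>n. h n > (0::real)"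
    "(\<lambda>n. (\<i> / h n) *\<^sub>C (g + (- exp (- (\<i> * h n * t))) *\<^sub>C modulate (h n) g)) \<longlonglongrightarrow> f"
proof -
  note F = hardy_ext_properties[OF f]
  obtain D where G: "hardy_function (\<lambda>z. if z = t then D else inverse (z - t) *\<^sub>C hardy_ext f z)"
    by (rule hardy_function_divide[OF F(1) t zero])
  define \<kappa> where "\<kappa> x = inverse (complex_of_real x - t)" for x
  have ne: "complex_of_real x \<noteq> t" for x using t by auto
  have sqg: "square_integrable (\<lambda>x. \<kappa> x *\<^sub>C rep_L2R f x)"
  proof (rule square_integrable_scaleC_fun[OF _ square_integrable_rep])
    show "\<kappa> \<in> borel_measurable lborel" unfolding \<kappa>_def[abs_def] by measurable
    show "cmod (\<kappa> x) \<le> inverse (Im t)" for x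
      unfolding \<kappa>_def norm_inverse
      using t abs_Im_le_cmod[of "complex_of_real x - t"] by (intro le_imp_inverse_le) auto
  qed
  define g where "g = abs_L2R (\<lambda>x. \<kappa> x *\<^sub>C rep_L2R f x)"
  have "has_boundary_values (\<lambda>z. if z = t then D else inverse (z - t) *\<^sub>C hardy_ext f z) g"
    using F(2) rep_abs_L2R[OF sqg] unfolding has_boundary_values_def
  proof eventually_elim
    case (elim x)
    have "((\<lambda>y. of_real x + \<i> * of_real y) \<longlongrightarrow> of_real x + \<i> * of_real 0) (at_right (0::real))"
      by (intro tendsto_intros)
    then have c: "((\<lambda>y. Complex x y) \<longlongrightarrow> of_real x) (at_right 0)" by (simp add: Complex_eq)
    have "((\<lambda>y. inverse (Complex x y - t) *\<^sub>C hardy_ext f (Complex x y)) \<longlongrightarrow> \<kappa> x *\<^sub>C rep_L2R f x) (at_right 0)"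
      unfolding \<kappa>_def by (intro tendsto_scaleC elim(1) tendsto_intros c) (simp add: ne)
    moreover have "\<forall>\<^sub>F y in at_right 0. Complex x y \<noteq> t"
      using c by (rule tendsto_imp_eventually_ne) (rule ne)
    then have "\<forall>\<^sub>F y in at_right 0. inverse (Complex x y - t) *\<^sub>C hardy_ext f (Complex x y)
        = (if Complex x y = t then D else inverse (Complex x y - t) *\<^sub>C hardy_ext f (Complex x y))"
      by (rule eventually_mono) simp
    ultimately have "((\<lambda>y. if Complex x y = t then D else inverse (Complex x y - t) *\<^sub>C hardy_ext f (Complex x y))
        \<longlongrightarrow> \<kappa> x *\<^sub>C rep_L2R f x) (at_right 0)"
      by (rule Lim_transform_eventually)
    then show ?case using elim(2) by (simp add: g_def)
  qed
  with G have g: "g \<in> hardy2" by (rule hardy_ext_eq(1))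
  define h where "h n = inverse (real (Suc n))" for n
  have h: "h n > 0" "h n \<le> 1" for n by (simp_all add: h_def inverse_le_1_iff)
  have h_lim: "h \<longlonglongrightarrow> 0" unfolding h_def[abs_def] by (rule LIMSEQ_inverse_real_of_nat)
  define m where "m n x = (\<i> / h n) * (1 - exp (\<i> * h n * (of_real x - t))) * \<kappa> x" for n x
  have m_meas: "m n \<in> borel_measurable lborel" for n
    unfolding m_def[abs_def] \<kappa>_def by measurable
  have m_bound: "cmod (m n x) \<le> exp (Im t)" for n x
  proof -
    have "cmod (1 - exp (\<i> * h n * (of_real x - t))) \<le> exp (Im t) * cmod (\<i> * h n * (of_real x - t))"
    proof (rule cmod_one_minus_exp_le)
      have "h n * Im t \<le> 1 * Im t" using h t by (intro mult_right_mono) auto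
      then show "Re (\<i> * h n * (of_real x - t)) \<le> Im t" by simp
    qed (use t in simp)
    also have "\<dots> = exp (Im t) * (h n * cmod (of_real x - t))"
      using h(1)[of n] by (simp add: norm_mult)
    finally have *: "cmod (1 - exp (\<i> * h n * (of_real x - t))) \<le> exp (Im t) * (h n * cmod (of_real x - t))" .
    have "cmod (m n x) = cmod (1 - exp (\<i> * h n * (of_real x - t))) / (h n * cmod (of_real x - t))"
      using h(1)[of n] by (simp add: m_def \<kappa>_def norm_mult norm_divide norm_inverse divide_inverse)
    also have "\<dots> \<le> exp (Im t)"
      using * h(1)[of n] ne[of x] by (simp add: pos_divide_le_eq)
    finally show ?thesis .
  qed
  have m_lim: "(\<lambda>n. m n x) \<longlonglongrightarrow> 1" for x
  proof -
    define a where "a = \<i> * (of_real x - t)"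
    have a: "a \<noteq> 0" using ne[of x] by (simp add: a_def)
    have "((\<lambda>z. (exp z - 1) / z) \<longlongrightarrow> 1) (at (0::complex))"
      using DERIV_exp[of "0::complex"] by (simp add: has_field_derivative_iff)
    moreover have "filterlim (\<lambda>n. of_real (h n) * a) (at 0) sequentially"
    proof -
      have "(\<lambda>n. of_real (h n) * a) \<longlonglongrightarrow> of_real 0 * a" by (intro tendsto_intros h_lim)
      then show ?thesis
        using a h(1) by (auto simp: filterlim_at less_imp_neq[THEN not_sym])
    qed
    ultimately have "(\<lambda>n. (exp (of_real (h n) * a) - 1) / (of_real (h n) * a)) \<longlonglongrightarrow> 1"
      by (rule filterlim_compose)
    moreover have "(exp (of_real (h n) * a) - 1) / (of_real (h n) * a) = m n x" for n
    proof -
      have "h n \<noteq> 0" using h(1)[of n] by simp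
      have e: "\<i> * of_real (h n) * (of_real x - t) = of_real (h n) * a" by (simp add: a_def)
      have k: "\<kappa> x = \<i> / a" using ne[of x] by (simp add: \<kappa>_def a_def field_simps)
      have "m n x = (\<i> / h n) * (1 - exp (of_real (h n) * a)) * (\<i> / a)"
        unfolding m_def e k ..
      also have "\<dots> = (exp (of_real (h n) * a) - 1) / (of_real (h n) * a)"
        using \<open>h n \<noteq> 0\<close> a by (simp add: field_simps)
      finally show ?thesis ..
    qed
    ultimately show ?thesis by simp
  qed
  have eq: "(\<i> / h n) *\<^sub>C (g + (- exp (- (\<i> * h n * t))) *\<^sub>C modulate (h n) g) = abs_L2R (\<lambda>x. m n x *\<^sub>C rep_L2R f x)" for n
  proof -
    define k where "k x = \<kappa> x *\<^sub>C rep_L2R f x" for x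
    have sqk: "square_integrable k" using sqg by (simp add: k_def[abs_def])
    have e: "iexp (h n * x) = exp (\<i> * h n * of_real x)" for x by (simp add: mult.assoc)
    have "(\<i> / h n) *\<^sub>C (g + (- exp (- (\<i> * h n * t))) *\<^sub>C modulate (h n) g)
        = abs_L2R (\<lambda>x. (\<i> / h n) *\<^sub>C (k x + (- exp (- (\<i> * h n * t))) *\<^sub>C iexp (h n * x) *\<^sub>C k x))"
      unfolding g_def k_def[symmetric]
      by (simp add: modulate_abs[OF sqk] scaleC_L2R_abs square_integrable_iexp[OF sqk] sqk square_integrable_scaleC
          add_L2R_abs square_integrable_add del: of_real_mult)
    also have "(\<lambda>x. (\<i> / h n) *\<^sub>C (k x + (- exp (- (\<i> * h n * t))) *\<^sub>C iexp (h n * x) *\<^sub>C k x))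
        = (\<lambda>x. m n x *\<^sub>C rep_L2R f x)"
    proof
      fix x
      have "exp (- (\<i> * h n * t)) * iexp (h n * x) = exp (\<i> * h n * (of_real x - t))"
        unfolding e exp_add[symmetric] by (simp add: algebra_simps)
      then have "k x + (- exp (- (\<i> * h n * t))) *\<^sub>C iexp (h n * x) *\<^sub>C k x = (1 - exp (\<i> * h n * (of_real x - t))) *\<^sub>C k x"
        by (simp add: scaleC_scaleC scaleC_diff_left scaleC_one scaleC_minus_left del: of_real_mult)
      then have "(\<i> / h n) *\<^sub>C (k x + (- exp (- (\<i> * h n * t))) *\<^sub>C iexp (h n * x) *\<^sub>C k x)
          = (\<i> / h n) *\<^sub>C (1 - exp (\<i> * h n * (of_real x - t))) *\<^sub>C k x"
        by (rule arg_cong)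
      also have "\<dots> = m n x *\<^sub>C rep_L2R f x"
        by (simp only: k_def m_def scaleC_scaleC mult.assoc)
      finally show "(\<i> / h n) *\<^sub>C (k x + (- exp (- (\<i> * h n * t))) *\<^sub>C iexp (h n * x) *\<^sub>C k x) = m n x *\<^sub>C rep_L2R f x" .
    qed
    finally show ?thesis .
  qed
  have "(\<lambda>n. abs_L2R (\<lambda>x. m n x *\<^sub>C rep_L2R f x)) \<longlonglongrightarrow> abs_L2R (rep_L2R f)"
  proof (rule L2R_dominated_convergence'[where K="exp (Im t)"])
    show "strongly_measurable (\<lambda>x. m n x *\<^sub>C rep_L2R f x)" for n
      by (rule strongly_measurable_scaleC_fun[OF m_meas strongly_measurable_rep])
    show "(\<lambda>n. m n x *\<^sub>C rep_L2R f x) \<longlonglongrightarrow> rep_L2R f x" for x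
      using tendsto_scaleC[OF m_lim tendsto_const, of x "rep_L2R f x"] by (simp add: scaleC_one)
    show "norm (m n x *\<^sub>C rep_L2R f x) \<le> exp (Im t) * norm (rep_L2R f x)" for n x
      unfolding norm_scaleC by (rule mult_right_mono[OF m_bound norm_ge_zero])
  qed (rule square_integrable_rep)
  then show thesis using that[OF g, of h] h(1) unfolding eq by simp
qed

text \<open>
  The boundary values of the Szego kernel of the upper half-plane at \<open>t\<close>, normalized so that its
  analytic extension has the value \<open>1\<close> at \<open>t\<close>.
\<close>

definition eval_kernel :: "complex \<Rightarrow> real \<Rightarrow> complex"
  where "eval_kernel t x = (t - cnj t) / (of_real x - cnj t)"

lemma square_integrable_eval_kernel:
  assumes t: "Im t > 0"
  shows "square_integrable (eval_kernel t)"
proof -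
  have "integrable lborel (\<lambda>x. (cmod (t - cnj t))\<^sup>2 * poisson t x)"
    using integrable_poisson[OF t] by simp
  moreover have "(norm (eval_kernel t x))\<^sup>2 = (cmod (t - cnj t))\<^sup>2 * poisson t x" for x
  proof -
    have "cmod (of_real x - cnj t) = cmod (cnj (of_real x - cnj t))" by (rule complex_mod_cnj[symmetric])
    then show ?thesis by (simp add: eval_kernel_def poisson_def norm_divide power_divide)
  qed
  moreover have "eval_kernel t \<in> borel_measurable borel"
    unfolding eval_kernel_def[abs_def] by measurable
  ultimately show ?thesis by (simp add: square_integrable_def strongly_measurable_iff_borel)
qed

lemma hardy2_eval_kernel:
  fixes v :: "'h::complex_hilbert"
  assumes t: "Im t > 0"
  shows "tensor (eval_kernel t) v \<in> hardy2" "hardy_ext (tensor (eval_kernel t) v) t = v"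
proof -
  define F where "F z = ((t - cnj t) / (z - cnj t)) *\<^sub>C v" for z
  note sq = square_integrable_tensor[OF square_integrable_eval_kernel[OF t], of v]
  have "analytic_upper (\<lambda>z. v)"
    unfolding analytic_upper_def
    using has_derivative_const[of v] by (auto intro!: exI[of _ 0])
  then have "analytic_upper F"
    unfolding F_def[abs_def]
    by (rule analytic_upper_scaleC_fun) (use t in \<open>auto intro!: holomorphic_intros\<close>)
  then have 1: "hardy_function F"
  proof (rule hardy_functionI[where G="\<lambda>y x. eval_kernel t x *\<^sub>C v"])
    show "square_integrable (\<lambda>x. eval_kernel t x *\<^sub>C v)" by (rule sq)
    show "L2_norm (\<lambda>x. eval_kernel t x *\<^sub>C v) \<le> L2_norm (\<lambda>x. eval_kernel t x *\<^sub>C v)" by simp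
    show "norm (F (Complex x y)) \<le> norm (eval_kernel t x *\<^sub>C v)" if y: "y > 0" for x y
    proof -
      have "cmod (of_real x - cnj t) \<le> cmod (Complex x y - cnj t)"
        unfolding cmod_def using t y by (auto intro!: real_sqrt_le_mono power_mono)
      moreover have "0 < cmod (of_real x - cnj t)" using t by (auto simp: complex_eq_iff)
      ultimately have "cmod (t - cnj t) / cmod (Complex x y - cnj t) \<le> cmod (t - cnj t) / cmod (of_real x - cnj t)"
        by (intro divide_left_mono mult_pos_pos) auto
      then have "cmod (t - cnj t) / cmod (Complex x y - cnj t) * norm v
          \<le> cmod (t - cnj t) / cmod (of_real x - cnj t) * norm v"
        by (rule mult_right_mono) simp
      then show ?thesis unfolding F_def eval_kernel_def norm_scaleC norm_divide .
    qed
  qed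
  have 2: "has_boundary_values F (tensor (eval_kernel t) v)"
    using rep_abs_L2R[OF sq] unfolding has_boundary_values_def tensor_def
  proof eventually_elim
    case (elim x)
    have "((\<lambda>y. of_real x + \<i> * of_real y) \<longlongrightarrow> of_real x + \<i> * of_real 0) (at_right (0::real))"
      by (intro tendsto_intros)
    then have c: "((\<lambda>y. Complex x y) \<longlongrightarrow> of_real x) (at_right 0)" by (simp add: Complex_eq)
    have "of_real x - cnj t \<noteq> 0" using t by (auto simp: complex_eq_iff)
    then show ?case
      unfolding elim unfolding F_def eval_kernel_def by (intro tendsto_scaleC tendsto_intros c)
  qed
  show "tensor (eval_kernel t) v \<in> hardy2" by (rule hardy_ext_eq(1)[OF 1 2])
  have "t - cnj t \<noteq> 0" using t by (auto simp: complex_eq_iff)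
  then have "F t = v" by (simp add: F_def scaleC_one)
  then show "hardy_ext (tensor (eval_kernel t) v) t = v" using hardy_ext_eq(2)[OF 1 2 t] by simp
qed

text \<open>
  An element vanishing at \<open>t\<close> is a limit of elements \<open>g - exp (- \<i> h t) * (exp (\<i> h _) g)\<close>, up to
  scalars. \<open>M\<close> maps these to elements of the same form with \<open>M g\<close> in place of \<open>g\<close>, and all
  elements of this form vanish at \<open>t\<close>. As evaluation at \<open>t\<close> is continuous, \<open>M\<close> preserves
  vanishing at \<open>t\<close>. Hence \<open>f\<close> may be replaced by the multiple \<open>hardy_ext f t\<close> of the kernel that
  has the same value at \<open>t\<close>, and \<open>S v\<close> is the value at \<open>t\<close> of \<open>M\<close> applied to the kernel times \<open>v\<close>.
\<close>

proposition modulation_invariant_operator_is_multiplication: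
  fixes M :: "'h::complex_hilbert L2R \<Rightarrow> 'h L2R"
  assumes M: "bounded_clinear M" and inv: "M ` hardy2 \<subseteq> hardy2"
    and comm: "\<And>h f. M (modulate h f) = modulate h (M f)" and t: "Im t > 0"
  obtains S where "bounded_clinear S" "\<And>f. f \<in> hardy2 \<Longrightarrow> hardy_ext (M f) t = S (hardy_ext f t)"
proof -
  obtain K where K: "\<And>(F :: complex \<Rightarrow> 'h) f. hardy_function F \<Longrightarrow> has_boundary_values F f \<Longrightarrow> norm (F t) \<le> K * norm f"
    using hardy_evaluation_bound[OF t] by blast
  have ev: "norm (hardy_ext f t) \<le> K * norm f" if "f \<in> hardy2" for f :: "'h L2R"
    by (rule K[OF hardy_ext_properties[OF that]])
  have MH: "M f \<in> hardy2" if "f \<in> hardy2" for f using inv that by blast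
  have lin: "M (f + c *\<^sub>C g) = M f + c *\<^sub>C M g" for f g c
    by (simp add: bounded_clinear_add[OF M] bounded_clinear_scaleC[OF M])
  have zero_mem: "(0 :: 'h L2R) \<in> hardy2"
    using hardy2_add_scaleC(1)[OF hardy2_eval_kernel(1)[OF t] hardy2_eval_kernel(1)[OF t], of 0 "-1" 0]
    by (simp add: scaleC_minus_one)
  have scale: "c *\<^sub>C f \<in> hardy2" "hardy_ext (c *\<^sub>C f) t = c *\<^sub>C hardy_ext f t"
    if "f \<in> hardy2" for c and f :: "'h L2R"
  proof -
    have "hardy_ext (0 :: 'h L2R) t = 0" using ev[OF zero_mem] by simp
    then show "c *\<^sub>C f \<in> hardy2" "hardy_ext (c *\<^sub>C f) t = c *\<^sub>C hardy_ext f t"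
      using hardy2_add_scaleC(1)[OF zero_mem that, of c] hardy2_add_scaleC(2)[OF zero_mem that t, of c]
      by simp_all
  qed
  have vanish: "hardy_ext (M f) t = 0" if f: "f \<in> hardy2" and zero: "hardy_ext f t = 0" for f
  proof -
    obtain g h where g: "g \<in> hardy2" and h: "\<forall>n. h n > (0::real)"
      and lim: "(\<lambda>n. (\<i> / h n) *\<^sub>C (g + (- exp (- (\<i> * h n * t))) *\<^sub>C modulate (h n) g)) \<longlonglongrightarrow> f"
      by (rule hardy2_zero_approx[OF f t zero])
    define f' where "f' n = (\<i> / h n) *\<^sub>C (g + (- exp (- (\<i> * h n * t))) *\<^sub>C modulate (h n) g)" for n
    have f'M: "M (f' n) = (\<i> / h n) *\<^sub>C (M g + (- exp (- (\<i> * h n * t))) *\<^sub>C modulate (h n) (M g))" for n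
      by (simp add: f'_def bounded_clinear_scaleC[OF M] lin comm)
    have mod: "modulate (h n) (M g) \<in> hardy2"
      "hardy_ext (modulate (h n) (M g)) t = exp (\<i> * h n * t) *\<^sub>C hardy_ext (M g) t" for n
      using hardy2_modulate[OF MH[OF g], of "h n"] h[rule_format, of n] t by auto
    have in1: "M g + (- exp (- (\<i> * h n * t))) *\<^sub>C modulate (h n) (M g) \<in> hardy2"
      and ext1: "hardy_ext (M g + (- exp (- (\<i> * h n * t))) *\<^sub>C modulate (h n) (M g)) t = 0" for n
    proof -
      show "M g + (- exp (- (\<i> * h n * t))) *\<^sub>C modulate (h n) (M g) \<in> hardy2"
        by (rule hardy2_add_scaleC(1)[OF MH[OF g] mod(1)])
      have "exp (- (\<i> * h n * t)) * exp (\<i> * h n * t) = 1" by (simp add: exp_minus)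
      then show "hardy_ext (M g + (- exp (- (\<i> * h n * t))) *\<^sub>C modulate (h n) (M g)) t = 0"
        unfolding hardy2_add_scaleC(2)[OF MH[OF g] mod(1) t] mod(2)
        by (simp add: scaleC_scaleC scaleC_minus_left scaleC_one)
    qed
    have f'0: "M (f' n) \<in> hardy2" "hardy_ext (M (f' n)) t = 0" for n
      unfolding f'M using scale[OF in1] ext1 by simp_all
    have "norm (hardy_ext (M f) t) \<le> K * norm (M f - M (f' n))" for n
    proof -
      have d: "M f - M (f' n) = M f + (-1) *\<^sub>C M (f' n)" by (simp add: scaleC_minus_one)
      have "hardy_ext (M f + (-1) *\<^sub>C M (f' n)) t = hardy_ext (M f) t"
        by (simp add: hardy2_add_scaleC(2)[OF MH[OF f] f'0(1) t] f'0(2))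
      then show ?thesis
        using ev[OF hardy2_add_scaleC(1)[OF MH[OF f] f'0(1)], of "-1" n] unfolding d by simp
    qed
    moreover have "(\<lambda>n. K * norm (M f - M (f' n))) \<longlonglongrightarrow> K * norm (M f - M f)"
      by (intro tendsto_intros bounded_clinear_tendsto[OF M]) (use lim in \<open>simp add: f'_def\<close>)
    ultimately have "norm (hardy_ext (M f) t) \<le> K * norm (M f - M f)"
      by (intro LIMSEQ_le_const[of "\<lambda>n. K * norm (M f - M (f' n))"]) auto
    then show ?thesis by simp
  qed
  define S where "S v = hardy_ext (M (tensor (eval_kernel t) v)) t" for v :: 'h
  note sqk = square_integrable_eval_kernel[OF t]
  note ker = hardy2_eval_kernel[OF t]
  have tens_lin: "tensor (eval_kernel t) (v + c *\<^sub>C w) = tensor (eval_kernel t) v + c *\<^sub>C tensor (eval_kernel t) w"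
    for v w :: 'h and c
  proof -
    have "tensor (eval_kernel t) v + c *\<^sub>C tensor (eval_kernel t) w = abs_L2R (\<lambda>x. eval_kernel t x *\<^sub>C v + c *\<^sub>C eval_kernel t x *\<^sub>C w)"
      unfolding tensor_def scaleC_L2R_abs[OF square_integrable_tensor[OF sqk]]
      by (intro add_L2R_abs square_integrable_scaleC square_integrable_tensor[OF sqk])
    then show ?thesis by (simp add: tensor_def scaleC_add_right scaleC_scaleC mult.commute)
  qed
  have S_lin: "S (v + c *\<^sub>C w) = S v + c *\<^sub>C S w" for v w c
    unfolding S_def tens_lin lin by (rule hardy2_add_scaleC(2)[OF MH[OF ker(1)] MH[OF ker(1)] t])
  have S: "hardy_ext (M f) t = S (hardy_ext f t)" if f: "f \<in> hardy2" for f
  proof -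
    define k where "k = tensor (eval_kernel t) (hardy_ext f t)"
    have k: "k \<in> hardy2" "hardy_ext k t = hardy_ext f t" by (simp_all add: k_def ker)
    have "hardy_ext (M (f + (-1) *\<^sub>C k)) t = 0"
      by (rule vanish[OF hardy2_add_scaleC(1)[OF f k(1)]])
        (subst hardy2_add_scaleC(2)[OF f k(1) t], simp add: k(2) scaleC_minus_one)
    then show ?thesis
      unfolding lin using hardy2_add_scaleC(2)[OF MH[OF f] MH[OF k(1)] t, of "-1"]
      by (simp add: scaleC_minus_one S_def k_def)
  qed
  obtain B where B: "\<And>f. norm (M f) \<le> norm f * B" "B \<ge> 0"
    using M bounded_linear.nonneg_bounded unfolding bounded_clinear_def by blast
  define N where "N = L2_norm (eval_kernel t)"
  have "norm (S v) \<le> (\<bar>K\<bar> * (N * B)) * norm v" for v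
  proof -
    have nt: "norm (tensor (eval_kernel t) v) = N * norm v"
    proof -
      have "norm (tensor (eval_kernel t) v) = L2_norm (\<lambda>x. eval_kernel t x *\<^sub>C v)"
        unfolding tensor_def by (rule norm_L2R_abs[OF square_integrable_tensor[OF sqk]])
      then show ?thesis by (simp add: L2_norm_def N_def norm_scaleC power_mult_distrib real_sqrt_mult)
    qed
    have "norm (S v) \<le> K * norm (M (tensor (eval_kernel t) v))"
      unfolding S_def by (rule ev[OF MH[OF ker(1)]])
    also have "\<dots> \<le> \<bar>K\<bar> * norm (M (tensor (eval_kernel t) v))" by (intro mult_right_mono) auto
    also have "\<dots> \<le> \<bar>K\<bar> * (norm (tensor (eval_kernel t) v) * B)" by (intro mult_left_mono B(1)) simp
    finally show ?thesis by (simp add: nt mult_ac)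
  qed
  moreover have "S (v + w) = S v + S w" for v w
    using S_lin[of v 1 w] by (simp add: scaleC_one)
  moreover have "S (c *\<^sub>C v) = c *\<^sub>C S v" for c v
  proof -
    have "S (0 + c *\<^sub>C v) = S 0 + c *\<^sub>C S v" by (rule S_lin)
    moreover have "S 0 = 0" using \<open>\<And>v. norm (S v) \<le> (\<bar>K\<bar> * (N * B)) * norm v\<close>[of 0] by simp
    ultimately show ?thesis by simp
  qed
  ultimately have "bounded_clinear S" by (intro bounded_clinearI)
  then show thesis using that S by blast
qed

theorem theorem6p4:
  fixes X :: "'h::complex_hilbert L2R \<Rightarrow> 'h L2R"
  assumes "bounded_clinear X"
    and "\<And>h. X \<circ> translation h = translation h \<circ> X"
    and "(fourier \<circ> X \<circ> inv fourier) ` hardy2 \<subseteq> hardy2"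
  shows "\<exists>S :: complex \<Rightarrow> 'h \<Rightarrow> 'h.
    (\<forall>t. Im t > 0 \<longrightarrow> bounded_clinear (S t)) \<and>
    (\<forall>f\<in>hardy2. \<forall>t. Im t > 0 \<longrightarrow>
      hardy_ext ((fourier \<circ> X \<circ> inv fourier) f) t = S t (hardy_ext f t))"
proof -
  obtain V :: "'h L2R \<Rightarrow> 'h L2R" where U: "bounded_clinear (fourier :: 'h L2R \<Rightarrow> 'h L2R)"
    and V: "bounded_clinear V" and inv: "inv fourier = V"
    and UV: "\<And>f. fourier (V f) = f" and VU: "\<And>f. V (fourier f) = f"
    and trans: "\<And>h (f :: 'h L2R). fourier (translation h f) = modulate (- h) (fourier f)"
    using fourier_unitary by blast
  define M where "M = fourier \<circ> X \<circ> inv fourier"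
  have M_eq: "M f = fourier (X (V f))" for f by (simp add: M_def inv)
  have M: "bounded_clinear M"
    unfolding M_eq[abs_def]
    by (intro bounded_clinear_compose[OF U] bounded_clinear_compose[OF assms(1)] V)
  have comm: "M (modulate h f) = modulate h (M f)" for h f
  proof -
    have "modulate h f = fourier (translation (- h) (V f))" by (simp add: trans UV)
    then have "V (modulate h f) = translation (- h) (V f)" by (simp add: VU)
    moreover have "X (translation (- h) (V f)) = translation (- h) (X (V f))"
      using fun_cong[OF assms(2)[of "- h"], of "V f"] by simp
    ultimately show ?thesis by (simp add: M_eq trans)
  qed
  have "\<exists>S. bounded_clinear S \<and> (\<forall>f\<in>hardy2. hardy_ext (M f) t = S (hardy_ext f t))" if "Im t > 0" for t
    using modulation_invariant_operator_is_multiplication[OF M assms(3)[folded M_def] comm that] by metis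
  then obtain S where "\<And>t. Im t > 0 \<Longrightarrow> bounded_clinear (S t) \<and> (\<forall>f\<in>hardy2. hardy_ext (M f) t = S t (hardy_ext f t))"
    by metis
  then show ?thesis unfolding M_def by (intro exI[of _ S]) blast
qed

end
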